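(* Let $\Gamma$ be a quiver with vertex set $V$, edge set $E$, and genera $\{g_v\}_{v\in V}$, $g_v\ge0$. Let $\Lambda_\Gamma$ be the associated collection of Legendrian Hopf links with capping surface $Q_\Gamma^\circ$ (the smooth locus of the strongly exact immersed zero section in the plumbing determined by $\Gamma$). The higher genus multiplicative pre-projective algebra $\mathscr{B}(\Gamma)$ is isomorphic to the degree $0$ homology of the corresponding capped Chekanov–Eliashberg algebra: \[ \mathscr{B}(\Gamma)\ \cong\ H_0\big(CE(\Lambda_\Gamma;\mathbb{C}[\pi_1(Q_\Gamma^\circ)])\big). \]
   Context: For $a\in E$ let $s(a),t(a)$ be the source and target vertices. Let $\mathbf{k}=\bigoplus_{v\in V}\mathbb{C}e_v$ with $e_v^2=e_v$, $e_ve_w=0$ for $v\ne w$. **Pre-projective algebra.** $\mathscr{B}(\Gamma)$ is the quotient of the tensor ring over $\mathbf{k}$ on the $\mathbf{k}$-bimodule with generators $p_a,q_a,t_a^{\pm1}$ ($a\in E$) and $x_{i,v}^{\pm1},y_{i,v}^{\pm1}$ ($v\in V$, $1\le i\le g_v$), where $e_{t(a)}p_a=p_ae_{s(a)}=p_a$, $e_{s(a)}q_a=q_ae_{t(a)}=q_a$, $e_{s(a)}t_a=t_ae_{s(a)}=t_a$, $e_vx_{i,v}=x_{i,v}e_v=x_{i,v}$, $e_vy_{i,v}=y_{i,v}e_v=y_{i,v}$ (similarly for inverses; all other actions of idempotents are zero), by the relations: $t_at_a^{-1}=t_a^{-1}t_a=e_{s(a)}$; $x_{i,v}^{\pm1}$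 and $y_{i,v}^{\pm1}$ are mutually inverse with unit $e_v$; $e_{s(a)}+q_ap_a=t_a$ for $a\in E$; and, for each $v\in V$, \[ \prod_{t(a)=v}(e_v+p_aq_a)=R_{g_v}^{-1}\prod_{s(a)=v}(e_v+q_ap_a),\qquad R_{g_v}=\prod_{i=1}^{g_v}[x_{i,v},y_{i,v}], \] where the products are in some fixed order (immaterial up to isomorphism) and $[x,y]=xyx^{-1}y^{-1}$. **Geometric side.** Let $X_\Gamma$ be the plumbing of cotangent bundles of closed oriented surfaces of genus $g_v$, $v\in V$, using the underlying graph of $\Gamma$, with all intersections positive. Let $Q_\Gamma\subset X_\Gamma$ be the union of the zero sections (a strongly exact immersed Lagrangian with double points in bijection with $E$), and $Q_\Gamma^\circ$ its complement of double points, with components $Q_v^\circ$. In a small standard contact 3-sphere around the double point of $b\in E$, $Q_\Gamma$ intersects in a Hopf link, represented by the generic Hopf link $\Lambda_{\mathrm{Ho}}$ in a small Darboux ball; $\Lambda_\Gamma$ is the union of all these. The Reeb chord $p_b$ starts on the component of the link lying in $Q^\circ_{s(b)}$ and ends on that lying in $Q^\circ_{t(b)}$; the chord $q_b$ goes in the opposite direction. **Capped Chekanov–Eliashberg algebra.** Choose base points on the components $Q_v^\circ$ and capping paths to chord endpoints. $CE(\Lambda_\Gamma;\mathbb{C}[\pi_1(Q_\Gamma^\circ)])$ is the dg-algebra generated over $\bigoplus_v\mathbb{C}[\pi_1(Q_v^\circ)]$ (semi-simple sum, $e_v$ = the constant loop) by the degree-$0$ chords $p_b,q_b$ and degree-$1$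 chords $a_{1,b},a_{2,b}$, $b\in E$, as composable words, with differential satisfying the Leibniz rule, zero on loops, $p_b$ and $q_b$, and counting rigid holomorphic disks in the symplectization with one positive puncture: \[ \partial a_{1,b}=e_{s(b)}-t_b+q_bp_b,\qquad \partial a_{2,b}=e_{t(b)}-s_b+p_bq_b . \] Here $t_b\in\pi_1(Q^\circ_{s(b)})$ and $s_b\in\pi_1(Q^\circ_{t(b)})$ are the loops around the two ends at the double point $b$, depending on the capping paths. The capping paths can be chosen so that $\pi_1(Q^\circ_v)$ is generated by $\{s_b\}_{t(b)=v}\cup\{t_b\}_{s(b)=v}\cup\{x_{i,v},y_{i,v}\}_{i\le g_v}$ with the relation $\prod_{t(b)=v}s_b=\big(\prod_i x_{i,v}y_{i,v}x_{i,v}^{-1}y_{i,v}^{-1}\big)^{-1}\prod_{s(b)=v}t_b$. (Long chords not in the Darboux balls may be ignored, as they do not change the homology.) *)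

theory Defs
  imports
    "HOL-Algebra.QuotRing"
    "HOL-Homology.Homology"
    "HOL-Complex_Analysis.Complex_Analysis"
    "Graph_Theory.Digraph"
begin

section \<open>Tensor rings over semisimple sums of group algebras\<close>

text \<open>
  Let \<open>Q\<close> be a quiver and let \<open>G v\<close> be a group for every vertex \<open>v\<close>. The tensor ring of the free
  bimodule on the arrows of \<open>Q\<close> over \<open>\<Oplus>\<^sub>v \<complex>[G v]\<close> has as basis the composable words
  \<open>\<gamma>\<^sub>0 c\<^sub>1 \<gamma>\<^sub>1 \<dots> c\<^sub>n \<gamma>\<^sub>n\<close> with \<open>c\<^sub>i\<close> an arrow and \<open>\<gamma>\<^sub>i\<close> a group element at the vertex between
  \<open>c\<^sub>i\<close> and \<open>c\<^sub>i\<^sub>+\<^sub>1\<close>. Words compose from right to left, so that \<open>c = e\<^sub>h c e\<^sub>t\<close> for an arrow \<open>c\<close> from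
  \<open>t\<close> to \<open>h\<close>. With all the groups trivial, this is the tensor ring over \<open>k = \<Oplus>\<^sub>v \<complex>e\<^sub>v\<close>.
\<close>

datatype ('v, 'g, 'c) word =
    Base 'v 'g
  | Arrow 'v 'g 'c "('v, 'g, 'c) word"

primrec left_end :: "('v, 'g, 'c) word \<Rightarrow> 'v" where
  "left_end (Base v \<gamma>) = v"
| "left_end (Arrow v \<gamma> c w) = v"

primrec is_word ::
  "('v, 'c) pre_digraph \<Rightarrow> ('v \<Rightarrow> 'g monoid) \<Rightarrow> ('v, 'g, 'c) word \<Rightarrow> bool" where
  "is_word Q G (Base v \<gamma>) \<longleftrightarrow> v \<in> verts Q \<and> \<gamma> \<in> carrier (G v)"
| "is_word Q G (Arrow v \<gamma> c w) \<longleftrightarrow> v \<in> verts Q \<and> \<gamma> \<in> carrier (G v) \<and>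
     c \<in> arcs Q \<and> head Q c = v \<and> tail Q c = left_end w \<and> is_word Q G w"

primrec act_left :: "('v \<Rightarrow> 'g monoid) \<Rightarrow> 'g \<Rightarrow> ('v, 'g, 'c) word \<Rightarrow> ('v, 'g, 'c) word" where
  "act_left G \<gamma> (Base v \<gamma>') = Base v (\<gamma> \<otimes>\<^bsub>G v\<^esub> \<gamma>')"
| "act_left G \<gamma> (Arrow v \<gamma>' c w) = Arrow v (\<gamma> \<otimes>\<^bsub>G v\<^esub> \<gamma>') c w"

primrec word_mult ::
  "('v \<Rightarrow> 'g monoid) \<Rightarrow> ('v, 'g, 'c) word \<Rightarrow> ('v, 'g, 'c) word \<Rightarrow> ('v, 'g, 'c) word option" where
  "word_mult G (Base v \<gamma>) w' = (if left_end w' = v then Some (act_left G \<gamma> w') else None)"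
| "word_mult G (Arrow v \<gamma> c w) w' = map_option (Arrow v \<gamma> c) (word_mult G w w')"

text \<open>The product of non-composable words is zero, and \<open>1 = \<Sum>\<^sub>v e\<^sub>v\<close>.\<close>

definition tensor_ring ::
  "('v, 'c) pre_digraph \<Rightarrow> ('v \<Rightarrow> 'g monoid) \<Rightarrow> (('v, 'g, 'c) word \<Rightarrow> complex) ring" where
  "tensor_ring Q G =
    \<lparr> carrier = {f. finite {w. f w \<noteq> 0} \<and> (\<forall>w. f w \<noteq> 0 \<longrightarrow> is_word Q G w)},
      monoid.mult = (\<lambda>f g w. \<Sum>(u, u') | f u \<noteq> 0 \<and> g u' \<noteq> 0 \<and> word_mult G u u' = Some w. f u * g u'),
      monoid.one = (\<lambda>w. if \<exists>v\<in>verts Q. w = Base v \<one>\<^bsub>G v\<^esub> then 1 else 0),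
      ring.zero = (\<lambda>w. 0),
      ring.add = (\<lambda>f g w. f w + g w) \<rparr>"

definition scaled_word :: "complex \<Rightarrow> ('v, 'g, 'c) word \<Rightarrow> ('v, 'g, 'c) word \<Rightarrow> complex" where
  "scaled_word z w = (\<lambda>u. if u = w then z else 0)"

abbreviation single_word :: "('v, 'g, 'c) word \<Rightarrow> ('v, 'g, 'c) word \<Rightarrow> complex" where
  "single_word \<equiv> scaled_word 1"

definition idem :: "('v \<Rightarrow> 'g monoid) \<Rightarrow> 'v \<Rightarrow> ('v, 'g, 'c) word \<Rightarrow> complex" where
  "idem G v = single_word (Base v \<one>\<^bsub>G v\<^esub>)"

definition gen ::
  "('v, 'c) pre_digraph \<Rightarrow> ('v \<Rightarrow> 'g monoid) \<Rightarrow> 'c \<Rightarrow> ('v, 'g, 'c) word \<Rightarrow> complex" where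
  "gen Q G c = single_word (Arrow (head Q c) \<one>\<^bsub>G (head Q c)\<^esub> c (Base (tail Q c) \<one>\<^bsub>G (tail Q c)\<^esub>))"

text \<open>
  A ring under \<open>k = \<Oplus>\<^sub>v \<complex>e\<^sub>v\<close> is given here by the images \<open>\<eta> v z\<close> of the elements \<open>z e\<^sub>v\<close>; an
  isomorphism compatible with them is \<open>k\<close>-bilinear, in particular \<open>\<complex>\<close>-linear.
\<close>

definition isomorphic_over_k ::
  "'v set \<Rightarrow> ('a, 'm) ring_scheme \<Rightarrow> ('v \<Rightarrow> complex \<Rightarrow> 'a) \<Rightarrow>
   ('b, 'n) ring_scheme \<Rightarrow> ('v \<Rightarrow> complex \<Rightarrow> 'b) \<Rightarrow> bool" where
  "isomorphic_over_k V A \<eta>A B \<eta>B \<longleftrightarrow>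
     (\<exists>\<phi> \<in> ring_iso A B. \<forall>v\<in>V. \<forall>z. \<phi> (\<eta>A v z) = \<eta>B v z)"


section \<open>The higher genus multiplicative pre-projective algebra\<close>

text \<open>
  An edge \<open>a\<close> of the quiver \<open>\<Gamma>\<close> has source \<open>tail \<Gamma> a\<close> and target \<open>head \<Gamma> a\<close>. The lists \<open>ins v\<close>
  and \<open>outs v\<close> fix the orders of the products over the edges ending and starting at \<open>v\<close>.
\<close>

definition edge_orders ::
  "('v, 'e) pre_digraph \<Rightarrow> ('v \<Rightarrow> 'e list) \<Rightarrow> ('v \<Rightarrow> 'e list) \<Rightarrow> bool" where
  "edge_orders \<Gamma> ins outs \<longleftrightarrow> (\<forall>v\<in>verts \<Gamma>.
     distinct (ins v) \<and> set (ins v) = {a \<in> arcs \<Gamma>. head \<Gamma> a = v} \<and>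
     distinct (outs v) \<and> set (outs v) = {a \<in> arcs \<Gamma>. tail \<Gamma> a = v})"

datatype ('v, 'e) preproj_gen =
    Gen_p 'e | Gen_q 'e
  | Gen_t 'e | Gen_t_inv 'e
  | Gen_x 'v nat | Gen_x_inv 'v nat
  | Gen_y 'v nat | Gen_y_inv 'v nat

primrec preproj_source :: "('v, 'e) pre_digraph \<Rightarrow> ('v, 'e) preproj_gen \<Rightarrow> 'v" where
  "preproj_source \<Gamma> (Gen_p a) = tail \<Gamma> a"
| "preproj_source \<Gamma> (Gen_q a) = head \<Gamma> a"
| "preproj_source \<Gamma> (Gen_t a) = tail \<Gamma> a"
| "preproj_source \<Gamma> (Gen_t_inv a) = tail \<Gamma> a"
| "preproj_source \<Gamma> (Gen_x v i) = v"
| "preproj_source \<Gamma> (Gen_x_inv v i) = v"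
| "preproj_source \<Gamma> (Gen_y v i) = v"
| "preproj_source \<Gamma> (Gen_y_inv v i) = v"

primrec preproj_target :: "('v, 'e) pre_digraph \<Rightarrow> ('v, 'e) preproj_gen \<Rightarrow> 'v" where
  "preproj_target \<Gamma> (Gen_p a) = head \<Gamma> a"
| "preproj_target \<Gamma> (Gen_q a) = tail \<Gamma> a"
| "preproj_target \<Gamma> (Gen_t a) = tail \<Gamma> a"
| "preproj_target \<Gamma> (Gen_t_inv a) = tail \<Gamma> a"
| "preproj_target \<Gamma> (Gen_x v i) = v"
| "preproj_target \<Gamma> (Gen_x_inv v i) = v"
| "preproj_target \<Gamma> (Gen_y v i) = v"
| "preproj_target \<Gamma> (Gen_y_inv v i) = v"

definition preproj_quiver ::
  "('v, 'e) pre_digraph \<Rightarrow> ('v \<Rightarrow> nat) \<Rightarrow> ('v, ('v, 'e) preproj_gen) pre_digraph" where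
  "preproj_quiver \<Gamma> g =
    \<lparr> verts = verts \<Gamma>,
      arcs = (\<Union>a\<in>arcs \<Gamma>. {Gen_p a, Gen_q a, Gen_t a, Gen_t_inv a}) \<union>
        (\<Union>v\<in>verts \<Gamma>. \<Union>i\<in>{1..g v}. {Gen_x v i, Gen_x_inv v i, Gen_y v i, Gen_y_inv v i}),
      tail = preproj_source \<Gamma>,
      head = preproj_target \<Gamma> \<rparr>"

abbreviation trivial_groups :: "'v \<Rightarrow> unit monoid" where
  "trivial_groups \<equiv> (\<lambda>v. singleton_group ())"

definition preproj_tensor_ring ::
  "('v, 'e) pre_digraph \<Rightarrow> ('v \<Rightarrow> nat) \<Rightarrow> (('v, unit, ('v, 'e) preproj_gen) word \<Rightarrow> complex) ring" where
  "preproj_tensor_ring \<Gamma> g = tensor_ring (preproj_quiver \<Gamma> g) trivial_groups"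

text \<open>
  Each pair consists of the two sides of a defining relation. In the last one, the inverse of
  \<open>\<Prod>\<^sub>i [x\<^sub>i, y\<^sub>i]\<close> is expanded by means of \<open>[x, y]\<^sup>-\<^sup>1 = y x y\<^sup>-\<^sup>1 x\<^sup>-\<^sup>1\<close>, because the \<open>x\<^sub>i\<close> and \<open>y\<^sub>i\<close> become
  invertible only in the quotient.
\<close>

definition preproj_relations ::
  "('v, 'e) pre_digraph \<Rightarrow> ('v \<Rightarrow> nat) \<Rightarrow> ('v \<Rightarrow> 'e list) \<Rightarrow> ('v \<Rightarrow> 'e list) \<Rightarrow>
   ((('v, unit, ('v, 'e) preproj_gen) word \<Rightarrow> complex) \<times>
    (('v, unit, ('v, 'e) preproj_gen) word \<Rightarrow> complex)) set" where
  "preproj_relations \<Gamma> g ins outs =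
    (let R = preproj_tensor_ring \<Gamma> g;
         e = idem trivial_groups;
         \<iota> = gen (preproj_quiver \<Gamma> g) trivial_groups;
         product = (\<lambda>v xs. foldr (\<lambda>x y. x \<otimes>\<^bsub>R\<^esub> y) xs (e v))
     in (\<Union>a\<in>arcs \<Gamma>.
          {(\<iota> (Gen_t a) \<otimes>\<^bsub>R\<^esub> \<iota> (Gen_t_inv a), e (tail \<Gamma> a)),
           (\<iota> (Gen_t_inv a) \<otimes>\<^bsub>R\<^esub> \<iota> (Gen_t a), e (tail \<Gamma> a)),
           (e (tail \<Gamma> a) \<oplus>\<^bsub>R\<^esub> \<iota> (Gen_q a) \<otimes>\<^bsub>R\<^esub> \<iota> (Gen_p a), \<iota> (Gen_t a))}) \<union>
        (\<Union>v\<in>verts \<Gamma>. \<Union>i\<in>{1..g v}.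
          {(\<iota> (Gen_x v i) \<otimes>\<^bsub>R\<^esub> \<iota> (Gen_x_inv v i), e v),
           (\<iota> (Gen_x_inv v i) \<otimes>\<^bsub>R\<^esub> \<iota> (Gen_x v i), e v),
           (\<iota> (Gen_y v i) \<otimes>\<^bsub>R\<^esub> \<iota> (Gen_y_inv v i), e v),
           (\<iota> (Gen_y_inv v i) \<otimes>\<^bsub>R\<^esub> \<iota> (Gen_y v i), e v)}) \<union>
        (\<Union>v\<in>verts \<Gamma>.
          {(product v (map (\<lambda>a. e v \<oplus>\<^bsub>R\<^esub> \<iota> (Gen_p a) \<otimes>\<^bsub>R\<^esub> \<iota> (Gen_q a)) (ins v)),
            product v (concat (map
              (\<lambda>i. [\<iota> (Gen_y v i), \<iota> (Gen_x v i), \<iota> (Gen_y_inv v i), \<iota> (Gen_x_inv v i)])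
              (rev [1..<Suc (g v)])))
            \<otimes>\<^bsub>R\<^esub> product v (map (\<lambda>a. e v \<oplus>\<^bsub>R\<^esub> \<iota> (Gen_q a) \<otimes>\<^bsub>R\<^esub> \<iota> (Gen_p a)) (outs v)))}))"

definition preproj_ideal ::
  "('v, 'e) pre_digraph \<Rightarrow> ('v \<Rightarrow> nat) \<Rightarrow> ('v \<Rightarrow> 'e list) \<Rightarrow> ('v \<Rightarrow> 'e list) \<Rightarrow>
   (('v, unit, ('v, 'e) preproj_gen) word \<Rightarrow> complex) set" where
  "preproj_ideal \<Gamma> g ins outs =
    genideal (preproj_tensor_ring \<Gamma> g)
      {l \<ominus>\<^bsub>preproj_tensor_ring \<Gamma> g\<^esub> r | l r. (l, r) \<in> preproj_relations \<Gamma> g ins outs}"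

definition preproj_algebra ::
  "('v, 'e) pre_digraph \<Rightarrow> ('v \<Rightarrow> nat) \<Rightarrow> ('v \<Rightarrow> 'e list) \<Rightarrow> ('v \<Rightarrow> 'e list) \<Rightarrow>
   (('v, unit, ('v, 'e) preproj_gen) word \<Rightarrow> complex) set ring" where
  "preproj_algebra \<Gamma> g ins outs =
    preproj_tensor_ring \<Gamma> g Quot preproj_ideal \<Gamma> g ins outs"

definition preproj_of_k ::
  "('v, 'e) pre_digraph \<Rightarrow> ('v \<Rightarrow> nat) \<Rightarrow> ('v \<Rightarrow> 'e list) \<Rightarrow> ('v \<Rightarrow> 'e list) \<Rightarrow> 'v \<Rightarrow> complex \<Rightarrow>
   (('v, unit, ('v, 'e) preproj_gen) word \<Rightarrow> complex) set" where
  "preproj_of_k \<Gamma> g ins outs v z =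
    preproj_ideal \<Gamma> g ins outs +>\<^bsub>preproj_tensor_ring \<Gamma> g\<^esub> scaled_word z (Base v ())"


section \<open>Fundamental groups and group presentations\<close>

definition loop_class :: "'s::topological_space set \<Rightarrow> (real \<Rightarrow> 's) \<Rightarrow> (real \<Rightarrow> 's) set" where
  "loop_class S p = {q. homotopic_paths S p q}"

definition is_loop :: "'s::topological_space set \<Rightarrow> 's \<Rightarrow> (real \<Rightarrow> 's) \<Rightarrow> bool" where
  "is_loop S x p \<longleftrightarrow> path p \<and> path_image p \<subseteq> S \<and> pathstart p = x \<and> pathfinish p = x"

definition fundamental_group :: "'s::topological_space set \<Rightarrow> 's \<Rightarrow> (real \<Rightarrow> 's) set monoid" where
  "fundamental_group S x =
    \<lparr> carrier = loop_class S ` {p. is_loop S x p},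
      monoid.mult = (\<lambda>A B. \<Union>p\<in>A. \<Union>q\<in>B. loop_class S (p +++ q)),
      monoid.one = loop_class S (\<lambda>_. x) \<rparr>"

text \<open>
  A group word is a list of letters \<open>(x, b)\<close>, which stand for the generator \<open>x\<close> if \<open>b\<close> is false
  and for its inverse if \<open>b\<close> is true. A relation is a pair of words.
\<close>

type_synonym 'x gword = "('x \<times> bool) list"

definition inverse_gword :: "'x gword \<Rightarrow> 'x gword" where
  "inverse_gword w = rev (map (\<lambda>(x, b). (x, \<not> b)) w)"

definition gword_value :: "('a, 'm) monoid_scheme \<Rightarrow> ('x \<Rightarrow> 'a) \<Rightarrow> 'x gword \<Rightarrow> 'a" where
  "gword_value G h w =
    foldr (\<lambda>(x, b) y. (if b then inv\<^bsub>G\<^esub> (h x) else h x) \<otimes>\<^bsub>G\<^esub> y) w \<one>\<^bsub>G\<^esub>"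

inductive gword_equiv :: "'x set \<Rightarrow> ('x gword \<times> 'x gword) set \<Rightarrow> 'x gword \<Rightarrow> 'x gword \<Rightarrow> bool"
  for X Rels where
  refl: "gword_equiv X Rels w w"
| sym: "gword_equiv X Rels w w' \<Longrightarrow> gword_equiv X Rels w' w"
| trans: "gword_equiv X Rels w w' \<Longrightarrow> gword_equiv X Rels w' w'' \<Longrightarrow> gword_equiv X Rels w w''"
| cancel: "x \<in> X \<Longrightarrow> gword_equiv X Rels (u @ [(x, b), (x, \<not> b)] @ u') (u @ u')"
| relation: "(l, r) \<in> Rels \<Longrightarrow> gword_equiv X Rels (u @ l @ u') (u @ r @ u')"

definition is_presentation ::
  "('a, 'm) monoid_scheme \<Rightarrow> 'x set \<Rightarrow> ('x \<Rightarrow> 'a) \<Rightarrow> ('x gword \<times> 'x gword) set \<Rightarrow> bool" where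
  "is_presentation G X h Rels \<longleftrightarrow>
    h ` X \<subseteq> carrier G \<and>
    carrier G \<subseteq> gword_value G h ` lists (X \<times> UNIV) \<and>
    (\<forall>w \<in> lists (X \<times> UNIV). \<forall>w' \<in> lists (X \<times> UNIV).
       gword_value G h w = gword_value G h w' \<longleftrightarrow> gword_equiv X Rels w w')"


section \<open>The zero section of the plumbing\<close>

definition is_chart :: "'s::topological_space set \<Rightarrow> 's set \<times> ('s \<Rightarrow> complex) \<Rightarrow> bool" where
  "is_chart S = (\<lambda>(U, \<phi>). openin (top_of_set S) U \<and> open (\<phi> ` U) \<and>
     homeomorphism U (\<phi> ` U) \<phi> (inv_into U \<phi>))"

text \<open>
  A transition map between plane domains preserves orientation iff it maps small circles
  around a point to curves with winding number one around the image of the point.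
\<close>

definition compatibly_oriented ::
  "'s::topological_space set \<times> ('s \<Rightarrow> complex) \<Rightarrow> 's set \<times> ('s \<Rightarrow> complex) \<Rightarrow> bool" where
  "compatibly_oriented = (\<lambda>(U, \<phi>) (W, \<psi>). \<forall>x \<in> U \<inter> W. \<exists>r>0.
     cball (\<phi> x) r \<subseteq> \<phi> ` (U \<inter> W) \<and>
     winding_number (\<psi> \<circ> inv_into U \<phi> \<circ> circlepath (\<phi> x) r) (\<psi> x) = 1)"

text \<open>The genus is half the rank of the first homology group.\<close>

definition closed_oriented_surface ::
  "nat \<Rightarrow> 's::topological_space set \<Rightarrow> ('s set \<times> ('s \<Rightarrow> complex)) set \<Rightarrow> bool" where
  "closed_oriented_surface g S \<A> \<longleftrightarrow>
     compact S \<and> connected S \<and> S \<noteq> {} \<and> Hausdorff_space (top_of_set S) \<and>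
     (\<forall>c\<in>\<A>. is_chart S c) \<and> (\<Union>c\<in>\<A>. fst c) = S \<and>
     (\<forall>c\<in>\<A>. \<forall>c'\<in>\<A>. compatibly_oriented c c') \<and>
     homology_group 1 (top_of_set S) \<cong> free_Abelian_group {..<2 * g}"

text \<open>
  The immersed zero section \<open>Q\<^sub>\<Gamma>\<close> is the union of closed surfaces \<open>surf v\<close> in which, for every
  edge \<open>b\<close>, the point \<open>puncture (Tail_end b)\<close> of the surface at the source of \<open>b\<close> is identified with
  the point \<open>puncture (Head_end b)\<close> of the surface at the target of \<open>b\<close>; this is the double point of
  \<open>b\<close>. The Hopf link around it has one component in each of the two sheets, namely a circle in
  the chart \<open>disc_chart\<close> of radius \<open>disc_radius\<close>.
\<close>

datatype 'e edge_end = Tail_end 'e | Head_end 'e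

primrec end_vertex :: "('v, 'e) pre_digraph \<Rightarrow> 'e edge_end \<Rightarrow> 'v" where
  "end_vertex \<Gamma> (Tail_end b) = tail \<Gamma> b"
| "end_vertex \<Gamma> (Head_end b) = head \<Gamma> b"

definition edge_ends :: "('v, 'e) pre_digraph \<Rightarrow> 'e edge_end set" where
  "edge_ends \<Gamma> = Tail_end ` arcs \<Gamma> \<union> Head_end ` arcs \<Gamma>"

definition ends_at :: "('v, 'e) pre_digraph \<Rightarrow> 'v \<Rightarrow> 'e edge_end set" where
  "ends_at \<Gamma> v = {\<epsilon> \<in> edge_ends \<Gamma>. end_vertex \<Gamma> \<epsilon> = v}"

record ('v, 'e, 's) zero_section =
  surf :: "'v \<Rightarrow> 's set"
  atlas :: "'v \<Rightarrow> ('s set \<times> ('s \<Rightarrow> complex)) set"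
  puncture :: "'e edge_end \<Rightarrow> 's"
  disc_chart :: "'e edge_end \<Rightarrow> 's set \<times> ('s \<Rightarrow> complex)"
  disc_radius :: "'e edge_end \<Rightarrow> real"

definition plumbing_zero_section ::
  "('v, 'e) pre_digraph \<Rightarrow> ('v \<Rightarrow> nat) \<Rightarrow> ('v, 'e, 's::topological_space) zero_section \<Rightarrow> bool" where
  "plumbing_zero_section \<Gamma> g Z \<longleftrightarrow>
    (\<forall>v\<in>verts \<Gamma>. closed_oriented_surface (g v) (surf Z v) (atlas Z v) \<and>
       puncture Z ` ends_at \<Gamma> v \<subseteq> surf Z v \<and> inj_on (puncture Z) (ends_at \<Gamma> v)) \<and>
    (\<forall>\<epsilon>\<in>edge_ends \<Gamma>. case disc_chart Z \<epsilon> of (U, \<phi>) \<Rightarrow>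
       (U, \<phi>) \<in> atlas Z (end_vertex \<Gamma> \<epsilon>) \<and> puncture Z \<epsilon> \<in> U \<and> 0 < disc_radius Z \<epsilon> \<and>
       cball (\<phi> (puncture Z \<epsilon>)) (disc_radius Z \<epsilon>) \<subseteq> \<phi> ` U \<and>
       (\<forall>\<epsilon>' \<in> ends_at \<Gamma> (end_vertex \<Gamma> \<epsilon>). \<epsilon>' \<noteq> \<epsilon> \<longrightarrow>
          puncture Z \<epsilon>' \<notin> inv_into U \<phi> ` cball (\<phi> (puncture Z \<epsilon>)) (disc_radius Z \<epsilon>)))"

definition smooth_locus ::
  "('v, 'e) pre_digraph \<Rightarrow> ('v, 'e, 's) zero_section \<Rightarrow> 'v \<Rightarrow> 's set" where
  "smooth_locus \<Gamma> Z v = surf Z v - puncture Z ` ends_at \<Gamma> v"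

definition link_component :: "('v, 'e, 's) zero_section \<Rightarrow> 'e edge_end \<Rightarrow> real \<Rightarrow> 's" where
  "link_component Z \<epsilon> = (case disc_chart Z \<epsilon> of (U, \<phi>) \<Rightarrow>
     inv_into U \<phi> \<circ> circlepath (\<phi> (puncture Z \<epsilon>)) (disc_radius Z \<epsilon>))"


section \<open>Capping paths\<close>

record ('v, 'e, 's) capping_system =
  base_point :: "'v \<Rightarrow> 's"
  capping_path :: "'e edge_end \<Rightarrow> real \<Rightarrow> 's"
  x_loop :: "'v \<Rightarrow> nat \<Rightarrow> real \<Rightarrow> 's"
  y_loop :: "'v \<Rightarrow> nat \<Rightarrow> real \<Rightarrow> 's"

definition pi1 ::
  "('v, 'e) pre_digraph \<Rightarrow> ('v, 'e, 's::topological_space) zero_section \<Rightarrow>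
   ('v, 'e, 's) capping_system \<Rightarrow> 'v \<Rightarrow> (real \<Rightarrow> 's) set monoid" where
  "pi1 \<Gamma> Z K v = fundamental_group (smooth_locus \<Gamma> Z v) (base_point K v)"

text \<open>
  The relation between the generators of the fundamental group requires the loops \<open>s\<^sub>b\<close> and \<open>t\<^sub>b\<close>
  to encircle the double points in opposite senses.
\<close>

definition s_class ::
  "('v, 'e) pre_digraph \<Rightarrow> ('v, 'e, 's::topological_space) zero_section \<Rightarrow>
   ('v, 'e, 's) capping_system \<Rightarrow> 'e \<Rightarrow> (real \<Rightarrow> 's) set" where
  "s_class \<Gamma> Z K b = loop_class (smooth_locus \<Gamma> Z (head \<Gamma> b))
     (capping_path K (Head_end b) +++ link_component Z (Head_end b)
        +++ reversepath (capping_path K (Head_end b)))"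

definition t_class ::
  "('v, 'e) pre_digraph \<Rightarrow> ('v, 'e, 's::topological_space) zero_section \<Rightarrow>
   ('v, 'e, 's) capping_system \<Rightarrow> 'e \<Rightarrow> (real \<Rightarrow> 's) set" where
  "t_class \<Gamma> Z K b = loop_class (smooth_locus \<Gamma> Z (tail \<Gamma> b))
     (capping_path K (Tail_end b) +++ reversepath (link_component Z (Tail_end b))
        +++ reversepath (capping_path K (Tail_end b)))"

datatype 'e surface_gen = Surf_s 'e | Surf_t 'e | Surf_x nat | Surf_y nat

definition surface_gens :: "('v, 'e) pre_digraph \<Rightarrow> ('v \<Rightarrow> nat) \<Rightarrow> 'v \<Rightarrow> 'e surface_gen set" where
  "surface_gens \<Gamma> g v =
     Surf_s ` {b \<in> arcs \<Gamma>. head \<Gamma> b = v} \<union> Surf_t ` {b \<in> arcs \<Gamma>. tail \<Gamma> b = v} \<union>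
     Surf_x ` {1..g v} \<union> Surf_y ` {1..g v}"

primrec surface_gen_class ::
  "('v, 'e) pre_digraph \<Rightarrow> ('v, 'e, 's::topological_space) zero_section \<Rightarrow>
   ('v, 'e, 's) capping_system \<Rightarrow> 'v \<Rightarrow> 'e surface_gen \<Rightarrow> (real \<Rightarrow> 's) set" where
  "surface_gen_class \<Gamma> Z K v (Surf_s b) = s_class \<Gamma> Z K b"
| "surface_gen_class \<Gamma> Z K v (Surf_t b) = t_class \<Gamma> Z K b"
| "surface_gen_class \<Gamma> Z K v (Surf_x i) = loop_class (smooth_locus \<Gamma> Z v) (x_loop K v i)"
| "surface_gen_class \<Gamma> Z K v (Surf_y i) = loop_class (smooth_locus \<Gamma> Z v) (y_loop K v i)"

definition surface_relation ::
  "nat \<Rightarrow> 'e list \<Rightarrow> 'e list \<Rightarrow> 'e surface_gen gword \<times> 'e surface_gen gword" where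
  "surface_relation g ins outs =
    (map (\<lambda>b. (Surf_s b, False)) ins,
     inverse_gword (concat (map
       (\<lambda>i. [(Surf_x i, False), (Surf_y i, False), (Surf_x i, True), (Surf_y i, True)])
       [1..<Suc g]))
     @ map (\<lambda>b. (Surf_t b, False)) outs)"

definition adapted_capping_system ::
  "('v, 'e) pre_digraph \<Rightarrow> ('v \<Rightarrow> nat) \<Rightarrow> ('v \<Rightarrow> 'e list) \<Rightarrow> ('v \<Rightarrow> 'e list) \<Rightarrow>
   ('v, 'e, 's::topological_space) zero_section \<Rightarrow> ('v, 'e, 's) capping_system \<Rightarrow> bool" where
  "adapted_capping_system \<Gamma> g ins outs Z K \<longleftrightarrow>
    (\<forall>v\<in>verts \<Gamma>. base_point K v \<in> smooth_locus \<Gamma> Z v) \<and>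
    (\<forall>\<epsilon>\<in>edge_ends \<Gamma>. path (capping_path K \<epsilon>) \<and>
       path_image (capping_path K \<epsilon>) \<subseteq> smooth_locus \<Gamma> Z (end_vertex \<Gamma> \<epsilon>) \<and>
       pathstart (capping_path K \<epsilon>) = base_point K (end_vertex \<Gamma> \<epsilon>) \<and>
       pathfinish (capping_path K \<epsilon>) = pathstart (link_component Z \<epsilon>)) \<and>
    (\<forall>v\<in>verts \<Gamma>. \<forall>i\<in>{1..g v}.
       is_loop (smooth_locus \<Gamma> Z v) (base_point K v) (x_loop K v i) \<and>
       is_loop (smooth_locus \<Gamma> Z v) (base_point K v) (y_loop K v i)) \<and>
    (\<forall>v\<in>verts \<Gamma>. is_presentation (pi1 \<Gamma> Z K v) (surface_gens \<Gamma> g v)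
       (surface_gen_class \<Gamma> Z K v) {surface_relation (g v) (ins v) (outs v)})"


section \<open>The capped Chekanov--Eliashberg algebra\<close>

datatype 'e chord = Chord_p 'e | Chord_q 'e | Chord_a1 'e | Chord_a2 'e

primrec chord_start :: "('v, 'e) pre_digraph \<Rightarrow> 'e chord \<Rightarrow> 'v" where
  "chord_start \<Gamma> (Chord_p b) = tail \<Gamma> b"
| "chord_start \<Gamma> (Chord_q b) = head \<Gamma> b"
| "chord_start \<Gamma> (Chord_a1 b) = tail \<Gamma> b"
| "chord_start \<Gamma> (Chord_a2 b) = head \<Gamma> b"

primrec chord_end :: "('v, 'e) pre_digraph \<Rightarrow> 'e chord \<Rightarrow> 'v" where
  "chord_end \<Gamma> (Chord_p b) = head \<Gamma> b"
| "chord_end \<Gamma> (Chord_q b) = tail \<Gamma> b"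
| "chord_end \<Gamma> (Chord_a1 b) = tail \<Gamma> b"
| "chord_end \<Gamma> (Chord_a2 b) = head \<Gamma> b"

primrec chord_degree :: "'e chord \<Rightarrow> nat" where
  "chord_degree (Chord_p b) = 0"
| "chord_degree (Chord_q b) = 0"
| "chord_degree (Chord_a1 b) = 1"
| "chord_degree (Chord_a2 b) = 1"

definition chord_quiver :: "('v, 'e) pre_digraph \<Rightarrow> ('v, 'e chord) pre_digraph" where
  "chord_quiver \<Gamma> =
    \<lparr> verts = verts \<Gamma>,
      arcs = (\<Union>b\<in>arcs \<Gamma>. {Chord_p b, Chord_q b, Chord_a1 b, Chord_a2 b}),
      tail = chord_start \<Gamma>,
      head = chord_end \<Gamma> \<rparr>"

type_synonym ('v, 'e, 's) ce_elem = "('v, (real \<Rightarrow> 's) set, 'e chord) word \<Rightarrow> complex"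

definition CE ::
  "('v, 'e) pre_digraph \<Rightarrow> ('v, 'e, 's::topological_space) zero_section \<Rightarrow>
   ('v, 'e, 's) capping_system \<Rightarrow> ('v, 'e, 's) ce_elem ring" where
  "CE \<Gamma> Z K = tensor_ring (chord_quiver \<Gamma>) (pi1 \<Gamma> Z K)"

primrec word_degree :: "('v, 'g, 'e chord) word \<Rightarrow> nat" where
  "word_degree (Base v \<gamma>) = 0"
| "word_degree (Arrow v \<gamma> c w) = chord_degree c + word_degree w"

definition CE_degree ::
  "('v, 'e) pre_digraph \<Rightarrow> ('v, 'e, 's::topological_space) zero_section \<Rightarrow>
   ('v, 'e, 's) capping_system \<Rightarrow> nat \<Rightarrow> ('v, 'e, 's) ce_elem set" where
  "CE_degree \<Gamma> Z K n = {f \<in> carrier (CE \<Gamma> Z K). \<forall>w. f w \<noteq> 0 \<longrightarrow> word_degree w = n}"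

text \<open>
  The values on chords are the counts of rigid disks with one positive puncture for the
  generic Hopf link in a Darboux ball.
\<close>

primrec chord_diff ::
  "('v, 'e) pre_digraph \<Rightarrow> ('v, 'e, 's::topological_space) zero_section \<Rightarrow>
   ('v, 'e, 's) capping_system \<Rightarrow> 'e chord \<Rightarrow> ('v, 'e, 's) ce_elem" where
  "chord_diff \<Gamma> Z K (Chord_p b) = \<zero>\<^bsub>CE \<Gamma> Z K\<^esub>"
| "chord_diff \<Gamma> Z K (Chord_q b) = \<zero>\<^bsub>CE \<Gamma> Z K\<^esub>"
| "chord_diff \<Gamma> Z K (Chord_a1 b) =
     (idem (pi1 \<Gamma> Z K) (tail \<Gamma> b)
        \<ominus>\<^bsub>CE \<Gamma> Z K\<^esub> single_word (Base (tail \<Gamma> b) (t_class \<Gamma> Z K b)))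
     \<oplus>\<^bsub>CE \<Gamma> Z K\<^esub> gen (chord_quiver \<Gamma>) (pi1 \<Gamma> Z K) (Chord_q b)
        \<otimes>\<^bsub>CE \<Gamma> Z K\<^esub> gen (chord_quiver \<Gamma>) (pi1 \<Gamma> Z K) (Chord_p b)"
| "chord_diff \<Gamma> Z K (Chord_a2 b) =
     (idem (pi1 \<Gamma> Z K) (head \<Gamma> b)
        \<ominus>\<^bsub>CE \<Gamma> Z K\<^esub> single_word (Base (head \<Gamma> b) (s_class \<Gamma> Z K b)))
     \<oplus>\<^bsub>CE \<Gamma> Z K\<^esub> gen (chord_quiver \<Gamma>) (pi1 \<Gamma> Z K) (Chord_p b)
        \<otimes>\<^bsub>CE \<Gamma> Z K\<^esub> gen (chord_quiver \<Gamma>) (pi1 \<Gamma> Z K) (Chord_q b)"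

text \<open>The second equation is the Leibniz rule for the product of \<open>\<gamma> c\<close> and \<open>w\<close>.\<close>

primrec word_diff ::
  "('v, 'e) pre_digraph \<Rightarrow> ('v, 'e, 's::topological_space) zero_section \<Rightarrow>
   ('v, 'e, 's) capping_system \<Rightarrow> ('v, (real \<Rightarrow> 's) set, 'e chord) word \<Rightarrow>
   ('v, 'e, 's) ce_elem" where
  "word_diff \<Gamma> Z K (Base v \<gamma>) = \<zero>\<^bsub>CE \<Gamma> Z K\<^esub>"
| "word_diff \<Gamma> Z K (Arrow v \<gamma> c w) =
     single_word (Base v \<gamma>) \<otimes>\<^bsub>CE \<Gamma> Z K\<^esub> chord_diff \<Gamma> Z K c \<otimes>\<^bsub>CE \<Gamma> Z K\<^esub> single_word w
     \<oplus>\<^bsub>CE \<Gamma> Z K\<^esub> scaled_word ((-1) ^ chord_degree c)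
           (Arrow v \<gamma> c (Base (chord_start \<Gamma> c) \<one>\<^bsub>pi1 \<Gamma> Z K (chord_start \<Gamma> c)\<^esub>))
        \<otimes>\<^bsub>CE \<Gamma> Z K\<^esub> word_diff \<Gamma> Z K w"

definition CE_diff ::
  "('v, 'e) pre_digraph \<Rightarrow> ('v, 'e, 's::topological_space) zero_section \<Rightarrow>
   ('v, 'e, 's) capping_system \<Rightarrow> ('v, 'e, 's) ce_elem \<Rightarrow> ('v, 'e, 's) ce_elem" where
  "CE_diff \<Gamma> Z K f = (\<lambda>u. \<Sum>w | f w \<noteq> 0. f w * word_diff \<Gamma> Z K w u)"

definition CE_cycles0 ::
  "('v, 'e) pre_digraph \<Rightarrow> ('v, 'e, 's::topological_space) zero_section \<Rightarrow>
   ('v, 'e, 's) capping_system \<Rightarrow> ('v, 'e, 's) ce_elem ring" where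
  "CE_cycles0 \<Gamma> Z K = (CE \<Gamma> Z K)
     \<lparr>carrier := {f \<in> CE_degree \<Gamma> Z K 0. CE_diff \<Gamma> Z K f = \<zero>\<^bsub>CE \<Gamma> Z K\<^esub>}\<rparr>"

definition CE_boundaries0 ::
  "('v, 'e) pre_digraph \<Rightarrow> ('v, 'e, 's::topological_space) zero_section \<Rightarrow>
   ('v, 'e, 's) capping_system \<Rightarrow> ('v, 'e, 's) ce_elem set" where
  "CE_boundaries0 \<Gamma> Z K = CE_diff \<Gamma> Z K ` CE_degree \<Gamma> Z K 1"

definition CE_homology0 ::
  "('v, 'e) pre_digraph \<Rightarrow> ('v, 'e, 's::topological_space) zero_section \<Rightarrow>
   ('v, 'e, 's) capping_system \<Rightarrow> ('v, 'e, 's) ce_elem set ring" where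
  "CE_homology0 \<Gamma> Z K = CE_cycles0 \<Gamma> Z K Quot CE_boundaries0 \<Gamma> Z K"

definition CE_homology0_of_k ::
  "('v, 'e) pre_digraph \<Rightarrow> ('v, 'e, 's::topological_space) zero_section \<Rightarrow>
   ('v, 'e, 's) capping_system \<Rightarrow> 'v \<Rightarrow> complex \<Rightarrow> ('v, 'e, 's) ce_elem set" where
  "CE_homology0_of_k \<Gamma> Z K v z =
     CE_boundaries0 \<Gamma> Z K +>\<^bsub>CE_cycles0 \<Gamma> Z K\<^esub> scaled_word z (Base v \<one>\<^bsub>pi1 \<Gamma> Z K v\<^esub>)"

end

theory Submission
  imports Defs
begin

text \<open>
  Both algebras are generated by the arrows \<open>p\<^sub>b\<close>, \<open>q\<^sub>b\<close> together with invertible loops at the vertices.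
  In degree zero of the Chekanov--Eliashberg algebra everything is a cycle, and the boundaries of
  the long chords identify the loops \<open>t\<^sub>b\<close> and \<open>s\<^sub>b\<close> with \<open>e + q\<^sub>b p\<^sub>b\<close> and \<open>e + p\<^sub>b q\<^sub>b\<close>. What remains of the
  presentation of \<open>\<pi>\<^sub>1(Q\<^sub>v)\<close> is that the \<open>x\<^sub>i\<close>, \<open>y\<^sub>i\<close>, \<open>t\<^sub>b\<close> and \<open>s\<^sub>b\<close> are invertible and that the surface relation
  holds, which after this substitution is the relation of the pre-projective algebra at \<open>v\<close>. The
  pre-projective algebra does not ask for an inverse of \<open>e + p\<^sub>b q\<^sub>b\<close>, but the inverse exists because
  \<open>e + q\<^sub>b p\<^sub>b = t\<^sub>b\<close> has one (\<open>one_plus_swap\<close>).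

  To turn this into a proof, the degree zero cycles are recognized as a tensor ring on the short
  chords (\<open>CE_cycles0_eq\<close>), and the boundaries as a two-sided ideal that is contained in every ideal
  containing the differentials of the long chords (\<open>ideal_boundaries\<close>, \<open>boundaries_subset_ideal\<close>). Both
  facts come from the Leibniz rule, in which short chords contribute neither terms nor signs.
  A homomorphism from a tensor ring to a complex algebra amounts to compatible images of the
  groups and of the arrows (locale \<open>tensor_representation\<close>). This yields \<open>\<Phi>\<close> from the free
  pre-projective tensor ring to the homology, and \<open>\<Psi>\<close> from the cycles to the pre-projective algebra;
  the images of the loops under \<open>\<Psi>\<close> are given by the universal property of the presentation of \<open>\<pi>\<^sub>1(Q\<^sub>v)\<close>
  (\<open>presented_group_hom\<close>), applied to the group of units of the corner ring at \<open>v\<close>. Both maps respect the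
  relations (\<open>\<Phi>_relation\<close>, \<open>\<Psi>_boundaries\<close>), hence descend to the quotients, and the induced maps are
  inverse to each other since their composites fix generators (\<open>left_inverse\<close>, \<open>right_inverse\<close>).
\<close>

section \<open>The fundamental group of a subset of a topological space\<close>

text \<open>
  A path is a continuous map on the unit interval, so a homotopy between paths in the interval can
  be transported along it. This reduces the group laws up to homotopy in any topological space to
  the interval, where constant paths are segments.
\<close>

lemma homotopic_paths_compose_path:
  fixes p :: "real \<Rightarrow> 's::topological_space"
  assumes "path p" "path_image p \<subseteq> S" "homotopic_paths {0..1} a b"
  shows "homotopic_paths S (p \<circ> a) (p \<circ> b)"
  using homotopic_paths_continuous_image[OF assms(3), of p S] assms(1,2)
  by (auto simp: path_def path_image_def)

lemma linepath_0_1: "linepath 0 1 = (\<lambda>t::real. t)"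
  by (auto simp: linepath_def)

lemma compose_linepath_const: "p \<circ> linepath a a = (\<lambda>_. p a)"
  by (simp add: linepath_def fun_eq_iff scaleR_add_left[symmetric])

lemma
  fixes p :: "real \<Rightarrow> 's::topological_space"
  assumes p: "path p" "path_image p \<subseteq> S"
  shows homotopic_paths_const_join: "homotopic_paths S ((\<lambda>_. pathstart p) +++ p) p"
    and homotopic_paths_reversepath_join: "homotopic_paths S (reversepath p +++ p) (\<lambda>_. pathfinish p)"
proof -
  let ?i = "linepath 0 (1::real)"
  have i: "path ?i" "path_image ?i \<subseteq> {0..1}" "p \<circ> ?i = p"
    by (auto simp: linepath_0_1 path_image_def path_def)
  have rev: "p \<circ> linepath 1 0 = reversepath p"
    by (auto simp: linepath_def reversepath_def)
  note c = path_compose_join path_compose_reversepath i(3) compose_linepath_const rev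
  show "homotopic_paths S ((\<lambda>_. pathstart p) +++ p) p"
    using homotopic_paths_compose_path[OF p homotopic_paths_lid[OF i(1,2)]]
    by (simp add: c) (simp add: pathstart_def)
  show "homotopic_paths S (reversepath p +++ p) (\<lambda>_. pathfinish p)"
    using homotopic_paths_compose_path[OF p homotopic_paths_linv[OF i(1,2)]]
    by (simp add: c) (simp add: pathfinish_def)
qed

lemma loop_class_eq_iff:
  assumes "path p" "path_image p \<subseteq> S"
  shows "loop_class S p = loop_class S q \<longleftrightarrow> homotopic_paths S p q"
proof
  assume "loop_class S p = loop_class S q"
  moreover have "p \<in> loop_class S p"
    using assms by (simp add: loop_class_def)
  ultimately show "homotopic_paths S p q"
    by (simp add: loop_class_def homotopic_paths_sym)
next
  assume "homotopic_paths S p q"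
  then show "loop_class S p = loop_class S q"
    unfolding loop_class_def by (blast intro: homotopic_paths_trans homotopic_paths_sym)
qed

lemma is_loop_join: "is_loop S x p \<Longrightarrow> is_loop S x q \<Longrightarrow> is_loop S x (p +++ q)"
  by (auto simp: is_loop_def path_image_join)

lemma loop_class_mult:
  assumes "is_loop S x p" "is_loop S x q"
  shows "loop_class S p \<otimes>\<^bsub>fundamental_group S x\<^esub> loop_class S q = loop_class S (p +++ q)"
proof -
  have "loop_class S (p' +++ q') = loop_class S (p +++ q)"
    if "p' \<in> loop_class S p" "q' \<in> loop_class S q" for p' q'
  proof -
    have "homotopic_paths S (p +++ q) (p' +++ q')"
      using that assms by (intro homotopic_paths_join) (auto simp: loop_class_def is_loop_def)
    then show ?thesis
      using loop_class_eq_iff homotopic_paths_imp_path homotopic_paths_imp_subset by metis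
  qed
  moreover have "p \<in> loop_class S p" "q \<in> loop_class S q"
    using assms by (auto simp: loop_class_def is_loop_def)
  ultimately have "(\<Union>p'\<in>loop_class S p. \<Union>q'\<in>loop_class S q. loop_class S (p' +++ q')) = loop_class S (p +++ q)"
    by blast
  then show ?thesis
    by (simp add: fundamental_group_def)
qed

lemma group_fundamental_group:
  assumes x: "x \<in> S"
  shows "group (fundamental_group S x)"
proof -
  let ?G = "fundamental_group S x"
  have carr: "carrier ?G = loop_class S ` {p. is_loop S x p}" and one: "\<one>\<^bsub>?G\<^esub> = loop_class S (\<lambda>_. x)"
    by (auto simp: fundamental_group_def)
  have const: "is_loop S x (\<lambda>_. x)"
    using x by (auto simp: is_loop_def path_def path_image_def pathstart_def pathfinish_def)
  have rev: "is_loop S x (reversepath p)" if "is_loop S x p" for p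
    using that by (auto simp: is_loop_def)
  have eq: "loop_class S p = loop_class S q" if "homotopic_paths S p q" for p q
    using that loop_class_eq_iff homotopic_paths_imp_path homotopic_paths_imp_subset by metis
  have loopD: "path p" "path_image p \<subseteq> S" "pathstart p = x" "pathfinish p = x" if "is_loop S x p" for p
    using that by (auto simp: is_loop_def)
  show ?thesis
  proof (rule groupI)
    show "A \<otimes>\<^bsub>?G\<^esub> B \<in> carrier ?G" if "A \<in> carrier ?G" "B \<in> carrier ?G" for A B
      using that by (auto simp: carr loop_class_mult intro!: imageI is_loop_join)
    show "\<one>\<^bsub>?G\<^esub> \<in> carrier ?G"
      using const by (auto simp: carr one)
    show "A \<otimes>\<^bsub>?G\<^esub> B \<otimes>\<^bsub>?G\<^esub> C = A \<otimes>\<^bsub>?G\<^esub> (B \<otimes>\<^bsub>?G\<^esub> C)"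
      if ABC: "A \<in> carrier ?G" "B \<in> carrier ?G" "C \<in> carrier ?G" for A B C
    proof -
      obtain p q r where pqr: "is_loop S x p" "A = loop_class S p" "is_loop S x q" "B = loop_class S q"
        "is_loop S x r" "C = loop_class S r"
        using ABC by (auto simp: carr)
      have "loop_class S (p +++ (q +++ r)) = loop_class S ((p +++ q) +++ r)"
        using pqr by (intro eq homotopic_paths_assoc) (auto simp: is_loop_def)
      then show ?thesis
        using pqr by (simp add: loop_class_mult is_loop_join)
    qed
    show "\<one>\<^bsub>?G\<^esub> \<otimes>\<^bsub>?G\<^esub> A = A" if A: "A \<in> carrier ?G" for A
    proof -
      obtain p where p: "is_loop S x p" "A = loop_class S p"
        using A by (auto simp: carr)
      show ?thesis
        using eq[OF homotopic_paths_const_join[OF loopD(1,2)[OF p(1)]]] p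
        by (simp add: one loop_class_mult[OF const] loopD(3))
    qed
    show "\<exists>B\<in>carrier ?G. B \<otimes>\<^bsub>?G\<^esub> A = \<one>\<^bsub>?G\<^esub>" if A: "A \<in> carrier ?G" for A
    proof -
      obtain p where p: "is_loop S x p" "A = loop_class S p"
        using A by (auto simp: carr)
      have "loop_class S (reversepath p) \<otimes>\<^bsub>?G\<^esub> A = \<one>\<^bsub>?G\<^esub>"
        using eq[OF homotopic_paths_reversepath_join[OF loopD(1,2)[OF p(1)]]] p
        by (simp add: one loop_class_mult rev loopD(4))
      moreover have "loop_class S (reversepath p) \<in> carrier ?G"
        using rev[OF p(1)] by (auto simp: carr)
      ultimately show ?thesis by blast
    qed
  qed
qed


section \<open>Homomorphisms out of a presented group\<close>

lemma gword_value_simps [simp]: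
  "gword_value G h [] = \<one>\<^bsub>G\<^esub>"
  "gword_value G h ((x, b) # w) = (if b then inv\<^bsub>G\<^esub> (h x) else h x) \<otimes>\<^bsub>G\<^esub> gword_value G h w"
  by (simp_all add: gword_value_def)

lemma (in group) gword_value_closed [simp]:
  "w \<in> lists (X \<times> UNIV) \<Longrightarrow> h ` X \<subseteq> carrier G \<Longrightarrow> gword_value G h w \<in> carrier G"
  by (induction w) (auto intro!: m_closed simp: subset_iff)

lemma (in group) gword_value_append:
  "w \<in> lists (X \<times> UNIV) \<Longrightarrow> w' \<in> lists (X \<times> UNIV) \<Longrightarrow> h ` X \<subseteq> carrier G \<Longrightarrow>
    gword_value G h (w @ w') = gword_value G h w \<otimes> gword_value G h w'"
proof (induction w)
  case (Cons a w)
  obtain x b where a: "a = (x, b)" by force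
  show ?case
    using Cons gword_value_closed[of w X h] gword_value_closed[of w' X h]
    by (auto simp: a m_assoc subset_iff)
qed simp

text \<open>
  A derivation of an equivalence may pass through words with letters outside of \<open>X\<close>; this is why all
  values of \<open>k\<close> are required to lie in the group.
\<close>

lemma (in group) gword_value_equiv:
  assumes "gword_equiv X Rels w w'"
    and k: "range k \<subseteq> carrier G"
    and rels: "\<And>l r. (l, r) \<in> Rels \<Longrightarrow> gword_value G k l = gword_value G k r"
  shows "gword_value G k w = gword_value G k w'"
  using assms(1)
proof induction
  case (cancel x u b u')
  have app: "gword_value G k (v @ v') = gword_value G k v \<otimes> gword_value G k v'"
    and cl: "gword_value G k v \<in> carrier G" for v v'
    using gword_value_append[of v UNIV v' k] gword_value_closed[of v UNIV k] k by auto
  have "k x \<in> carrier G"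
    using k by auto
  then have "gword_value G k ([(x, b), (x, \<not> b)] @ u') = gword_value G k u'"
    using cl[of u'] inv_closed[of "k x"] by (cases b) (simp_all add: m_assoc[symmetric])
  then show ?case
    by (simp add: app del: append.simps)
next
  case (relation l r u u')
  have app: "gword_value G k (v @ v') = gword_value G k v \<otimes> gword_value G k v'" for v v'
    using gword_value_append[of v UNIV v' k] k by auto
  show ?case
    using rels[OF relation] by (simp add: app)
qed simp_all

lemma gword_value_cong:
  "w \<in> lists (X \<times> UNIV) \<Longrightarrow> (\<And>x. x \<in> X \<Longrightarrow> h x = h' x) \<Longrightarrow> gword_value G h w = gword_value G h' w"
  by (induction w) (auto split: prod.splits)

lemma (in group_hom) hom_gword_value:
  "w \<in> lists (X \<times> UNIV) \<Longrightarrow> k ` X \<subseteq> carrier G \<Longrightarrow>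
    h (gword_value G k w) = gword_value H (h \<circ> k) w"
proof (induction w)
  case (Cons a w)
  obtain x b where a: "a = (x, b)" by force
  show ?case
    using Cons G.gword_value_closed[of w X k]
    by (auto simp: a subset_iff)
qed simp

text \<open>
  The universal property of a presentation: an element is sent to the value of any word that
  represents it, and two such words have equal values because they are equivalent.
\<close>

lemma presented_group_hom:
  assumes G: "group G" and pres: "is_presentation G X h Rels" and H: "group H"
    and k: "k ` X \<subseteq> carrier H"
    and letters: "Rels \<subseteq> lists (X \<times> UNIV) \<times> lists (X \<times> UNIV)"
    and rels: "\<And>l r. (l, r) \<in> Rels \<Longrightarrow> gword_value H k l = gword_value H k r"
  obtains \<theta> where "\<theta> \<in> hom G H" "\<And>x. x \<in> X \<Longrightarrow> \<theta> (h x) = k x"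
proof -
  interpret G: group G by fact
  interpret H: group H by fact
  let ?W = "lists (X \<times> (UNIV :: bool set))"
  have hX: "h ` X \<subseteq> carrier G"
    and onto: "\<And>\<gamma>. \<gamma> \<in> carrier G \<Longrightarrow> \<exists>w\<in>?W. gword_value G h w = \<gamma>"
    and equiv: "\<And>w w'. w \<in> ?W \<Longrightarrow> w' \<in> ?W \<Longrightarrow> gword_value G h w = gword_value G h w' \<Longrightarrow>
      gword_equiv X Rels w w'"
    using pres unfolding is_presentation_def by blast+
  \<comment> \<open>Extending \<open>k\<close> by \<open>\<one>\<close> gives a value to every word in a derivation of an equivalence.\<close>
  define k' where "k' x = (if x \<in> X then k x else \<one>\<^bsub>H\<^esub>)" for x
  have k': "range k' \<subseteq> carrier H" "k' ` X \<subseteq> carrier H"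
    using k by (auto simp: k'_def)
  have kk': "gword_value H k w = gword_value H k' w" if "w \<in> ?W" for w
    using that by (rule gword_value_cong) (simp add: k'_def)
  define rep where "rep \<gamma> = (SOME w. w \<in> ?W \<and> gword_value G h w = \<gamma>)" for \<gamma>
  have rep: "rep \<gamma> \<in> ?W" "gword_value G h (rep \<gamma>) = \<gamma>" if "\<gamma> \<in> carrier G" for \<gamma>
    using someI_ex[of "\<lambda>w. w \<in> ?W \<and> gword_value G h w = \<gamma>"] onto[OF that]
    unfolding rep_def by blast+
  define \<theta> where "\<theta> \<gamma> = gword_value H k' (rep \<gamma>)" for \<gamma>
  have \<theta>: "\<theta> (gword_value G h w) = gword_value H k' w" if w: "w \<in> ?W" for w
  proof -
    have c: "gword_value G h w \<in> carrier G"
      using w hX by simp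
    have "gword_equiv X Rels (rep (gword_value G h w)) w"
      using rep[OF c] w by (intro equiv) auto
    then show ?thesis
      unfolding \<theta>_def using k'(1)
    proof (rule H.gword_value_equiv)
      show "gword_value H k' l = gword_value H k' r" if "(l, r) \<in> Rels" for l r
        using rels[OF that] that letters by (simp add: kk' subset_iff)
    qed
  qed
  show ?thesis
  proof
    show "\<theta> \<in> hom G H"
    proof (rule homI)
      show "\<theta> \<gamma> \<in> carrier H" if "\<gamma> \<in> carrier G" for \<gamma>
        unfolding \<theta>_def using rep(1)[OF that] k'(2) by (rule H.gword_value_closed)
      show "\<theta> (\<gamma> \<otimes>\<^bsub>G\<^esub> \<gamma>') = \<theta> \<gamma> \<otimes>\<^bsub>H\<^esub> \<theta> \<gamma>'" if g: "\<gamma> \<in> carrier G" "\<gamma>' \<in> carrier G" for \<gamma> \<gamma>'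
      proof -
        have "\<gamma> \<otimes>\<^bsub>G\<^esub> \<gamma>' = gword_value G h (rep \<gamma> @ rep \<gamma>')"
          using rep[OF g(1)] rep[OF g(2)] hX by (simp add: G.gword_value_append)
        then have "\<theta> (\<gamma> \<otimes>\<^bsub>G\<^esub> \<gamma>') = gword_value H k' (rep \<gamma> @ rep \<gamma>')"
          using \<theta>[of "rep \<gamma> @ rep \<gamma>'"] rep[OF g(1)] rep[OF g(2)] by simp
        then show ?thesis
          using rep[OF g(1)] rep[OF g(2)] k'(2) by (simp add: H.gword_value_append \<theta>_def)
      qed
    qed
    show "\<theta> (h x) = k x" if "x \<in> X" for x
      using \<theta>[of "[(x, False)]"] that hX k by (auto simp: k'_def image_subset_iff)
  qed
qed

lemma presented_group_hom_unique:
  assumes "group_hom G H \<theta>" "group_hom G H \<theta>'" and pres: "is_presentation G X h Rels"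
    and eq: "\<And>x. x \<in> X \<Longrightarrow> \<theta> (h x) = \<theta>' (h x)" and "\<gamma> \<in> carrier G"
  shows "\<theta> \<gamma> = \<theta>' \<gamma>"
proof -
  have hX: "h ` X \<subseteq> carrier G"
    using pres unfolding is_presentation_def by blast
  obtain w where w: "w \<in> lists (X \<times> UNIV)" "\<gamma> = gword_value G h w"
    using pres assms(5) unfolding is_presentation_def by blast
  show ?thesis
    unfolding w(2) group_hom.hom_gword_value[OF assms(1) w(1) hX]
      group_hom.hom_gword_value[OF assms(2) w(1) hX]
    using w(1) by (rule gword_value_cong) (simp add: eq)
qed

section \<open>Tensor rings\<close>

primrec right_end :: "('v, 'g, 'c) word \<Rightarrow> 'v" where
  "right_end (Base v \<gamma>) = v"
| "right_end (Arrow v \<gamma> c w) = right_end w"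

text \<open>
  The value of a word when group elements act by \<open>\<rho>\<close> and arrows by \<open>\<kappa>\<close>; its linear extension is the
  homomorphism of the universal property.
\<close>

primrec word_value ::
  "('a, 'm) monoid_scheme \<Rightarrow> ('v \<Rightarrow> 'g \<Rightarrow> 'a) \<Rightarrow> ('c \<Rightarrow> 'a) \<Rightarrow> ('v, 'g, 'c) word \<Rightarrow> 'a" where
  "word_value A \<rho> \<kappa> (Base v \<gamma>) = \<rho> v \<gamma>"
| "word_value A \<rho> \<kappa> (Arrow v \<gamma> c w) = \<rho> v \<gamma> \<otimes>\<^bsub>A\<^esub> (\<kappa> c \<otimes>\<^bsub>A\<^esub> word_value A \<rho> \<kappa> w)"

definition scalar ::
  "('v, 'c) pre_digraph \<Rightarrow> ('v \<Rightarrow> 'g monoid) \<Rightarrow> complex \<Rightarrow> ('v, 'g, 'c) word \<Rightarrow> complex" where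
  "scalar Q G z = (\<lambda>w. z * \<one>\<^bsub>tensor_ring Q G\<^esub> w)"

lemma left_end_act_left [simp]: "left_end (act_left G \<gamma> w) = left_end w"
  by (cases w) auto

locale quiver_with_groups =
  fixes Q :: "('v, 'c) pre_digraph" and G :: "'v \<Rightarrow> 'g monoid"
  assumes finite_verts: "finite (verts Q)"
    and group_at: "v \<in> verts Q \<Longrightarrow> group (G v)"
    and head_in_verts: "c \<in> arcs Q \<Longrightarrow> head Q c \<in> verts Q"
    and tail_in_verts: "c \<in> arcs Q \<Longrightarrow> tail Q c \<in> verts Q"
begin

abbreviation T :: "(('v, 'g, 'c) word \<Rightarrow> complex) ring" where
  "T \<equiv> tensor_ring Q G"

abbreviation word :: "('v, 'g, 'c) word \<Rightarrow> bool" where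
  "word \<equiv> is_word Q G"

lemma one_at [simp]: "v \<in> verts Q \<Longrightarrow> \<one>\<^bsub>G v\<^esub> \<in> carrier (G v)"
  by (simp add: group_at group.is_monoid)

lemma left_end_in_verts: "word w \<Longrightarrow> left_end w \<in> verts Q"
  by (cases w) auto

lemma right_end_in_verts: "word w \<Longrightarrow> right_end w \<in> verts Q"
  by (induction w) auto

lemma word_act_left: "word w \<Longrightarrow> \<gamma> \<in> carrier (G (left_end w)) \<Longrightarrow> word (act_left G \<gamma> w)"
  by (cases w) (auto intro!: monoid.m_closed group.is_monoid group_at)

lemma act_left_act_left:
  "word w \<Longrightarrow> \<gamma> \<in> carrier (G (left_end w)) \<Longrightarrow> \<gamma>' \<in> carrier (G (left_end w)) \<Longrightarrow>
    act_left G \<gamma> (act_left G \<gamma>' w) = act_left G (\<gamma> \<otimes>\<^bsub>G (left_end w)\<^esub> \<gamma>') w"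
  by (cases w) (auto simp: monoid.m_assoc group.is_monoid group_at)

lemma act_left_one: "word w \<Longrightarrow> act_left G \<one>\<^bsub>G (left_end w)\<^esub> w = w"
  by (cases w) (auto simp: monoid.l_one group.is_monoid group_at)

lemma word_mult_act_left:
  "word u \<Longrightarrow> word w \<Longrightarrow> \<gamma> \<in> carrier (G (left_end u)) \<Longrightarrow>
    word_mult G (act_left G \<gamma> u) w = map_option (act_left G \<gamma>) (word_mult G u w)"
  by (cases u) (auto simp: act_left_act_left option.map_comp comp_def)

lemma word_mult_Some:
  "word u \<Longrightarrow> word u' \<Longrightarrow> word_mult G u u' = Some w \<Longrightarrow>
    word w \<and> left_end w = left_end u \<and> right_end w = right_end u'"
proof (induction u arbitrary: w)
  case (Base v \<gamma>)
  then show ?case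
    by (cases u') (auto split: if_splits intro!: word_act_left monoid.m_closed group.is_monoid group_at)
qed auto

lemma word_mult_None_iff: "word u \<Longrightarrow> word_mult G u w = None \<longleftrightarrow> right_end u \<noteq> left_end w"
  by (induction u) auto

lemma word_mult_assoc:
  "word u \<Longrightarrow> word v \<Longrightarrow> word w \<Longrightarrow>
    Option.bind (word_mult G u v) (\<lambda>x. word_mult G x w) = Option.bind (word_mult G v w) (word_mult G u)"
proof (induction u)
  case (Base x \<gamma>)
  then show ?case
    by (cases "word_mult G v w") (auto simp: word_mult_act_left dest: word_mult_Some)
next
  case (Arrow x \<gamma> c u)
  have "Option.bind (word_mult G (Arrow x \<gamma> c u) v) (\<lambda>x. word_mult G x w) =
      map_option (Arrow x \<gamma> c) (Option.bind (word_mult G u v) (\<lambda>x. word_mult G x w))"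
    by (cases "word_mult G u v") auto
  then show ?case
    using Arrow by (cases "word_mult G v w") auto
qed

lemma word_mult_idem_left:
  "word w \<Longrightarrow> word_mult G (Base v \<one>\<^bsub>G v\<^esub>) w = (if v = left_end w then Some w else None)"
  by (auto simp: act_left_one)

lemma word_mult_idem_right:
  "word w \<Longrightarrow> word_mult G w (Base v \<one>\<^bsub>G v\<^esub>) = (if v = right_end w then Some w else None)"
  by (induction w) (auto simp: monoid.r_one group.is_monoid group_at)


subsection \<open>The tensor ring is a ring\<close>

lemma tensor_carrier: "f \<in> carrier T \<longleftrightarrow> finite {w. f w \<noteq> 0} \<and> (\<forall>w. f w \<noteq> 0 \<longrightarrow> word w)"
  by (simp add: tensor_ring_def)

lemma tensor_add: "f \<oplus>\<^bsub>T\<^esub> g = (\<lambda>w. f w + g w)"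
  and tensor_zero: "\<zero>\<^bsub>T\<^esub> = (\<lambda>w. 0)"
  and tensor_one: "\<one>\<^bsub>T\<^esub> = (\<lambda>w. if \<exists>v\<in>verts Q. w = Base v \<one>\<^bsub>G v\<^esub> then 1 else 0)"
  by (simp_all add: tensor_ring_def)

text \<open>
  Summing over fixed finite sets that contain the supports makes the bilinearity of the product
  visible, since the range of summation no longer depends on the factors.
\<close>

lemma tensor_mult:
  assumes U: "finite U" "{u. f u \<noteq> 0} \<subseteq> U" and U': "finite U'" "{u. g u \<noteq> 0} \<subseteq> U'"
  shows "(f \<otimes>\<^bsub>T\<^esub> g) w =
    (\<Sum>u\<in>U. \<Sum>u'\<in>U'. if word_mult G u u' = Some w then f u * g u' else 0)"
proof -
  have "(\<Sum>(u, u') | f u \<noteq> 0 \<and> g u' \<noteq> 0 \<and> word_mult G u u' = Some w. f u * g u') =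
      (\<Sum>(u, u')\<in>U \<times> U'. if word_mult G u u' = Some w then f u * g u' else 0)"
  proof (rule sum.mono_neutral_cong_left)
    show "finite (U \<times> U')"
      using U U' by simp
    show "{(u, u'). f u \<noteq> 0 \<and> g u' \<noteq> 0 \<and> word_mult G u u' = Some w} \<subseteq> U \<times> U'"
      using U(2) U'(2) by blast
  qed (auto split: if_splits)
  then show ?thesis
    by (simp add: tensor_ring_def sum.cartesian_product)
qed

lemma tensor_mult_support:
  assumes "(f \<otimes>\<^bsub>T\<^esub> g) w \<noteq> 0"
  obtains u u' where "f u \<noteq> 0" "g u' \<noteq> 0" "word_mult G u u' = Some w"
proof -
  have "(\<Sum>(u, u') | f u \<noteq> 0 \<and> g u' \<noteq> 0 \<and> word_mult G u u' = Some w. f u * g u') \<noteq> 0"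
    using assms by (simp add: tensor_ring_def)
  then obtain x where "x \<in> {(u, u'). f u \<noteq> 0 \<and> g u' \<noteq> 0 \<and> word_mult G u u' = Some w}"
    by (rule sum.not_neutral_contains_not_neutral)
  then show ?thesis
    using that by auto
qed

lemma scaled_word_carrier [simp]: "word w \<Longrightarrow> scaled_word z w \<in> carrier T"
  by (auto simp: tensor_carrier scaled_word_def)

lemma scaled_word_support: "{u. scaled_word z w u \<noteq> 0} \<subseteq> {w}"
  by (auto simp: scaled_word_def)

lemma scaled_word_mult:
  "scaled_word z u \<otimes>\<^bsub>T\<^esub> scaled_word z' u' =
    (case word_mult G u u' of None \<Rightarrow> \<zero>\<^bsub>T\<^esub> | Some w \<Rightarrow> scaled_word (z * z') w)"
proof
  fix x
  have "(scaled_word z u \<otimes>\<^bsub>T\<^esub> scaled_word z' u') x =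
      (if word_mult G u u' = Some x then z * z' else 0)"
    by (subst tensor_mult[OF _ scaled_word_support _ scaled_word_support]) (simp_all add: scaled_word_def)
  then show "(scaled_word z u \<otimes>\<^bsub>T\<^esub> scaled_word z' u') x =
      (case word_mult G u u' of None \<Rightarrow> \<zero>\<^bsub>T\<^esub> | Some w \<Rightarrow> scaled_word (z * z') w) x"
    by (auto simp: scaled_word_def tensor_zero split: option.splits)
qed

lemma tensor_mult_closed:
  assumes "f \<in> carrier T" "g \<in> carrier T"
  shows "f \<otimes>\<^bsub>T\<^esub> g \<in> carrier T"
proof -
  let ?P = "\<lambda>(u, u'). the (word_mult G u u')"
  have "{w. (f \<otimes>\<^bsub>T\<^esub> g) w \<noteq> 0} \<subseteq> ?P ` ({u. f u \<noteq> 0} \<times> {u. g u \<noteq> 0})"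
  proof
    fix w assume "w \<in> {w. (f \<otimes>\<^bsub>T\<^esub> g) w \<noteq> 0}"
    then obtain u u' where "f u \<noteq> 0" "g u' \<noteq> 0" "word_mult G u u' = Some w"
      by (auto elim: tensor_mult_support)
    then show "w \<in> ?P ` ({u. f u \<noteq> 0} \<times> {u. g u \<noteq> 0})"
      by (intro image_eqI[of _ _ "(u, u')"]) auto
  qed
  moreover have "finite (?P ` ({u. f u \<noteq> 0} \<times> {u. g u \<noteq> 0}))"
    using assms by (simp add: tensor_carrier)
  ultimately have "finite {w. (f \<otimes>\<^bsub>T\<^esub> g) w \<noteq> 0}"
    by (rule finite_subset)
  then show ?thesis
    using assms by (auto simp: tensor_carrier dest: word_mult_Some elim!: tensor_mult_support)
qed

lemma tensor_add_closed: "f \<in> carrier T \<Longrightarrow> g \<in> carrier T \<Longrightarrow> f \<oplus>\<^bsub>T\<^esub> g \<in> carrier T"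
proof -
  assume fg: "f \<in> carrier T" "g \<in> carrier T"
  have "{w. f w + g w \<noteq> 0} \<subseteq> {w. f w \<noteq> 0} \<union> {w. g w \<noteq> 0}"
    by auto
  then have "finite {w. f w + g w \<noteq> 0}"
    using fg by (auto simp: tensor_carrier intro: finite_subset)
  moreover have "word w" if "f w + g w \<noteq> 0" for w
    using fg that by (cases "f w = 0") (auto simp: tensor_carrier)
  ultimately show ?thesis
    by (simp add: tensor_carrier tensor_add)
qed

text \<open>
  Elements are finite combinations of words. Multilinear identities, such as associativity, thus
  reduce to words.
\<close>

lemma tensor_induct [consumes 1, case_names zero add]:
  assumes f: "f \<in> carrier T" and zero: "P \<zero>\<^bsub>T\<^esub>"
    and add: "\<And>z w f. word w \<Longrightarrow> f \<in> carrier T \<Longrightarrow> P f \<Longrightarrow> P (scaled_word z w \<oplus>\<^bsub>T\<^esub> f)"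
  shows "P f"
proof -
  have "f \<in> carrier T \<longrightarrow> P f" if "finite U" "{w. f w \<noteq> 0} \<subseteq> U" for U f
    using that
  proof (induction U arbitrary: f rule: finite_induct)
    case empty
    then have "f = \<zero>\<^bsub>T\<^esub>"
      by (auto simp: tensor_zero)
    then show ?case
      using zero by simp
  next
    case (insert w U)
    show ?case
    proof
      assume f: "f \<in> carrier T"
      show "P f"
      proof (cases "f w = 0")
        case True
        then show ?thesis
          using insert.IH[of f] insert.prems f by blast
      next
        case False
        let ?g = "f(w := 0)"
        have "{u. ?g u \<noteq> 0} \<subseteq> {u. f u \<noteq> 0}"
          by auto
        then have g: "?g \<in> carrier T"
          using f by (auto simp: tensor_carrier intro: finite_subset)
        have "f = scaled_word (f w) w \<oplus>\<^bsub>T\<^esub> ?g"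
          by (auto simp: tensor_add scaled_word_def)
        moreover have "P ?g"
        proof -
          have "{u. ?g u \<noteq> 0} \<subseteq> U"
            using insert.prems by auto
          from insert.IH[OF this] show ?thesis
            using g by blast
        qed
        moreover have "word w"
          using f False by (simp add: tensor_carrier)
        ultimately show ?thesis
          using add g by metis
      qed
    qed
  qed
  then show ?thesis
    using f by (auto simp: tensor_carrier)
qed

lemma tensor_l_distr:
  assumes "f \<in> carrier T" "g \<in> carrier T" "h \<in> carrier T"
  shows "(f \<oplus>\<^bsub>T\<^esub> g) \<otimes>\<^bsub>T\<^esub> h = f \<otimes>\<^bsub>T\<^esub> h \<oplus>\<^bsub>T\<^esub> g \<otimes>\<^bsub>T\<^esub> h"
proof
  fix w
  let ?U = "{u. f u \<noteq> 0} \<union> {u. g u \<noteq> 0}" and ?U' = "{u. h u \<noteq> 0}"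
  have U: "finite ?U" "finite ?U'"
    using assms by (auto simp: tensor_carrier)
  note m = tensor_mult[OF U(1) _ U(2) subset_refl]
  have "((f \<oplus>\<^bsub>T\<^esub> g) \<otimes>\<^bsub>T\<^esub> h) w = (f \<otimes>\<^bsub>T\<^esub> h) w + (g \<otimes>\<^bsub>T\<^esub> h) w"
  proof (subst (1 2 3) m)
    show "(\<Sum>u\<in>?U. \<Sum>u'\<in>?U'. if word_mult G u u' = Some w then (f \<oplus>\<^bsub>T\<^esub> g) u * h u' else 0) =
      (\<Sum>u\<in>?U. \<Sum>u'\<in>?U'. if word_mult G u u' = Some w then f u * h u' else 0) +
      (\<Sum>u\<in>?U. \<Sum>u'\<in>?U'. if word_mult G u u' = Some w then g u * h u' else 0)"
      unfolding sum.distrib[symmetric] by (intro sum.cong refl) (simp_all add: tensor_add ring_distribs)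
  qed (auto simp: tensor_add)
  then show "((f \<oplus>\<^bsub>T\<^esub> g) \<otimes>\<^bsub>T\<^esub> h) w = (f \<otimes>\<^bsub>T\<^esub> h \<oplus>\<^bsub>T\<^esub> g \<otimes>\<^bsub>T\<^esub> h) w"
    by (simp add: tensor_add)
qed

lemma tensor_r_distr:
  assumes "f \<in> carrier T" "g \<in> carrier T" "h \<in> carrier T"
  shows "h \<otimes>\<^bsub>T\<^esub> (f \<oplus>\<^bsub>T\<^esub> g) = h \<otimes>\<^bsub>T\<^esub> f \<oplus>\<^bsub>T\<^esub> h \<otimes>\<^bsub>T\<^esub> g"
proof
  fix w
  let ?U = "{u. f u \<noteq> 0} \<union> {u. g u \<noteq> 0}" and ?U' = "{u. h u \<noteq> 0}"
  have U: "finite ?U" "finite ?U'"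
    using assms by (auto simp: tensor_carrier)
  note m = tensor_mult[OF U(2) subset_refl U(1)]
  have "(h \<otimes>\<^bsub>T\<^esub> (f \<oplus>\<^bsub>T\<^esub> g)) w = (h \<otimes>\<^bsub>T\<^esub> f) w + (h \<otimes>\<^bsub>T\<^esub> g) w"
  proof (subst (1 2 3) m)
    show "(\<Sum>u\<in>?U'. \<Sum>u'\<in>?U. if word_mult G u u' = Some w then h u * (f \<oplus>\<^bsub>T\<^esub> g) u' else 0) =
      (\<Sum>u\<in>?U'. \<Sum>u'\<in>?U. if word_mult G u u' = Some w then h u * f u' else 0) +
      (\<Sum>u\<in>?U'. \<Sum>u'\<in>?U. if word_mult G u u' = Some w then h u * g u' else 0)"
      unfolding sum.distrib[symmetric] by (intro sum.cong refl) (simp_all add: tensor_add ring_distribs)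
  qed (auto simp: tensor_add)
  then show "(h \<otimes>\<^bsub>T\<^esub> (f \<oplus>\<^bsub>T\<^esub> g)) w = (h \<otimes>\<^bsub>T\<^esub> f \<oplus>\<^bsub>T\<^esub> h \<otimes>\<^bsub>T\<^esub> g) w"
    by (simp add: tensor_add)
qed

lemma tensor_zero_mult: "\<zero>\<^bsub>T\<^esub> \<otimes>\<^bsub>T\<^esub> f = \<zero>\<^bsub>T\<^esub>" "f \<otimes>\<^bsub>T\<^esub> \<zero>\<^bsub>T\<^esub> = \<zero>\<^bsub>T\<^esub>"
  by (simp_all add: tensor_ring_def)

lemma tensor_zero_closed: "\<zero>\<^bsub>T\<^esub> \<in> carrier T"
  by (simp add: tensor_carrier tensor_zero)

lemma tensor_assoc_words:
  assumes "word u" "word v" "word w"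
  shows "(scaled_word x u \<otimes>\<^bsub>T\<^esub> scaled_word y v) \<otimes>\<^bsub>T\<^esub> scaled_word z w =
    scaled_word x u \<otimes>\<^bsub>T\<^esub> (scaled_word y v \<otimes>\<^bsub>T\<^esub> scaled_word z w)"
  using word_mult_assoc[OF assms]
  by (auto simp: scaled_word_mult tensor_zero_mult mult.assoc split: option.splits)

lemma tensor_assoc:
  assumes f: "f \<in> carrier T" and g: "g \<in> carrier T" and h: "h \<in> carrier T"
  shows "(f \<otimes>\<^bsub>T\<^esub> g) \<otimes>\<^bsub>T\<^esub> h = f \<otimes>\<^bsub>T\<^esub> (g \<otimes>\<^bsub>T\<^esub> h)"
proof -
  note d = tensor_l_distr tensor_r_distr tensor_mult_closed tensor_zero_mult
  have 1: "(scaled_word x u \<otimes>\<^bsub>T\<^esub> scaled_word y v) \<otimes>\<^bsub>T\<^esub> h = scaled_word x u \<otimes>\<^bsub>T\<^esub> (scaled_word y v \<otimes>\<^bsub>T\<^esub> h)"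
    if "word u" "word v" for x u y v
    using h by (induction h rule: tensor_induct) (use that in \<open>simp_all add: d tensor_assoc_words\<close>)
  have 2: "(scaled_word x u \<otimes>\<^bsub>T\<^esub> g) \<otimes>\<^bsub>T\<^esub> h = scaled_word x u \<otimes>\<^bsub>T\<^esub> (g \<otimes>\<^bsub>T\<^esub> h)" if "word u" for x u
    using g by (induction g rule: tensor_induct) (use that h in \<open>simp_all add: d 1\<close>)
  show ?thesis
    using f by (induction f rule: tensor_induct) (use g h in \<open>simp_all add: d 2\<close>)
qed

lemma tensor_one_support: "{u. \<one>\<^bsub>T\<^esub> u \<noteq> 0} \<subseteq> (\<lambda>v. Base v \<one>\<^bsub>G v\<^esub>) ` verts Q"
  by (auto simp: tensor_one split: if_splits)

lemma tensor_one_closed: "\<one>\<^bsub>T\<^esub> \<in> carrier T"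
proof -
  have "finite {u. \<one>\<^bsub>T\<^esub> u \<noteq> 0}"
    by (rule finite_subset[OF tensor_one_support]) (simp add: finite_verts)
  moreover have "word u" if "\<one>\<^bsub>T\<^esub> u \<noteq> 0" for u
    using that tensor_one_support by fastforce
  ultimately show ?thesis
    unfolding tensor_carrier by blast
qed

lemma tensor_one_mult_word:
  assumes w: "word w"
  shows "\<one>\<^bsub>T\<^esub> \<otimes>\<^bsub>T\<^esub> scaled_word z w = scaled_word z w" "scaled_word z w \<otimes>\<^bsub>T\<^esub> \<one>\<^bsub>T\<^esub> = scaled_word z w"
proof -
  let ?U = "(\<lambda>v. Base v \<one>\<^bsub>G v\<^esub>) ` verts Q"
  have U: "finite ?U" and inj: "inj_on (\<lambda>v. Base v \<one>\<^bsub>G v\<^esub>) (verts Q)"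
    by (auto simp: finite_verts inj_on_def)
  have "(\<one>\<^bsub>T\<^esub> \<otimes>\<^bsub>T\<^esub> scaled_word z w) x = scaled_word z w x" for x
  proof -
    have "(\<one>\<^bsub>T\<^esub> \<otimes>\<^bsub>T\<^esub> scaled_word z w) x = (\<Sum>v\<in>verts Q. if v = left_end w then scaled_word z w x else 0)"
      using w by (simp add: tensor_mult[OF U tensor_one_support _ scaled_word_support] sum.reindex[OF inj]
          del: word_mult.simps)
        (rule sum.cong, auto simp: word_mult_idem_left tensor_one scaled_word_def simp del: word_mult.simps)
    then show ?thesis
      using left_end_in_verts[OF w] finite_verts by simp
  qed
  moreover have "(scaled_word z w \<otimes>\<^bsub>T\<^esub> \<one>\<^bsub>T\<^esub>) x = scaled_word z w x" for x
  proof -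
    have "(scaled_word z w \<otimes>\<^bsub>T\<^esub> \<one>\<^bsub>T\<^esub>) x = (\<Sum>v\<in>verts Q. if v = right_end w then scaled_word z w x else 0)"
      using w by (simp add: tensor_mult[OF _ scaled_word_support U tensor_one_support] sum.reindex[OF inj])
        (rule sum.cong, auto simp: word_mult_idem_right tensor_one scaled_word_def)
    then show ?thesis
      using right_end_in_verts[OF w] finite_verts by simp
  qed
  ultimately show "\<one>\<^bsub>T\<^esub> \<otimes>\<^bsub>T\<^esub> scaled_word z w = scaled_word z w"
      "scaled_word z w \<otimes>\<^bsub>T\<^esub> \<one>\<^bsub>T\<^esub> = scaled_word z w"
    by blast+
qed

lemma tensor_one_mult:
  assumes "f \<in> carrier T"
  shows "\<one>\<^bsub>T\<^esub> \<otimes>\<^bsub>T\<^esub> f = f" "f \<otimes>\<^bsub>T\<^esub> \<one>\<^bsub>T\<^esub> = f"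
  using assms
  by (induction f rule: tensor_induct)
    (simp_all add: tensor_zero_mult tensor_r_distr tensor_l_distr tensor_one_closed tensor_one_mult_word)

lemma ring_tensor: "ring T"
proof (rule ringI)
  show "abelian_group T"
  proof (rule abelian_groupI)
    show "\<exists>g\<in>carrier T. g \<oplus>\<^bsub>T\<^esub> f = \<zero>\<^bsub>T\<^esub>" if "f \<in> carrier T" for f
      using that by (intro bexI[of _ "\<lambda>w. - f w"]) (auto simp: tensor_add tensor_zero tensor_carrier)
  qed (auto simp: tensor_add_closed tensor_zero_closed, auto simp: tensor_add tensor_zero)
  show "Group.monoid T"
    by (rule monoidI) (auto simp: tensor_mult_closed tensor_one_closed tensor_assoc tensor_one_mult)
qed (auto simp: tensor_l_distr tensor_r_distr)

sublocale tensor: ring T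
  by (rule ring_tensor)

lemma tensor_minus: "f \<in> carrier T \<Longrightarrow> \<ominus>\<^bsub>T\<^esub> f = (\<lambda>w. - f w)"
  by (intro tensor.minus_equality) (auto simp: tensor_add tensor_zero tensor_carrier)

end

section \<open>Complex algebras and the universal property of tensor rings\<close>

lemma (in ring_hom_ring) hom_finsum_family:
  assumes "finite F" "f \<in> F \<rightarrow> carrier R"
  shows "h (finsum R f F) = finsum S (\<lambda>x. h (f x)) F"
  using assms by (induction F) (auto simp: Pi_iff)

text \<open>
  A complex algebra is encoded by the homomorphism \<open>\<sigma>\<close> from the complex numbers to the center of a
  ring. Quotients inherit this structure by composition with the projection.
\<close>

locale complex_algebra = ring A for A :: "('a, 'm) ring_scheme" (structure) +
  fixes \<sigma> :: "complex \<Rightarrow> 'a"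
  assumes \<sigma>_closed [simp]: "\<sigma> z \<in> carrier A"
    and \<sigma>_add: "\<sigma> (z + z') = \<sigma> z \<oplus> \<sigma> z'"
    and \<sigma>_mult: "\<sigma> (z * z') = \<sigma> z \<otimes> \<sigma> z'"
    and \<sigma>_one: "\<sigma> 1 = \<one>"
    and \<sigma>_central: "a \<in> carrier A \<Longrightarrow> a \<otimes> \<sigma> z = \<sigma> z \<otimes> a"
begin

lemma \<sigma>_zero: "\<sigma> 0 = \<zero>"
proof -
  have "\<sigma> 0 \<oplus> \<sigma> 0 = \<sigma> 0"
    using \<sigma>_add[of 0 0, symmetric] by simp
  then show ?thesis
    using add.l_cancel_one[of "\<sigma> 0" "\<sigma> 0"] by simp
qed

lemma complex_algebra_quotient:
  assumes "ideal I A"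
  shows "complex_algebra (A Quot I) (\<lambda>z. I +> \<sigma> z)"
proof -
  interpret I: ideal I A by fact
  interpret pr: ring_hom_ring A "A Quot I" "(+>) I"
    by (rule I.rcos_ring_hom_ring)
  have quot_carr: "\<exists>b\<in>carrier A. a = I +> b" if "a \<in> carrier (A Quot I)" for a
    using that unfolding FactRing_def A_RCOSETS_def' by auto
  show ?thesis
  proof
    fix a z assume "a \<in> carrier (A Quot I)"
    then obtain b where "b \<in> carrier A" "a = I +> b"
      using quot_carr by blast
    then show "a \<otimes>\<^bsub>A Quot I\<^esub> (I +> \<sigma> z) = (I +> \<sigma> z) \<otimes>\<^bsub>A Quot I\<^esub> a"
      by (simp add: \<sigma>_central flip: pr.hom_mult)
  qed (simp_all add: \<sigma>_add \<sigma>_mult \<sigma>_one)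
qed

end

context quiver_with_groups
begin

lemma scalar_mult:
  assumes "f \<in> carrier T"
  shows "scalar Q G z \<otimes>\<^bsub>T\<^esub> f = (\<lambda>w. z * f w)" "f \<otimes>\<^bsub>T\<^esub> scalar Q G z = (\<lambda>w. z * f w)"
proof -
  let ?U = "{w. f w \<noteq> 0}" and ?V = "{w. \<one>\<^bsub>T\<^esub> w \<noteq> 0}"
  have fin: "finite ?U" "finite ?V"
    using assms tensor_one_closed by (auto simp: tensor_carrier)
  have sub: "{w. scalar Q G z w \<noteq> 0} \<subseteq> ?V"
    by (auto simp: scalar_def)
  have "(scalar Q G z \<otimes>\<^bsub>T\<^esub> f) w = z * (\<one>\<^bsub>T\<^esub> \<otimes>\<^bsub>T\<^esub> f) w" for w
    unfolding tensor_mult[OF fin(2) sub fin(1) subset_refl] tensor_mult[OF fin(2) subset_refl fin(1) subset_refl]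
      sum_distrib_left
    by (intro sum.cong refl) (simp_all add: scalar_def)
  then show "scalar Q G z \<otimes>\<^bsub>T\<^esub> f = (\<lambda>w. z * f w)"
    using assms by auto
  have "(f \<otimes>\<^bsub>T\<^esub> scalar Q G z) w = z * (f \<otimes>\<^bsub>T\<^esub> \<one>\<^bsub>T\<^esub>) w" for w
    unfolding tensor_mult[OF fin(1) subset_refl fin(2) sub] tensor_mult[OF fin(1) subset_refl fin(2) subset_refl]
      sum_distrib_left
    by (intro sum.cong refl) (simp_all add: scalar_def)
  then show "f \<otimes>\<^bsub>T\<^esub> scalar Q G z = (\<lambda>w. z * f w)"
    using assms by auto
qed

lemma tensor_scale_closed: "f \<in> carrier T \<Longrightarrow> (\<lambda>w. z * f w) \<in> carrier T"
  by (auto simp: tensor_carrier intro: finite_subset)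

lemma complex_algebra_tensor: "complex_algebra T (scalar Q G)"
proof
  have c: "scalar Q G z \<in> carrier T" for z
    using tensor_scale_closed[OF tensor_one_closed] by (simp add: scalar_def)
  fix z z'
  show "scalar Q G z \<in> carrier T"
    by (rule c)
  show "scalar Q G (z + z') = scalar Q G z \<oplus>\<^bsub>T\<^esub> scalar Q G z'"
    by (simp add: scalar_def tensor_add ring_distribs)
  show "scalar Q G (z * z') = scalar Q G z \<otimes>\<^bsub>T\<^esub> scalar Q G z'"
    by (simp add: scalar_mult(1)[OF c]) (simp add: scalar_def mult.assoc)
  show "scalar Q G 1 = \<one>\<^bsub>T\<^esub>"
    by (simp add: scalar_def)
  show "f \<otimes>\<^bsub>T\<^esub> scalar Q G z = scalar Q G z \<otimes>\<^bsub>T\<^esub> f" if "f \<in> carrier T" for f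
    using that by (simp add: scalar_mult)
qed

sublocale scalars: complex_algebra T "scalar Q G"
  by (rule complex_algebra_tensor)

lemma scaled_word_eq: "word w \<Longrightarrow> scaled_word z w = scalar Q G z \<otimes>\<^bsub>T\<^esub> single_word w"
  by (simp add: scalar_mult) (auto simp: scaled_word_def)

lemma scaled_word_Arrow:
  assumes "word (Arrow v \<gamma> c w)"
  shows "scaled_word z (Arrow v \<gamma> c w) = scaled_word z (Base v \<gamma>) \<otimes>\<^bsub>T\<^esub> (gen Q G c \<otimes>\<^bsub>T\<^esub> single_word w)"
  using assms
  by (simp add: gen_def scaled_word_mult act_left_one monoid.r_one group.is_monoid group_at)

lemma gen_closed [simp]: "c \<in> arcs Q \<Longrightarrow> gen Q G c \<in> carrier T"
  by (simp add: gen_def head_in_verts tail_in_verts)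

lemma idem_closed [simp]: "v \<in> verts Q \<Longrightarrow> idem G v \<in> carrier T"
  by (simp add: idem_def)

lemma base_mult_base:
  "single_word (Base v \<gamma>) \<otimes>\<^bsub>T\<^esub> single_word (Base v \<gamma>') = single_word (Base v (\<gamma> \<otimes>\<^bsub>G v\<^esub> \<gamma>'))"
  by (simp add: scaled_word_mult)

lemma idem_mult_base:
  assumes "v \<in> verts Q" "\<gamma> \<in> carrier (G v)"
  shows "idem G v \<otimes>\<^bsub>T\<^esub> single_word (Base v \<gamma>) = single_word (Base v \<gamma>)"
    and "single_word (Base v \<gamma>) \<otimes>\<^bsub>T\<^esub> idem G v = single_word (Base v \<gamma>)"
  using assms by (simp_all add: idem_def scaled_word_mult monoid.l_one monoid.r_one group.is_monoid group_at)

lemma idem_mult_idem: "v \<in> verts Q \<Longrightarrow> idem G v \<otimes>\<^bsub>T\<^esub> idem G v = idem G v"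
  using idem_mult_base(1)[of v "\<one>\<^bsub>G v\<^esub>"] by (simp add: idem_def)

lemma idem_orthogonal: "v \<noteq> w \<Longrightarrow> idem G v \<otimes>\<^bsub>T\<^esub> idem G w = \<zero>\<^bsub>T\<^esub>"
  by (simp add: idem_def scaled_word_mult)

lemma idem_mult_gen:
  assumes "c \<in> arcs Q"
  shows "idem G (head Q c) \<otimes>\<^bsub>T\<^esub> gen Q G c = gen Q G c"
    and "gen Q G c \<otimes>\<^bsub>T\<^esub> idem G (tail Q c) = gen Q G c"
  using head_in_verts[OF assms] tail_in_verts[OF assms]
  by (simp_all add: idem_def gen_def scaled_word_mult monoid.l_one monoid.r_one group.is_monoid group_at)

lemma finsum_idem: "finsum T (idem G) (verts Q) = \<one>\<^bsub>T\<^esub>"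
proof -
  have "finsum T (idem G) F = (\<lambda>w. if \<exists>v\<in>F. w = Base v \<one>\<^bsub>G v\<^esub> then 1 else 0)"
    if "finite F" "F \<subseteq> verts Q" for F
    using that
  proof (induction F)
    case empty
    then show ?case by (simp add: tensor_zero)
  next
    case (insert v F)
    have "finsum T (idem G) (insert v F) = idem G v \<oplus>\<^bsub>T\<^esub> finsum T (idem G) F"
      using insert by (intro tensor.finsum_insert) auto
    also have "\<dots> = idem G v \<oplus>\<^bsub>T\<^esub> (\<lambda>w. if \<exists>v\<in>F. w = Base v \<one>\<^bsub>G v\<^esub> then 1 else 0)"
      using insert by simp
    also have "\<dots> = (\<lambda>w. if \<exists>v\<in>insert v F. w = Base v \<one>\<^bsub>G v\<^esub> then 1 else 0)"
      using insert.hyps by (auto simp: tensor_add idem_def scaled_word_def fun_eq_iff)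
    finally show ?case .
  qed
  then show ?thesis
    using finite_verts by (simp add: tensor_one)
qed


text \<open>
  Every word is a product of loops and arrows, so a homomorphism is determined by its values on
  these.
\<close>

lemma tensor_hom_eqI:
  assumes h: "ring_hom_ring T A h" and h': "ring_hom_ring T A h'"
    and base: "\<And>v \<gamma> z. v \<in> verts Q \<Longrightarrow> \<gamma> \<in> carrier (G v) \<Longrightarrow>
      h (scaled_word z (Base v \<gamma>)) = h' (scaled_word z (Base v \<gamma>))"
    and gen: "\<And>c. c \<in> arcs Q \<Longrightarrow> h (gen Q G c) = h' (gen Q G c)"
    and f: "f \<in> carrier T"
  shows "h f = h' f"
proof -
  interpret h: ring_hom_ring T A h by fact
  interpret h': ring_hom_ring T A h' by fact
  have word: "h (scaled_word z w) = h' (scaled_word z w)" if "word w" for z w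
    using that
  proof (induction w arbitrary: z)
    case (Base v \<gamma>)
    then show ?case by (simp add: base)
  next
    case (Arrow v \<gamma> c w)
    then show ?case
      by (simp add: scaled_word_Arrow[OF Arrow.prems] base gen)
  qed
  show ?thesis
    using f by (induction f rule: tensor_induct) (simp_all add: word)
qed

end

text \<open>
  The data for a homomorphism from a tensor ring to a complex algebra: the units of the groups go to
  a complete system of orthogonal idempotents, every group acts in its own corner, and an arrow
  lies between the corners of its ends.
\<close>

locale tensor_representation =
  quiver_with_groups Q G + A: complex_algebra A \<sigma>
  for Q :: "('v, 'c) pre_digraph" and G :: "'v \<Rightarrow> 'g monoid"
    and A :: "('a, 'm) ring_scheme" and \<sigma> :: "complex \<Rightarrow> 'a" +
  fixes \<rho> :: "'v \<Rightarrow> 'g \<Rightarrow> 'a" and \<kappa> :: "'c \<Rightarrow> 'a"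
  assumes \<rho>_closed: "v \<in> verts Q \<Longrightarrow> \<gamma> \<in> carrier (G v) \<Longrightarrow> \<rho> v \<gamma> \<in> carrier A"
    and \<rho>_mult: "v \<in> verts Q \<Longrightarrow> \<gamma> \<in> carrier (G v) \<Longrightarrow> \<gamma>' \<in> carrier (G v) \<Longrightarrow>
      \<rho> v (\<gamma> \<otimes>\<^bsub>G v\<^esub> \<gamma>') = \<rho> v \<gamma> \<otimes>\<^bsub>A\<^esub> \<rho> v \<gamma>'"
    and \<rho>_orthogonal: "v \<in> verts Q \<Longrightarrow> w \<in> verts Q \<Longrightarrow> v \<noteq> w \<Longrightarrow>
      \<rho> v \<one>\<^bsub>G v\<^esub> \<otimes>\<^bsub>A\<^esub> \<rho> w \<one>\<^bsub>G w\<^esub> = \<zero>\<^bsub>A\<^esub>"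
    and \<rho>_complete: "finsum A (\<lambda>v. \<rho> v \<one>\<^bsub>G v\<^esub>) (verts Q) = \<one>\<^bsub>A\<^esub>"
    and \<kappa>_closed: "c \<in> arcs Q \<Longrightarrow> \<kappa> c \<in> carrier A"
    and \<kappa>_head: "c \<in> arcs Q \<Longrightarrow> \<rho> (head Q c) \<one>\<^bsub>G (head Q c)\<^esub> \<otimes>\<^bsub>A\<^esub> \<kappa> c = \<kappa> c"
    and \<kappa>_tail: "c \<in> arcs Q \<Longrightarrow> \<kappa> c \<otimes>\<^bsub>A\<^esub> \<rho> (tail Q c) \<one>\<^bsub>G (tail Q c)\<^esub> = \<kappa> c"
begin

abbreviation val :: "('v, 'g, 'c) word \<Rightarrow> 'a" where
  "val \<equiv> word_value A \<rho> \<kappa>"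

definition extension :: "(('v, 'g, 'c) word \<Rightarrow> complex) \<Rightarrow> 'a" where
  "extension f = finsum A (\<lambda>w. \<sigma> (f w) \<otimes>\<^bsub>A\<^esub> val w) {w. f w \<noteq> 0}"

lemma val_closed [simp]: "word w \<Longrightarrow> val w \<in> carrier A"
  by (induction w) (auto simp: \<rho>_closed \<kappa>_closed)

lemma \<rho>_one_mult: "v \<in> verts Q \<Longrightarrow> \<gamma> \<in> carrier (G v) \<Longrightarrow> \<rho> v \<one>\<^bsub>G v\<^esub> \<otimes>\<^bsub>A\<^esub> \<rho> v \<gamma> = \<rho> v \<gamma>"
  "v \<in> verts Q \<Longrightarrow> \<gamma> \<in> carrier (G v) \<Longrightarrow> \<rho> v \<gamma> \<otimes>\<^bsub>A\<^esub> \<rho> v \<one>\<^bsub>G v\<^esub> = \<rho> v \<gamma>"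
  by (simp_all flip: \<rho>_mult add: group_at group.is_monoid)

text \<open>
  If the ends do not match, two distinct orthogonal idempotents meet in the product.
\<close>

lemma \<rho>_mult_val:
  assumes v: "v \<in> verts Q" "\<gamma> \<in> carrier (G v)" and w: "word w"
  shows "\<rho> v \<gamma> \<otimes>\<^bsub>A\<^esub> val w = (if left_end w = v then val (act_left G \<gamma> w) else \<zero>\<^bsub>A\<^esub>)"
proof -
  obtain \<gamma>' x where w': "\<gamma>' \<in> carrier (G (left_end w))" "left_end w \<in> verts Q" "x \<in> carrier A"
    "val w = \<rho> (left_end w) \<gamma>' \<otimes>\<^bsub>A\<^esub> x"
    "left_end w = v \<Longrightarrow> val (act_left G \<gamma> w) = \<rho> (left_end w) (\<gamma> \<otimes>\<^bsub>G (left_end w)\<^esub> \<gamma>') \<otimes>\<^bsub>A\<^esub> x"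
  proof (cases w)
    case (Base u \<gamma>')
    have "\<rho> v (\<gamma> \<otimes>\<^bsub>G v\<^esub> \<gamma>') \<otimes>\<^bsub>A\<^esub> \<rho> v \<one>\<^bsub>G v\<^esub> = \<rho> v (\<gamma> \<otimes>\<^bsub>G v\<^esub> \<gamma>')" if "u = v"
      using w v that Base by (intro \<rho>_one_mult(2)) (auto intro!: monoid.m_closed group.is_monoid group_at)
    then show ?thesis
      using w v Base that[of \<gamma>' "\<rho> u \<one>\<^bsub>G u\<^esub>"] \<rho>_one_mult(2)[of u \<gamma>']
      by (auto simp: \<rho>_closed)
  next
    case (Arrow u \<gamma>' c w')
    then show ?thesis
      using w that[of \<gamma>' "\<kappa> c \<otimes>\<^bsub>A\<^esub> val w'"] by (simp add: \<kappa>_closed)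
  qed
  show ?thesis
  proof (cases "left_end w = v")
    case True
    then show ?thesis
      using w' v by (simp add: \<rho>_closed \<rho>_mult A.m_assoc)
  next
    case False
    have "\<rho> v \<gamma> \<otimes>\<^bsub>A\<^esub> val w = (\<rho> v \<gamma> \<otimes>\<^bsub>A\<^esub> \<rho> v \<one>\<^bsub>G v\<^esub>) \<otimes>\<^bsub>A\<^esub>
        ((\<rho> (left_end w) \<one>\<^bsub>G (left_end w)\<^esub> \<otimes>\<^bsub>A\<^esub> \<rho> (left_end w) \<gamma>') \<otimes>\<^bsub>A\<^esub> x)"
      using w' v by (simp add: \<rho>_one_mult)
    also have "\<dots> = \<rho> v \<gamma> \<otimes>\<^bsub>A\<^esub> ((\<rho> v \<one>\<^bsub>G v\<^esub> \<otimes>\<^bsub>A\<^esub> \<rho> (left_end w) \<one>\<^bsub>G (left_end w)\<^esub>) \<otimes>\<^bsub>A\<^esub>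
        (\<rho> (left_end w) \<gamma>' \<otimes>\<^bsub>A\<^esub> x))"
      using w' v by (simp add: \<rho>_closed A.m_assoc)
    also have "\<dots> = \<zero>\<^bsub>A\<^esub>"
      using w' v False by (simp add: \<rho>_closed \<rho>_orthogonal)
    finally show ?thesis
      using False by simp
  qed
qed

lemma val_mult:
  "word u \<Longrightarrow> word w \<Longrightarrow>
    val u \<otimes>\<^bsub>A\<^esub> val w = (case word_mult G u w of None \<Rightarrow> \<zero>\<^bsub>A\<^esub> | Some x \<Rightarrow> val x)"
proof (induction u)
  case (Base v \<gamma>)
  then show ?case by (simp add: \<rho>_mult_val)
next
  case (Arrow v \<gamma> c u)
  have "val (Arrow v \<gamma> c u) \<otimes>\<^bsub>A\<^esub> val w = \<rho> v \<gamma> \<otimes>\<^bsub>A\<^esub> (\<kappa> c \<otimes>\<^bsub>A\<^esub> (val u \<otimes>\<^bsub>A\<^esub> val w))"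
    using Arrow.prems by (simp add: A.m_assoc \<rho>_closed \<kappa>_closed)
  then show ?case
    using Arrow by (auto simp: \<rho>_closed \<kappa>_closed split: option.splits)
qed

lemma extension_superset:
  assumes "finite U" "{w. f w \<noteq> 0} \<subseteq> U" "U \<subseteq> {w. word w}"
  shows "extension f = finsum A (\<lambda>w. \<sigma> (f w) \<otimes>\<^bsub>A\<^esub> val w) U"
  unfolding extension_def
  using assms by (intro A.add.finprod_mono_neutral_cong_left) (auto simp: A.\<sigma>_zero)

lemma extension_closed: "f \<in> carrier T \<Longrightarrow> extension f \<in> carrier A"
  unfolding extension_def by (intro A.finsum_closed) (auto simp: tensor_carrier)

lemma extension_zero: "extension \<zero>\<^bsub>T\<^esub> = \<zero>\<^bsub>A\<^esub>"
  by (simp add: extension_def tensor_zero)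

lemma extension_scaled_word: "word w \<Longrightarrow> extension (scaled_word z w) = \<sigma> z \<otimes>\<^bsub>A\<^esub> val w"
  using extension_superset[of "{w}" "scaled_word z w"] scaled_word_support[of z w]
  by (simp add: scaled_word_def)

lemma extension_add:
  assumes "f \<in> carrier T" "g \<in> carrier T"
  shows "extension (f \<oplus>\<^bsub>T\<^esub> g) = extension f \<oplus>\<^bsub>A\<^esub> extension g"
proof -
  let ?U = "{w. f w \<noteq> 0} \<union> {w. g w \<noteq> 0}"
  have U: "finite ?U" "?U \<subseteq> {w. word w}"
    using assms by (auto simp: tensor_carrier)
  have "extension (f \<oplus>\<^bsub>T\<^esub> g) = finsum A (\<lambda>w. \<sigma> (f w) \<otimes>\<^bsub>A\<^esub> val w \<oplus>\<^bsub>A\<^esub> \<sigma> (g w) \<otimes>\<^bsub>A\<^esub> val w) ?U"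
  proof (subst extension_superset[OF U(1) _ U(2)])
    show "{w. (f \<oplus>\<^bsub>T\<^esub> g) w \<noteq> 0} \<subseteq> ?U"
      by (auto simp: tensor_add)
    show "finsum A (\<lambda>w. \<sigma> ((f \<oplus>\<^bsub>T\<^esub> g) w) \<otimes>\<^bsub>A\<^esub> val w) ?U =
        finsum A (\<lambda>w. \<sigma> (f w) \<otimes>\<^bsub>A\<^esub> val w \<oplus>\<^bsub>A\<^esub> \<sigma> (g w) \<otimes>\<^bsub>A\<^esub> val w) ?U"
      using U by (intro A.finsum_cong') (auto simp: tensor_add A.\<sigma>_add A.l_distr)
  qed
  also have "\<dots> = extension f \<oplus>\<^bsub>A\<^esub> extension g"
    using U by (subst (1 2) extension_superset[OF U(1) _ U(2)]) (auto intro!: A.finsum_addf)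
  finally show ?thesis .
qed

lemma extension_mult:
  assumes f: "f \<in> carrier T" and g: "g \<in> carrier T"
  shows "extension (f \<otimes>\<^bsub>T\<^esub> g) = extension f \<otimes>\<^bsub>A\<^esub> extension g"
proof -
  note s = extension_add extension_zero extension_closed tensor.l_distr tensor.r_distr A.l_distr A.r_distr
  have words: "extension (scaled_word z u \<otimes>\<^bsub>T\<^esub> scaled_word z' w) =
      extension (scaled_word z u) \<otimes>\<^bsub>A\<^esub> extension (scaled_word z' w)" if uw: "word u" "word w" for z z' u w
  proof -
    have "(\<sigma> z \<otimes>\<^bsub>A\<^esub> val u) \<otimes>\<^bsub>A\<^esub> (\<sigma> z' \<otimes>\<^bsub>A\<^esub> val w) = \<sigma> z \<otimes>\<^bsub>A\<^esub> ((val u \<otimes>\<^bsub>A\<^esub> \<sigma> z') \<otimes>\<^bsub>A\<^esub> val w)"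
      using uw by (simp add: A.m_assoc)
    also have "\<dots> = \<sigma> (z * z') \<otimes>\<^bsub>A\<^esub> (val u \<otimes>\<^bsub>A\<^esub> val w)"
      using uw by (simp add: A.\<sigma>_central[of "val u" z'] A.\<sigma>_mult A.m_assoc)
    finally show ?thesis
      using uw by (auto simp: extension_scaled_word scaled_word_mult val_mult extension_zero
          dest: word_mult_Some split: option.splits)
  qed
  have left: "extension (scaled_word z u \<otimes>\<^bsub>T\<^esub> g) = extension (scaled_word z u) \<otimes>\<^bsub>A\<^esub> extension g"
    if "word u" for z u
    using g by (induction g rule: tensor_induct) (use that in \<open>simp_all add: s words\<close>)
  show ?thesis
    using f by (induction f rule: tensor_induct) (use g in \<open>simp_all add: s left\<close>)
qed

lemma extension_one: "extension \<one>\<^bsub>T\<^esub> = \<one>\<^bsub>A\<^esub>"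
proof -
  let ?b = "\<lambda>v. Base v \<one>\<^bsub>G v\<^esub>"
  have "extension \<one>\<^bsub>T\<^esub> = finsum A (\<lambda>w. \<sigma> (\<one>\<^bsub>T\<^esub> w) \<otimes>\<^bsub>A\<^esub> val w) (?b ` verts Q)"
    using finite_verts tensor_one_support by (intro extension_superset) auto
  also have "\<dots> = finsum A (\<lambda>v. \<sigma> (\<one>\<^bsub>T\<^esub> (?b v)) \<otimes>\<^bsub>A\<^esub> val (?b v)) (verts Q)"
    by (intro A.finsum_reindex) (auto simp: inj_on_def \<rho>_closed)
  also have "\<dots> = finsum A (\<lambda>v. \<rho> v \<one>\<^bsub>G v\<^esub>) (verts Q)"
    by (intro A.finsum_cong') (auto simp: \<rho>_closed tensor_one A.\<sigma>_one)
  finally show ?thesis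
    by (simp add: \<rho>_complete)
qed

lemma extension_ring_hom: "ring_hom_ring T A extension"
  by (intro ring_hom_ringI ring_tensor A.ring_axioms extension_closed extension_mult extension_add extension_one)

lemma extension_scalar: "extension (scalar Q G z) = \<sigma> z"
proof -
  have "extension (scalar Q G z \<otimes>\<^bsub>T\<^esub> f) = \<sigma> z \<otimes>\<^bsub>A\<^esub> extension f" if "f \<in> carrier T" for f
    using that
  proof (induction f rule: tensor_induct)
    case zero
    then show ?case
      by (simp add: extension_zero)
  next
    case (add z' w f)
    have "scalar Q G z \<otimes>\<^bsub>T\<^esub> scaled_word z' w = scaled_word (z * z') w"
      using add(1) by (simp add: scalar_mult) (auto simp: scaled_word_def)
    then have "extension (scalar Q G z \<otimes>\<^bsub>T\<^esub> scaled_word z' w) = \<sigma> z \<otimes>\<^bsub>A\<^esub> extension (scaled_word z' w)"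
      using add(1) by (simp add: extension_scaled_word A.\<sigma>_mult A.m_assoc)
    then show ?case
      using add by (simp add: tensor.r_distr A.r_distr extension_add extension_closed)
  qed
  from this[of "\<one>\<^bsub>T\<^esub>"] show ?thesis
    by (simp add: extension_one)
qed

lemma extension_base:
  "v \<in> verts Q \<Longrightarrow> \<gamma> \<in> carrier (G v) \<Longrightarrow> extension (scaled_word z (Base v \<gamma>)) = \<sigma> z \<otimes>\<^bsub>A\<^esub> \<rho> v \<gamma>"
  by (simp add: extension_scaled_word)

lemma extension_single_base:
  "v \<in> verts Q \<Longrightarrow> \<gamma> \<in> carrier (G v) \<Longrightarrow> extension (single_word (Base v \<gamma>)) = \<rho> v \<gamma>"
  by (simp add: extension_scaled_word A.\<sigma>_one \<rho>_closed)

lemma extension_gen: "c \<in> arcs Q \<Longrightarrow> extension (gen Q G c) = \<kappa> c"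
  by (simp add: gen_def extension_scaled_word A.\<sigma>_one \<rho>_closed \<kappa>_closed head_in_verts tail_in_verts
      \<kappa>_head \<kappa>_tail)

end

section \<open>Degree zero homology of the capped algebra\<close>

text \<open>
  Words in the chords of degree zero span the degree zero part of the algebra.
\<close>

definition short_chord_quiver :: "('v, 'e) pre_digraph \<Rightarrow> ('v, 'e chord) pre_digraph" where
  "short_chord_quiver \<Gamma> = (chord_quiver \<Gamma>)\<lparr>arcs := {c \<in> arcs (chord_quiver \<Gamma>). chord_degree c = 0}\<rparr>"

lemma chord_quiver_simps [simp]:
  "verts (chord_quiver \<Gamma>) = verts \<Gamma>"
  "arcs (chord_quiver \<Gamma>) = (\<Union>b\<in>arcs \<Gamma>. {Chord_p b, Chord_q b, Chord_a1 b, Chord_a2 b})"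
  "tail (chord_quiver \<Gamma>) = chord_start \<Gamma>"
  "head (chord_quiver \<Gamma>) = chord_end \<Gamma>"
  by (simp_all add: chord_quiver_def)

lemma short_chord_quiver_simps [simp]:
  "verts (short_chord_quiver \<Gamma>) = verts \<Gamma>"
  "arcs (short_chord_quiver \<Gamma>) = (\<Union>b\<in>arcs \<Gamma>. {Chord_p b, Chord_q b})"
  "tail (short_chord_quiver \<Gamma>) = chord_start \<Gamma>"
  "head (short_chord_quiver \<Gamma>) = chord_end \<Gamma>"
  by (auto simp: short_chord_quiver_def)

lemma chord_cases:
  assumes "c \<in> arcs (chord_quiver \<Gamma>)"
  obtains (short) "c \<in> arcs (short_chord_quiver \<Gamma>)" "chord_degree c = 0"
  | (long) b where "b \<in> arcs \<Gamma>" "c = Chord_a1 b \<or> c = Chord_a2 b" "chord_degree c = 1"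
  using assms by auto

text \<open>
  The differentials of the long chords have this shape and hence lie in the corner \<open>e R e\<close>.
\<close>

lemma (in ring) corner_fixed:
  assumes "e \<in> carrier R" "x \<in> carrier R" "s \<in> carrier R" "p \<in> carrier R" "q \<in> carrier R"
    and "e \<otimes> x = x" "x \<otimes> e = x" "e \<otimes> s = s" "s \<otimes> e = s" "e \<otimes> q = q" "p \<otimes> e = p"
  shows "e \<otimes> ((x \<ominus> s) \<oplus> q \<otimes> p) \<otimes> e = (x \<ominus> s) \<oplus> q \<otimes> p"
proof -
  have "e \<otimes> ((x \<ominus> s) \<oplus> q \<otimes> p) = (x \<ominus> s) \<oplus> q \<otimes> p"
    using assms(1-5) by (simp add: minus_eq r_distr r_minus assms(6-) flip: m_assoc)
  then show ?thesis
    using assms(1-5) by (simp add: minus_eq l_distr l_minus m_assoc assms(6-))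
qed

lemma chord_diff_short: "chord_degree c = 0 \<Longrightarrow> chord_diff \<Gamma> Z K c = \<zero>\<^bsub>CE \<Gamma> Z K\<^esub>"
  by (cases c) auto

locale capped_hopf_links = fin_digraph \<Gamma>
  for \<Gamma> :: "('v, 'e) pre_digraph" +
  fixes Z :: "('v, 'e, 's::topological_space) zero_section" and K :: "('v, 'e, 's) capping_system"
  assumes group_pi1: "v \<in> verts \<Gamma> \<Longrightarrow> group (pi1 \<Gamma> Z K v)"
    and s_class_in_pi1: "b \<in> arcs \<Gamma> \<Longrightarrow> s_class \<Gamma> Z K b \<in> carrier (pi1 \<Gamma> Z K (head \<Gamma> b))"
    and t_class_in_pi1: "b \<in> arcs \<Gamma> \<Longrightarrow> t_class \<Gamma> Z K b \<in> carrier (pi1 \<Gamma> Z K (tail \<Gamma> b))"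
begin

sublocale chords: quiver_with_groups "chord_quiver \<Gamma>" "pi1 \<Gamma> Z K"
  rewrites "tensor_ring (chord_quiver \<Gamma>) (pi1 \<Gamma> Z K) = CE \<Gamma> Z K"
  by (rule quiver_with_groups.intro) (auto simp: group_pi1 CE_def)

sublocale short: quiver_with_groups "short_chord_quiver \<Gamma>" "pi1 \<Gamma> Z K"
  by (rule quiver_with_groups.intro) (auto simp: group_pi1)

abbreviation "P \<equiv> pi1 \<Gamma> Z K"
abbreviation "C \<equiv> CE \<Gamma> Z K"
abbreviation bdry (\<open>\<partial>\<close>) where "\<partial> \<equiv> word_diff \<Gamma> Z K"

lemma short_ops [simp]:
  "f \<otimes>\<^bsub>short.T\<^esub> g = f \<otimes>\<^bsub>C\<^esub> g" "f \<oplus>\<^bsub>short.T\<^esub> g = f \<oplus>\<^bsub>C\<^esub> g"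
  "\<one>\<^bsub>short.T\<^esub> = \<one>\<^bsub>C\<^esub>" "\<zero>\<^bsub>short.T\<^esub> = \<zero>\<^bsub>C\<^esub>" "scalar (short_chord_quiver \<Gamma>) P z = scalar (chord_quiver \<Gamma>) P z"
  by (simp_all add: CE_def tensor_ring_def scalar_def)

lemma short_word_iff: "short.word w \<longleftrightarrow> chords.word w \<and> word_degree w = 0"
  by (induction w) auto

lemma short_carrier: "carrier short.T = CE_degree \<Gamma> Z K 0"
  by (auto simp: short.tensor_carrier chords.tensor_carrier CE_degree_def short_word_iff)

lemma short_in_C: "f \<in> carrier short.T \<Longrightarrow> f \<in> carrier C"
  by (simp add: short_carrier CE_degree_def)

lemma short_minus: "f \<in> carrier short.T \<Longrightarrow> g \<in> carrier short.T \<Longrightarrow> f \<ominus>\<^bsub>short.T\<^esub> g = f \<ominus>\<^bsub>C\<^esub> g"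
  by (simp add: a_minus_def short.tensor_minus chords.tensor_minus short_in_C)

lemma word_degree_act_left [simp]: "word_degree (act_left G \<gamma> w) = word_degree w"
  by (cases w) auto

lemma word_degree_mult: "word_mult G u w = Some x \<Longrightarrow> word_degree x = word_degree u + word_degree w"
  by (induction u arbitrary: x) (auto split: if_splits)

subsection \<open>The differential of a word\<close>

lemma gen_short: "gen (short_chord_quiver \<Gamma>) P c = gen (chord_quiver \<Gamma>) P c"
  by (simp add: gen_def)

lemma short_base_closed:
  "b \<in> arcs \<Gamma> \<Longrightarrow> single_word (Base (tail \<Gamma> b) (t_class \<Gamma> Z K b)) \<in> carrier short.T"
  "b \<in> arcs \<Gamma> \<Longrightarrow> single_word (Base (head \<Gamma> b) (s_class \<Gamma> Z K b)) \<in> carrier short.T"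
  by (simp_all add: s_class_in_pi1 t_class_in_pi1)

lemma chord_diff_long:
  assumes "b \<in> arcs \<Gamma>"
  shows "chord_diff \<Gamma> Z K (Chord_a1 b) = (idem P (tail \<Gamma> b)
      \<ominus>\<^bsub>short.T\<^esub> single_word (Base (tail \<Gamma> b) (t_class \<Gamma> Z K b))) \<oplus>\<^bsub>short.T\<^esub>
      gen (short_chord_quiver \<Gamma>) P (Chord_q b) \<otimes>\<^bsub>short.T\<^esub> gen (short_chord_quiver \<Gamma>) P (Chord_p b)"
    and "chord_diff \<Gamma> Z K (Chord_a2 b) = (idem P (head \<Gamma> b)
      \<ominus>\<^bsub>short.T\<^esub> single_word (Base (head \<Gamma> b) (s_class \<Gamma> Z K b))) \<oplus>\<^bsub>short.T\<^esub>
      gen (short_chord_quiver \<Gamma>) P (Chord_p b) \<otimes>\<^bsub>short.T\<^esub> gen (short_chord_quiver \<Gamma>) P (Chord_q b)"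
  using short_minus short_base_closed assms by (simp_all add: gen_short)

lemma chord_diff_in_short:
  assumes "c \<in> arcs (chord_quiver \<Gamma>)"
  shows "chord_diff \<Gamma> Z K c \<in> carrier short.T"
  using assms
proof (cases rule: chord_cases)
  case short
  then show ?thesis
    using short.tensor_zero_closed by (simp add: chord_diff_short)
next
  case (long b)
  have gens: "gen (short_chord_quiver \<Gamma>) P (Chord_p b) \<in> carrier short.T"
    "gen (short_chord_quiver \<Gamma>) P (Chord_q b) \<in> carrier short.T"
    "idem P (tail \<Gamma> b) \<in> carrier short.T" "idem P (head \<Gamma> b) \<in> carrier short.T"
    using long(1) by simp_all
  show ?thesis
    using long(2) gens short_base_closed[OF long(1)] chord_diff_long[OF long(1)]
      short.tensor.minus_closed short.tensor.m_closed short.tensor.a_closed by metis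
qed

lemma chord_diff_closed [simp]: "c \<in> arcs (chord_quiver \<Gamma>) \<Longrightarrow> chord_diff \<Gamma> Z K c \<in> carrier C"
  by (rule short_in_C) (rule chord_diff_in_short)

lemma word_diff_closed [simp]: "chords.word w \<Longrightarrow> \<partial> w \<in> carrier C"
proof (induction w)
  case (Arrow v \<gamma> c w)
  then have "chords.word (Arrow v \<gamma> c (Base (chord_start \<Gamma> c) \<one>\<^bsub>P (chord_start \<Gamma> c)\<^esub>))"
    using chords.tail_in_verts[of c] by simp
  then show ?case
    using Arrow by simp
qed (simp add: chords.tensor_zero_closed)

lemma word_diff_degree0: "chords.word w \<Longrightarrow> word_degree w = 0 \<Longrightarrow> \<partial> w = \<zero>\<^bsub>C\<^esub>"
proof (induction w)
  case (Arrow v \<gamma> c w)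
  have "chord_diff \<Gamma> Z K c = \<zero>\<^bsub>C\<^esub>"
    using Arrow.prems by (simp add: chord_diff_short)
  then show ?case
    using Arrow by (simp add: chords.tensor_zero_mult chords.tensor_zero_closed)
qed simp

lemma leading_chord_mult:
  assumes "chords.word (Arrow v \<gamma> c w)"
  shows "scaled_word z (Arrow v \<gamma> c (Base (chord_start \<Gamma> c) \<one>\<^bsub>P (chord_start \<Gamma> c)\<^esub>)) \<otimes>\<^bsub>C\<^esub> single_word w
    = scaled_word z (Arrow v \<gamma> c w)"
  using assms chords.act_left_one[of w] by (simp add: chords.scaled_word_mult)

lemma leading_chord_word:
  "chords.word (Arrow v \<gamma> c w) \<Longrightarrow> chords.word (Arrow v \<gamma> c (Base (chord_start \<Gamma> c) \<one>\<^bsub>P (chord_start \<Gamma> c)\<^esub>))"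
  using chords.tail_in_verts[of c] by simp

text \<open>
  The Leibniz rule with a factor \<open>u\<close> of degree zero: its differential vanishes, and it causes no sign.
\<close>

lemma word_diff_mult_left:
  assumes "chords.word u" "word_degree u = 0" "chords.word w" "word_mult P u w = Some x"
  shows "\<partial> x = single_word u \<otimes>\<^bsub>C\<^esub> \<partial> w"
  using assms
proof (induction u arbitrary: x)
  case (Base v \<gamma>)
  show ?case
  proof (cases w)
    case (Base v' \<gamma>')
    then show ?thesis
      using Base.prems by (auto simp: chords.tensor_zero_mult split: if_splits)
  next
    case (Arrow v' \<gamma>' c w')
    let ?lead = "\<lambda>\<gamma>. Arrow v \<gamma> c (Base (chord_start \<Gamma> c) \<one>\<^bsub>P (chord_start \<Gamma> c)\<^esub>)"
    have v': "v' = v" "x = Arrow v (\<gamma> \<otimes>\<^bsub>P v\<^esub> \<gamma>') c w'"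
      using Base.prems Arrow by (auto split: if_splits)
    have words: "chords.word (Base v \<gamma>)" "chords.word (Base v \<gamma>')" "chords.word (?lead \<gamma>')" "chords.word w'"
      "c \<in> arcs (chord_quiver \<Gamma>)"
      using Base.prems Arrow v' leading_chord_word[of v \<gamma>' c w'] by auto
    have "single_word (Base v (\<gamma> \<otimes>\<^bsub>P v\<^esub> \<gamma>')) = single_word (Base v \<gamma>) \<otimes>\<^bsub>C\<^esub> single_word (Base v \<gamma>')"
      "scaled_word z (?lead (\<gamma> \<otimes>\<^bsub>P v\<^esub> \<gamma>')) = single_word (Base v \<gamma>) \<otimes>\<^bsub>C\<^esub> scaled_word z (?lead \<gamma>')" for z
      by (simp_all add: chords.scaled_word_mult)
    then show ?thesis
      using words unfolding v' Arrow
      by (simp add: chords.tensor.r_distr chords.tensor.m_assoc del: is_word.simps chord_quiver_simps)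
  qed
next
  case (Arrow v \<gamma> c u)
  let ?lead = "Arrow v \<gamma> c (Base (chord_start \<Gamma> c) \<one>\<^bsub>P (chord_start \<Gamma> c)\<^esub>)"
  obtain y where y: "word_mult P u w = Some y" "x = Arrow v \<gamma> c y"
    using Arrow.prems by auto
  have c: "c \<in> arcs (chord_quiver \<Gamma>)" "chord_degree c = 0" and u: "chords.word u" "word_degree u = 0"
    and wy: "chords.word y" "chords.word (Base v \<gamma>)"
    using Arrow.prems chords.word_mult_Some[OF _ _ y(1)] by auto
  have dc: "chord_diff \<Gamma> Z K c = \<zero>\<^bsub>C\<^esub>"
    using c by (simp add: chord_diff_short)
  have "\<partial> x = single_word ?lead \<otimes>\<^bsub>C\<^esub> (single_word u \<otimes>\<^bsub>C\<^esub> \<partial> w)"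
    using wy Arrow.prems(3) leading_chord_word[OF Arrow.prems(1)] u Arrow.IH[OF u Arrow.prems(3) y(1)]
    by (simp add: y(2) dc c(2) chords.tensor_zero_mult del: is_word.simps chord_quiver_simps)
  also have "\<dots> = single_word (Arrow v \<gamma> c u) \<otimes>\<^bsub>C\<^esub> \<partial> w"
    using leading_chord_word[OF Arrow.prems(1)] u Arrow.prems(3)
    by (simp add: leading_chord_mult[OF Arrow.prems(1)] del: is_word.simps chord_quiver_simps
        flip: chords.tensor.m_assoc)
  finally show ?case .
qed

lemma word_diff_mult_right:
  assumes "chords.word w" "chords.word u" "word_degree u = 0" "word_mult P w u = Some x"
  shows "\<partial> x = \<partial> w \<otimes>\<^bsub>C\<^esub> single_word u"
  using assms
proof (induction w arbitrary: x)
  case (Base v \<gamma>)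
  then have "\<partial> x = \<zero>\<^bsub>C\<^esub>"
    using chords.word_mult_Some[of "Base v \<gamma>" u x] word_degree_mult[of P "Base v \<gamma>" u x]
    by (intro word_diff_degree0) auto
  then show ?case
    by (simp add: chords.tensor_zero_mult)
next
  case (Arrow v \<gamma> c w)
  obtain y where y: "word_mult P w u = Some y" "x = Arrow v \<gamma> c y"
    using Arrow.prems by auto
  have wy: "chords.word y" "chords.word (Base v \<gamma>)" "c \<in> arcs (chord_quiver \<Gamma>)" "chords.word w"
    using Arrow.prems chords.word_mult_Some[OF _ _ y(1)] by auto
  have "single_word y = single_word w \<otimes>\<^bsub>C\<^esub> single_word u"
    using y by (simp add: chords.scaled_word_mult)
  then show ?case
    using wy Arrow.prems(2) leading_chord_word[OF Arrow.prems(1)] Arrow.IH[OF wy(4) Arrow.prems(2,3) y(1)]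
    by (simp add: y(2) chords.tensor.l_distr chords.tensor.m_assoc del: is_word.simps chord_quiver_simps)
qed

subsection \<open>The differential is linear over the algebra of short chords\<close>

lemma CE_diff_superset:
  assumes "finite U" "{w. f w \<noteq> 0} \<subseteq> U"
  shows "CE_diff \<Gamma> Z K f = (\<lambda>u. \<Sum>w\<in>U. f w * \<partial> w u)"
  unfolding CE_diff_def using assms by (intro ext sum.mono_neutral_left) auto

lemma CE_diff_scaled_word:
  "chords.word w \<Longrightarrow> CE_diff \<Gamma> Z K (scaled_word z w) = scalar (chord_quiver \<Gamma>) P z \<otimes>\<^bsub>C\<^esub> \<partial> w"
  by (subst CE_diff_superset[of "{w}"])
    (auto simp: scaled_word_def chords.scalar_mult)

lemma CE_diff_add:
  assumes "f \<in> carrier C" "g \<in> carrier C"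
  shows "CE_diff \<Gamma> Z K (f \<oplus>\<^bsub>C\<^esub> g) = CE_diff \<Gamma> Z K f \<oplus>\<^bsub>C\<^esub> CE_diff \<Gamma> Z K g"
proof -
  let ?U = "{w. f w \<noteq> 0} \<union> {w. g w \<noteq> 0}"
  have U: "finite ?U" "{w. (f \<oplus>\<^bsub>C\<^esub> g) w \<noteq> 0} \<subseteq> ?U"
    using assms by (auto simp: chords.tensor_carrier chords.tensor_add)
  show ?thesis
    unfolding CE_diff_superset[OF U] CE_diff_superset[OF U(1), of f, simplified]
      CE_diff_superset[OF U(1), of g, simplified]
    by (simp add: chords.tensor_add ring_distribs sum.distrib)
qed

lemma CE_diff_zero: "CE_diff \<Gamma> Z K \<zero>\<^bsub>C\<^esub> = \<zero>\<^bsub>C\<^esub>"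
  by (simp add: CE_diff_def chords.tensor_zero)

lemma CE_diff_closed: "f \<in> carrier C \<Longrightarrow> CE_diff \<Gamma> Z K f \<in> carrier C"
  by (induction f rule: chords.tensor_induct)
    (simp_all add: CE_diff_zero CE_diff_add CE_diff_scaled_word chords.tensor_zero_closed)

lemma word_diff_ends:
  assumes "chords.word w"
  shows "single_word (Base (left_end w) \<one>\<^bsub>P (left_end w)\<^esub>) \<otimes>\<^bsub>C\<^esub> \<partial> w = \<partial> w"
    and "\<partial> w \<otimes>\<^bsub>C\<^esub> single_word (Base (right_end w) \<one>\<^bsub>P (right_end w)\<^esub>) = \<partial> w"
  using assms chords.left_end_in_verts[of w] chords.right_end_in_verts[of w]
  by (auto intro!: word_diff_mult_left[symmetric] word_diff_mult_right[symmetric]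
      simp: chords.word_mult_idem_right chords.act_left_one)

text \<open>
  The differential of a word has the same ends as the word, so that products of non-composable
  words remain zero after differentiation.
\<close>

lemma single_word_mult_word_diff:
  assumes "chords.word u" "word_degree u = 0" "chords.word w"
  shows "single_word u \<otimes>\<^bsub>C\<^esub> \<partial> w = (case word_mult P u w of None \<Rightarrow> \<zero>\<^bsub>C\<^esub> | Some x \<Rightarrow> \<partial> x)"
    and "\<partial> w \<otimes>\<^bsub>C\<^esub> single_word u = (case word_mult P w u of None \<Rightarrow> \<zero>\<^bsub>C\<^esub> | Some x \<Rightarrow> \<partial> x)"
proof -
  let ?l = "Base (left_end w) \<one>\<^bsub>P (left_end w)\<^esub>" and ?r = "Base (right_end w) \<one>\<^bsub>P (right_end w)\<^esub>"
  have words: "chords.word ?l" "chords.word ?r"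
    using assms chords.left_end_in_verts[of w] chords.right_end_in_verts[of w] by auto
  show "single_word u \<otimes>\<^bsub>C\<^esub> \<partial> w = (case word_mult P u w of None \<Rightarrow> \<zero>\<^bsub>C\<^esub> | Some x \<Rightarrow> \<partial> x)"
  proof (cases "word_mult P u w")
    case None
    have "single_word u \<otimes>\<^bsub>C\<^esub> \<partial> w = (single_word u \<otimes>\<^bsub>C\<^esub> single_word ?l) \<otimes>\<^bsub>C\<^esub> \<partial> w"
      using words assms by (simp add: word_diff_ends chords.tensor.m_assoc del: is_word.simps)
    then show ?thesis
      using None assms chords.word_mult_None_iff[of u w] chords.left_end_in_verts[of w]
      by (simp add: chords.scaled_word_mult chords.word_mult_idem_right chords.tensor_zero_mult)
  qed (simp add: word_diff_mult_left[OF assms])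
  show "\<partial> w \<otimes>\<^bsub>C\<^esub> single_word u = (case word_mult P w u of None \<Rightarrow> \<zero>\<^bsub>C\<^esub> | Some x \<Rightarrow> \<partial> x)"
  proof (cases "word_mult P w u")
    case None
    have "\<partial> w \<otimes>\<^bsub>C\<^esub> single_word u = \<partial> w \<otimes>\<^bsub>C\<^esub> (single_word ?r \<otimes>\<^bsub>C\<^esub> single_word u)"
      using words assms by (simp add: word_diff_ends del: is_word.simps flip: chords.tensor.m_assoc)
    then show ?thesis
      using None assms chords.word_mult_None_iff[of w u]
      by (simp add: chords.scaled_word_mult chords.word_mult_idem_left chords.tensor_zero_mult del: word_mult.simps)
  qed (simp add: word_diff_mult_right[OF assms(3,1,2)])
qed

lemma CE_diff_mult_words:
  assumes u: "chords.word u" "word_degree u = 0" and w: "chords.word w"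
  shows "CE_diff \<Gamma> Z K (scaled_word z u \<otimes>\<^bsub>C\<^esub> scaled_word z' w) = scaled_word z u \<otimes>\<^bsub>C\<^esub> CE_diff \<Gamma> Z K (scaled_word z' w)"
    and "CE_diff \<Gamma> Z K (scaled_word z' w \<otimes>\<^bsub>C\<^esub> scaled_word z u) = CE_diff \<Gamma> Z K (scaled_word z' w) \<otimes>\<^bsub>C\<^esub> scaled_word z u"
proof -
  let ?s = "scalar (chord_quiver \<Gamma>) P"
  have c: "single_word u \<in> carrier C" "\<partial> w \<in> carrier C"
    using u w by auto
  have "scaled_word z u \<otimes>\<^bsub>C\<^esub> CE_diff \<Gamma> Z K (scaled_word z' w) =
      ?s z \<otimes>\<^bsub>C\<^esub> ((single_word u \<otimes>\<^bsub>C\<^esub> ?s z') \<otimes>\<^bsub>C\<^esub> \<partial> w)"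
    using u w c by (simp add: CE_diff_scaled_word chords.scaled_word_eq[of u z] chords.tensor.m_assoc)
  also have "\<dots> = ?s (z * z') \<otimes>\<^bsub>C\<^esub> (single_word u \<otimes>\<^bsub>C\<^esub> \<partial> w)"
    using c by (simp add: chords.scalars.\<sigma>_mult chords.scalars.\<sigma>_central[of "single_word u" z'] chords.tensor.m_assoc)
  finally show "CE_diff \<Gamma> Z K (scaled_word z u \<otimes>\<^bsub>C\<^esub> scaled_word z' w) =
      scaled_word z u \<otimes>\<^bsub>C\<^esub> CE_diff \<Gamma> Z K (scaled_word z' w)"
    using u w chords.word_mult_Some[of u w]
    by (auto simp: single_word_mult_word_diff chords.scaled_word_mult CE_diff_zero CE_diff_scaled_word
        split: option.splits)
  have "CE_diff \<Gamma> Z K (scaled_word z' w) \<otimes>\<^bsub>C\<^esub> scaled_word z u =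
      ?s z' \<otimes>\<^bsub>C\<^esub> ((\<partial> w \<otimes>\<^bsub>C\<^esub> ?s z) \<otimes>\<^bsub>C\<^esub> single_word u)"
    using u w c by (simp add: CE_diff_scaled_word chords.scaled_word_eq[of u z] chords.tensor.m_assoc)
  also have "\<dots> = ?s (z' * z) \<otimes>\<^bsub>C\<^esub> (\<partial> w \<otimes>\<^bsub>C\<^esub> single_word u)"
    using c by (simp add: chords.scalars.\<sigma>_mult chords.scalars.\<sigma>_central[of "\<partial> w" z] chords.tensor.m_assoc)
  finally show "CE_diff \<Gamma> Z K (scaled_word z' w \<otimes>\<^bsub>C\<^esub> scaled_word z u) =
      CE_diff \<Gamma> Z K (scaled_word z' w) \<otimes>\<^bsub>C\<^esub> scaled_word z u"
    using u w chords.word_mult_Some[of w u]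
    by (auto simp: single_word_mult_word_diff chords.scaled_word_mult CE_diff_zero CE_diff_scaled_word
        split: option.splits)
qed

lemma CE_diff_mult:
  assumes f: "f \<in> carrier short.T" and g: "g \<in> carrier C"
  shows "CE_diff \<Gamma> Z K (f \<otimes>\<^bsub>C\<^esub> g) = f \<otimes>\<^bsub>C\<^esub> CE_diff \<Gamma> Z K g"
    and "CE_diff \<Gamma> Z K (g \<otimes>\<^bsub>C\<^esub> f) = CE_diff \<Gamma> Z K g \<otimes>\<^bsub>C\<^esub> f"
proof -
  note s = CE_diff_add CE_diff_zero CE_diff_closed chords.tensor.l_distr chords.tensor.r_distr
    chords.tensor_zero_mult short_in_C
  have w: "CE_diff \<Gamma> Z K (scaled_word z u \<otimes>\<^bsub>C\<^esub> g) = scaled_word z u \<otimes>\<^bsub>C\<^esub> CE_diff \<Gamma> Z K g"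
    "CE_diff \<Gamma> Z K (g \<otimes>\<^bsub>C\<^esub> scaled_word z u) = CE_diff \<Gamma> Z K g \<otimes>\<^bsub>C\<^esub> scaled_word z u"
    if "chords.word u" "word_degree u = 0" for z u
    using g by (induction g rule: chords.tensor_induct) (use that in \<open>simp_all add: s CE_diff_mult_words\<close>)
  show "CE_diff \<Gamma> Z K (f \<otimes>\<^bsub>C\<^esub> g) = f \<otimes>\<^bsub>C\<^esub> CE_diff \<Gamma> Z K g"
    using f by (induction f rule: short.tensor_induct) (use g in \<open>simp_all add: s w short_word_iff\<close>)
  show "CE_diff \<Gamma> Z K (g \<otimes>\<^bsub>C\<^esub> f) = CE_diff \<Gamma> Z K g \<otimes>\<^bsub>C\<^esub> f"
    using f by (induction f rule: short.tensor_induct) (use g in \<open>simp_all add: s w short_word_iff\<close>)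
qed

text \<open>
  A word of degree zero consists of short chords, whose differentials vanish; hence all elements of
  degree zero are cycles.
\<close>

lemma CE_cycles0_eq: "CE_cycles0 \<Gamma> Z K = short.T"
proof -
  have "CE_diff \<Gamma> Z K f = \<zero>\<^bsub>C\<^esub>" if "f \<in> CE_degree \<Gamma> Z K 0" for f
  proof -
    have "f w * \<partial> w u = 0" for w u
      using that word_diff_degree0[of w]
      by (cases "f w = 0") (auto simp: CE_degree_def chords.tensor_carrier chords.tensor_zero)
    from this show ?thesis
      unfolding CE_diff_def chords.tensor_zero by (intro ext sum.neutral) blast
  qed
  then have "{f \<in> CE_degree \<Gamma> Z K 0. CE_diff \<Gamma> Z K f = \<zero>\<^bsub>C\<^esub>} = carrier short.T"
    by (auto simp: short_carrier)
  then show ?thesis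
    by (simp add: CE_cycles0_def CE_def tensor_ring_def)
qed

text \<open>
  A word of degree one contains exactly one long chord, and its differential is obtained by
  replacing this chord by its differential.
\<close>

lemma word_diff_in_ideal:
  assumes I: "ideal I short.T"
    and relations: "\<And>b. b \<in> arcs \<Gamma> \<Longrightarrow> chord_diff \<Gamma> Z K (Chord_a1 b) \<in> I"
      "\<And>b. b \<in> arcs \<Gamma> \<Longrightarrow> chord_diff \<Gamma> Z K (Chord_a2 b) \<in> I"
    and w: "chords.word w" "word_degree w = 1"
  shows "\<partial> w \<in> I"
  using w
proof (induction w)
  case (Arrow v \<gamma> c w)
  interpret I: ideal I short.T by fact
  have wv: "chords.word w" "c \<in> arcs (chord_quiver \<Gamma>)" "short.word (Base v \<gamma>)"
    using Arrow.prems by auto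
  show ?case
    using wv(2)
  proof (cases rule: chord_cases)
    case short
    have "short.word (Arrow v \<gamma> c (Base (chord_start \<Gamma> c) \<one>\<^bsub>P (chord_start \<Gamma> c)\<^esub>))"
      using leading_chord_word[OF Arrow.prems(1)] short by (simp add: short_word_iff del: is_word.simps)
    then show ?thesis
      using I.I_l_closed[of "\<partial> w"] Arrow wv short
      by (simp add: chords.tensor_zero_mult chord_diff_short)
  next
    case (long b)
    have dw: "\<partial> w = \<zero>\<^bsub>C\<^esub>" and sw: "short.word w"
      using wv Arrow.prems long word_diff_degree0[of w] by (auto simp: short_word_iff)
    have "chord_diff \<Gamma> Z K c \<in> I"
      using long relations by auto
    then have "single_word (Base v \<gamma>) \<otimes>\<^bsub>C\<^esub> chord_diff \<Gamma> Z K c \<otimes>\<^bsub>C\<^esub> single_word w \<in> I"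
      using I.I_l_closed I.I_r_closed sw wv(3) short.scaled_word_carrier by (metis short_ops(1))
    then show ?thesis
      using leading_chord_word[OF Arrow.prems(1)] I.a_Hcarr[THEN short_in_C]
      by (simp add: dw chords.tensor_zero_mult)
  qed
qed simp

lemma boundaries_subset_ideal:
  assumes I: "ideal I short.T"
    and relations: "\<And>b. b \<in> arcs \<Gamma> \<Longrightarrow> chord_diff \<Gamma> Z K (Chord_a1 b) \<in> I"
      "\<And>b. b \<in> arcs \<Gamma> \<Longrightarrow> chord_diff \<Gamma> Z K (Chord_a2 b) \<in> I"
  shows "CE_boundaries0 \<Gamma> Z K \<subseteq> I"
proof
  interpret I: ideal I short.T by fact
  fix j assume "j \<in> CE_boundaries0 \<Gamma> Z K"
  then obtain f where f: "f \<in> CE_degree \<Gamma> Z K 1" "j = CE_diff \<Gamma> Z K f"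
    by (auto simp: CE_boundaries0_def)
  have "(\<lambda>u. \<Sum>w\<in>U. f w * \<partial> w u) \<in> I" if "finite U" "U \<subseteq> {w. f w \<noteq> 0}" for U
    using that
  proof (induction U)
    case empty
    then show ?case
      using I.zero_closed by (simp add: chords.tensor_zero)
  next
    case (insert w U)
    have w: "\<partial> w \<in> I"
      using insert.prems f(1)
      by (intro word_diff_in_ideal[OF assms]) (auto simp: CE_degree_def chords.tensor_carrier)
    have "(\<lambda>u. \<Sum>w\<in>insert w U. f w * \<partial> w u) =
        scalar (chord_quiver \<Gamma>) P (f w) \<otimes>\<^bsub>C\<^esub> \<partial> w \<oplus>\<^bsub>C\<^esub> (\<lambda>u. \<Sum>w\<in>U. f w * \<partial> w u)"
      using insert.hyps short_in_C[OF I.a_Hcarr[OF w]]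
      by (simp add: chords.scalar_mult chords.tensor_add)
    then show ?case
      using I.a_closed[of "scalar (chord_quiver \<Gamma>) P (f w) \<otimes>\<^bsub>C\<^esub> \<partial> w"] insert
        I.I_l_closed[OF w short.scalars.\<sigma>_closed[of "f w"]]
      by simp
  qed
  from this[of "{w. f w \<noteq> 0}"] show "j \<in> I"
    using f by (simp add: CE_diff_def CE_degree_def chords.tensor_carrier)
qed

lemma degree1_mult:
  assumes "f \<in> CE_degree \<Gamma> Z K 0" "g \<in> CE_degree \<Gamma> Z K 1"
  shows "f \<otimes>\<^bsub>C\<^esub> g \<in> CE_degree \<Gamma> Z K 1" "g \<otimes>\<^bsub>C\<^esub> f \<in> CE_degree \<Gamma> Z K 1"
  using assms by (auto simp: CE_degree_def dest!: word_degree_mult elim!: chords.tensor_mult_support)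

text \<open>
  Linearity of the differential over the cycles makes its image on degree one a two-sided ideal.
\<close>

lemma ideal_boundaries: "ideal (CE_boundaries0 \<Gamma> Z K) short.T"
proof -
  let ?J = "CE_boundaries0 \<Gamma> Z K"
  have sub: "?J \<subseteq> carrier short.T"
    by (rule boundaries_subset_ideal[OF short.tensor.oneideal]; rule chord_diff_in_short; auto)
  have l: "f \<otimes>\<^bsub>C\<^esub> j \<in> ?J" and r: "j \<otimes>\<^bsub>C\<^esub> f \<in> ?J" if jf: "j \<in> ?J" "f \<in> carrier short.T" for f j
  proof -
    obtain g where g: "g \<in> CE_degree \<Gamma> Z K 1" "j = CE_diff \<Gamma> Z K g"
      using jf(1) unfolding CE_boundaries0_def by blast
    then have "f \<otimes>\<^bsub>C\<^esub> j = CE_diff \<Gamma> Z K (f \<otimes>\<^bsub>C\<^esub> g)" "j \<otimes>\<^bsub>C\<^esub> f = CE_diff \<Gamma> Z K (g \<otimes>\<^bsub>C\<^esub> f)"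
      using CE_diff_mult[OF jf(2), of g] by (simp_all add: CE_degree_def)
    then show "f \<otimes>\<^bsub>C\<^esub> j \<in> ?J" "j \<otimes>\<^bsub>C\<^esub> f \<in> ?J"
      using jf(2) degree1_mult[of f g] g(1) unfolding CE_boundaries0_def short_carrier by blast+
  qed
  have add: "i \<oplus>\<^bsub>C\<^esub> j \<in> ?J" if ij: "i \<in> ?J" "j \<in> ?J" for i j
  proof -
    obtain f g where fg: "f \<in> CE_degree \<Gamma> Z K 1" "i = CE_diff \<Gamma> Z K f"
      "g \<in> CE_degree \<Gamma> Z K 1" "j = CE_diff \<Gamma> Z K g"
      using ij unfolding CE_boundaries0_def by blast
    have "f w \<noteq> 0 \<or> g w \<noteq> 0" if "(f \<oplus>\<^bsub>C\<^esub> g) w \<noteq> 0" for w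
      using that by (auto simp: chords.tensor_add)
    then have "f \<oplus>\<^bsub>C\<^esub> g \<in> CE_degree \<Gamma> Z K 1"
      using fg chords.tensor_add_closed[of f g] unfolding CE_degree_def by blast
    moreover have "i \<oplus>\<^bsub>C\<^esub> j = CE_diff \<Gamma> Z K (f \<oplus>\<^bsub>C\<^esub> g)"
      using fg CE_diff_add[of f g] by (simp add: CE_degree_def)
    ultimately show ?thesis
      unfolding CE_boundaries0_def by blast
  qed
  have zero: "\<zero>\<^bsub>C\<^esub> \<in> ?J"
    unfolding CE_boundaries0_def CE_degree_def
    by (rule image_eqI[of _ _ "\<zero>\<^bsub>C\<^esub>"])
      (auto simp: CE_diff_zero chords.tensor_zero_closed, auto simp: chords.tensor_zero)
  show ?thesis
  proof (rule idealI[OF short.ring_tensor])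
    show "subgroup ?J (add_monoid short.T)"
    proof (rule short.tensor.add.subgroupI)
      show "\<ominus>\<^bsub>short.T\<^esub> j \<in> ?J" if "j \<in> ?J" for j
      proof -
        have j: "j \<in> carrier short.T"
          using that sub by blast
        have "\<ominus>\<^bsub>short.T\<^esub> j = (\<ominus>\<^bsub>short.T\<^esub> \<one>\<^bsub>short.T\<^esub>) \<otimes>\<^bsub>short.T\<^esub> j"
          by (simp only: short.tensor.l_minus[OF short.tensor.one_closed j] short.tensor.l_one[OF j])
        then show ?thesis
          unfolding short_ops(1)
          by (simp only: l[OF that short.tensor.a_inv_closed[OF short.tensor.one_closed]])
      qed
    qed (use sub zero add in \<open>auto simp del: One_nat_def\<close>)
  qed (use l r in auto)
qed

text \<open>
  A long chord alone, between trivial loops, is a word of degree one.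
\<close>

lemma long_chord_diff_in_boundaries:
  assumes c: "c \<in> arcs (chord_quiver \<Gamma>)" "chord_degree c = 1"
  shows "chord_diff \<Gamma> Z K c \<in> CE_boundaries0 \<Gamma> Z K"
proof -
  let ?h = "Base (chord_end \<Gamma> c) \<one>\<^bsub>P (chord_end \<Gamma> c)\<^esub>" and ?t = "Base (chord_start \<Gamma> c) \<one>\<^bsub>P (chord_start \<Gamma> c)\<^esub>"
  have words: "chords.word ?h" "chords.word ?t"
    using chords.head_in_verts[OF c(1)] chords.tail_in_verts[OF c(1)] by simp_all
  let ?w = "Arrow (chord_end \<Gamma> c) \<one>\<^bsub>P (chord_end \<Gamma> c)\<^esub> c ?t"
  have w: "chords.word ?w"
    using words c(1) by simp
  have "single_word ?w \<in> CE_degree \<Gamma> Z K 1"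
    using chords.scaled_word_carrier[OF w] c(2) by (auto simp: CE_degree_def scaled_word_def split: if_splits)
  moreover have "CE_diff \<Gamma> Z K (single_word ?w) = single_word ?h \<otimes>\<^bsub>C\<^esub> chord_diff \<Gamma> Z K c \<otimes>\<^bsub>C\<^esub> single_word ?t"
    using words w c by (simp add: CE_diff_scaled_word chords.scalars.\<sigma>_one chords.tensor_zero_mult
      del: is_word.simps chord_quiver_simps)
  moreover have "single_word ?h \<otimes>\<^bsub>C\<^esub> chord_diff \<Gamma> Z K c \<otimes>\<^bsub>C\<^esub> single_word ?t = chord_diff \<Gamma> Z K c"
  proof -
    note e = chords.idem_mult_base
    note e_gen = chords.idem_mult_gen
    obtain b where b: "b \<in> arcs \<Gamma>" "c = Chord_a1 b \<or> c = Chord_a2 b"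
      using c by auto
    have arcs: "Chord_p b \<in> arcs (chord_quiver \<Gamma>)" "Chord_q b \<in> arcs (chord_quiver \<Gamma>)"
      using b by auto
    have verts: "tail \<Gamma> b \<in> verts (chord_quiver \<Gamma>)" "head \<Gamma> b \<in> verts (chord_quiver \<Gamma>)"
      using b(1) by auto
    note ee = chords.idem_mult_idem
    have loops: "single_word (Base (tail \<Gamma> b) (t_class \<Gamma> Z K b)) \<in> carrier C"
      "single_word (Base (head \<Gamma> b) (s_class \<Gamma> Z K b)) \<in> carrier C"
      using b(1) by (simp_all add: s_class_in_pi1 t_class_in_pi1)
    note facts = chords.idem_closed[OF verts(1)] chords.idem_closed[OF verts(2)] chords.gen_closed[OF arcs(1)]
      chords.gen_closed[OF arcs(2)] ee[OF verts(1)] ee[OF verts(2)] loops e_gen[OF arcs(1), simplified]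
      e_gen[OF arcs(2), simplified]
      e[of "tail \<Gamma> b", OF _ t_class_in_pi1[OF b(1)]] e[of "head \<Gamma> b", OF _ s_class_in_pi1[OF b(1)]]
    show ?thesis
      using b(2)
    proof
      assume a: "c = Chord_a1 b"
      show ?thesis
        unfolding a chord_diff.simps chord_end.simps chord_start.simps idem_def[symmetric]
        by (rule chords.tensor.corner_fixed) (use b(1) facts in simp_all)
    next
      assume a: "c = Chord_a2 b"
      show ?thesis
        unfolding a chord_diff.simps chord_end.simps chord_start.simps idem_def[symmetric]
        by (rule chords.tensor.corner_fixed) (use b(1) facts in simp_all)
    qed
  qed
  ultimately show ?thesis
    unfolding CE_boundaries0_def by (metis image_eqI)
qed

end

section \<open>Units of corner rings\<close>

text \<open>
  The group of units of the corner ring \<open>e A e\<close>, whose unit element is \<open>e\<close>.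
\<close>

definition corner_units :: "('a, 'm) ring_scheme \<Rightarrow> 'a \<Rightarrow> 'a monoid" where
  "corner_units A e =
    \<lparr> carrier = {x \<in> carrier A. e \<otimes>\<^bsub>A\<^esub> x = x \<and> x \<otimes>\<^bsub>A\<^esub> e = x \<and>
        (\<exists>y\<in>carrier A. e \<otimes>\<^bsub>A\<^esub> y = y \<and> y \<otimes>\<^bsub>A\<^esub> e = y \<and> x \<otimes>\<^bsub>A\<^esub> y = e \<and> y \<otimes>\<^bsub>A\<^esub> x = e)},
      monoid.mult = (\<otimes>\<^bsub>A\<^esub>),
      monoid.one = e \<rparr>"

lemma corner_units_simps [simp]:
  "x \<otimes>\<^bsub>corner_units A e\<^esub> y = x \<otimes>\<^bsub>A\<^esub> y" "\<one>\<^bsub>corner_units A e\<^esub> = e"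
  by (simp_all add: corner_units_def)

lemma corner_unitsD:
  "x \<in> carrier (corner_units A e) \<Longrightarrow> x \<in> carrier A"
  "x \<in> carrier (corner_units A e) \<Longrightarrow> e \<otimes>\<^bsub>A\<^esub> x = x"
  "x \<in> carrier (corner_units A e) \<Longrightarrow> x \<otimes>\<^bsub>A\<^esub> e = x"
  by (simp_all add: corner_units_def)

context ring
begin

lemma corner_unitsI:
  assumes "x \<in> carrier R" "y \<in> carrier R" "e \<otimes> x = x" "x \<otimes> e = x" "e \<otimes> y = y" "y \<otimes> e = y"
    and "x \<otimes> y = e" "y \<otimes> x = e"
  shows "x \<in> carrier (corner_units R e)"
  using assms by (auto simp: corner_units_def)

lemma group_corner_units:
  assumes e: "e \<in> carrier R" "e \<otimes> e = e"
  shows "group (corner_units R e)"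
proof (rule groupI)
  fix x y z assume xyz: "x \<in> carrier (corner_units R e)" "y \<in> carrier (corner_units R e)" "z \<in> carrier (corner_units R e)"
  note c = corner_unitsD[OF xyz(1)] corner_unitsD[OF xyz(2)] corner_unitsD[OF xyz(3)]
  obtain x' where x': "x' \<in> carrier R" "e \<otimes> x' = x'" "x' \<otimes> e = x'" "x \<otimes> x' = e" "x' \<otimes> x = e"
    using xyz(1) by (auto simp: corner_units_def)
  obtain y' where y': "y' \<in> carrier R" "e \<otimes> y' = y'" "y' \<otimes> e = y'" "y \<otimes> y' = e" "y' \<otimes> y = e"
    using xyz(2) by (auto simp: corner_units_def)
  show "x \<otimes>\<^bsub>corner_units R e\<^esub> y \<otimes>\<^bsub>corner_units R e\<^esub> z = x \<otimes>\<^bsub>corner_units R e\<^esub> (y \<otimes>\<^bsub>corner_units R e\<^esub> z)"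
    using c by (simp add: m_assoc)
  show "\<one>\<^bsub>corner_units R e\<^esub> \<otimes>\<^bsub>corner_units R e\<^esub> x = x"
    using c by simp
  have "x' \<in> carrier (corner_units R e)"
    using x' c by (intro corner_unitsI[of x' x]) auto
  then show "\<exists>y\<in>carrier (corner_units R e). y \<otimes>\<^bsub>corner_units R e\<^esub> x = \<one>\<^bsub>corner_units R e\<^esub>"
    using x' by auto
  have "x \<otimes> y \<in> carrier (corner_units R e)"
  proof (rule corner_unitsI[of _ "y' \<otimes> x'"])
    show "e \<otimes> (x \<otimes> y) = x \<otimes> y" "e \<otimes> (y' \<otimes> x') = y' \<otimes> x'"
      using c x' y' e by (simp_all flip: m_assoc)
    show "x \<otimes> y \<otimes> e = x \<otimes> y" "y' \<otimes> x' \<otimes> e = y' \<otimes> x'"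
      using c x' y' e by (simp_all add: m_assoc)
    have "x \<otimes> y \<otimes> (y' \<otimes> x') = x \<otimes> ((y \<otimes> y') \<otimes> x')"
      by (simp only: m_assoc m_closed c(1,4) x'(1) y'(1))
    then show "x \<otimes> y \<otimes> (y' \<otimes> x') = e"
      using x' y' by simp
    have "y' \<otimes> x' \<otimes> (x \<otimes> y) = y' \<otimes> ((x' \<otimes> x) \<otimes> y)"
      by (simp only: m_assoc m_closed c(1,4) x'(1) y'(1))
    then show "y' \<otimes> x' \<otimes> (x \<otimes> y) = e"
      using c x' y' by simp
  qed (use c x' y' in auto)
  then show "x \<otimes>\<^bsub>corner_units R e\<^esub> y \<in> carrier (corner_units R e)"
    by simp
next
  show "\<one>\<^bsub>corner_units R e\<^esub> \<in> carrier (corner_units R e)"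
    using e by (auto intro!: corner_unitsI[of e e])
qed

lemma corner_units_inv:
  assumes e: "e \<in> carrier R" "e \<otimes> e = e"
    and "x \<in> carrier R" "y \<in> carrier R" "e \<otimes> x = x" "x \<otimes> e = x" "e \<otimes> y = y" "y \<otimes> e = y"
    and "x \<otimes> y = e" "y \<otimes> x = e"
  shows "inv\<^bsub>corner_units R e\<^esub> x = y"
proof (rule group.inv_equality[OF group_corner_units[OF e]])
  show "x \<in> carrier (corner_units R e)"
    using assms by (intro corner_unitsI[of x y])
  show "y \<in> carrier (corner_units R e)"
    using assms by (intro corner_unitsI[of y x])
qed (simp add: assms)

lemma minus_add_eq_zero_iff:
  assumes "x \<in> carrier R" "s \<in> carrier R" "y \<in> carrier R"
  shows "(x \<ominus> s) \<oplus> y = \<zero> \<longleftrightarrow> x \<oplus> y = s"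
proof
  assume "(x \<ominus> s) \<oplus> y = \<zero>"
  moreover have "x \<oplus> y = ((x \<ominus> s) \<oplus> y) \<oplus> s"
    using assms by algebra
  ultimately show "x \<oplus> y = s"
    using assms by simp
next
  have "(x \<ominus> s) \<oplus> y = (x \<oplus> y) \<ominus> s"
    using assms by algebra
  moreover assume "x \<oplus> y = s"
  ultimately show "(x \<ominus> s) \<oplus> y = \<zero>"
    using assms by (simp add: minus_eq r_neg)
qed

text \<open>
  The identity behind this is that \<open>1 + pq\<close> is invertible as soon as \<open>1 + qp\<close> is, with inverse
  \<open>1 - p (1 + qp)\<^sup>-\<^sup>1 q\<close>.
\<close>

lemma one_plus_swap:
  assumes c: "e \<in> carrier R" "f \<in> carrier R" "p \<in> carrier R" "q \<in> carrier R" "t \<in> carrier R" "t' \<in> carrier R"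
    and e: "e \<otimes> e = e" "e \<otimes> p = p" "p \<otimes> f = p" "f \<otimes> q = q" "q \<otimes> e = q"
    and t: "f \<oplus> q \<otimes> p = t" "t \<otimes> t' = f" "t' \<otimes> t = f" "f \<otimes> t' = t'" "t' \<otimes> f = t'"
  shows "e \<oplus> p \<otimes> q \<in> carrier (corner_units R e)"
proof -
  \<comment> \<open>The inverse is \<open>e - a\<close>: expanding \<open>p (t t') q\<close> and \<open>p (t' t) q\<close> gives \<open>b = a + b a = a + a b\<close>.\<close>
  define b where "b = p \<otimes> q"
  define a where "a = p \<otimes> (t' \<otimes> q)"
  have cab: "a \<in> carrier R" "b \<in> carrier R"
    using c by (simp_all add: a_def b_def)
  have eb: "e \<otimes> b = b" "b \<otimes> e = b" "e \<otimes> a = a" "a \<otimes> e = a"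
    using c e by (simp_all add: a_def b_def m_assoc) (simp_all flip: m_assoc add: e)
  have "p \<otimes> ((t \<otimes> t') \<otimes> q) = p \<otimes> (((f \<oplus> q \<otimes> p) \<otimes> t') \<otimes> q)"
    using t by simp
  also have "\<dots> = p \<otimes> ((f \<otimes> t') \<otimes> q) \<oplus> (p \<otimes> q) \<otimes> (p \<otimes> (t' \<otimes> q))"
    using c by (simp add: l_distr r_distr m_assoc)
  finally have 1: "b = a \<oplus> b \<otimes> a"
    using t e by (simp add: a_def b_def)
  have "p \<otimes> ((t' \<otimes> t) \<otimes> q) = p \<otimes> ((t' \<otimes> (f \<oplus> q \<otimes> p)) \<otimes> q)"
    using t by simp
  also have "\<dots> = p \<otimes> ((t' \<otimes> f) \<otimes> q) \<oplus> (p \<otimes> (t' \<otimes> q)) \<otimes> (p \<otimes> q)"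
    using c by (simp add: l_distr r_distr m_assoc)
  finally have 2: "b = a \<oplus> a \<otimes> b"
    using t e by (simp add: a_def b_def)
  have "(a \<oplus> b \<otimes> a) \<ominus> b \<otimes> a = a" "(a \<oplus> a \<otimes> b) \<ominus> a \<otimes> b = a"
    using cab by algebra+
  then have ba: "b \<ominus> b \<otimes> a = a" and ab: "b \<ominus> a \<otimes> b = a"
    by (simp_all only: 1[symmetric] 2[symmetric])
  have ea: "(e \<ominus> a) \<oplus> a = e"
    using c(1) cab by algebra
  have "(e \<oplus> b) \<otimes> (e \<ominus> a) = e \<otimes> e \<ominus> e \<otimes> a \<oplus> (b \<otimes> e \<ominus> b \<otimes> a)"
    using c(1) cab by algebra
  then have inv1: "(e \<oplus> b) \<otimes> (e \<ominus> a) = e"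
    by (simp only: e eb ba ea)
  have "(e \<ominus> a) \<otimes> (e \<oplus> b) = e \<otimes> e \<ominus> a \<otimes> e \<oplus> (e \<otimes> b \<ominus> a \<otimes> b)"
    using c(1) cab by algebra
  then have inv2: "(e \<ominus> a) \<otimes> (e \<oplus> b) = e"
    by (simp only: e eb ab ea)
  have "e \<oplus> b \<in> carrier (corner_units R e)"
    using c(1) cab e eb inv1 inv2
    by (intro corner_unitsI[of _ "e \<ominus> a"]) (simp_all add: minus_eq l_distr r_distr l_minus r_minus)
  then show ?thesis
    by (simp add: b_def)
qed

end

lemma gword_value_eq_foldr:
  "gword_value (corner_units A e) k w =
    foldr (\<otimes>\<^bsub>A\<^esub>) (map (\<lambda>(x, b). if b then inv\<^bsub>corner_units A e\<^esub> (k x) else k x) w) e"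
  by (induction w) auto

lemma (in ring_hom_ring) hom_corner_units:
  assumes "e \<in> carrier R"
  shows "h \<in> hom (corner_units R e) (corner_units S (h e))"
proof (rule homI)
  fix x assume "x \<in> carrier (corner_units R e)"
  then obtain y where "x \<in> carrier R" "y \<in> carrier R" "e \<otimes> x = x" "x \<otimes> e = x" "e \<otimes> y = y" "y \<otimes> e = y"
    "x \<otimes> y = e" "y \<otimes> x = e"
    by (auto simp: corner_units_def)
  then show "h x \<in> carrier (corner_units S (h e))"
    using assms by (intro S.corner_unitsI[of _ "h y"]) (simp_all flip: hom_mult)
qed (simp add: corner_unitsD)

lemma (in ring_hom_ring) hom_minus_add_mult:
  "x \<in> carrier R \<Longrightarrow> s \<in> carrier R \<Longrightarrow> q \<in> carrier R \<Longrightarrow> p \<in> carrier R \<Longrightarrow>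
    h ((x \<ominus> s) \<oplus> q \<otimes> p) = (h x \<ominus>\<^bsub>S\<^esub> h s) \<oplus>\<^bsub>S\<^esub> h q \<otimes>\<^bsub>S\<^esub> h p"
  by (simp add: a_minus_def)

lemma (in ring_hom_ring) hom_foldr:
  "set xs \<subseteq> carrier R \<Longrightarrow> e \<in> carrier R \<Longrightarrow>
    foldr (\<otimes>) xs e \<in> carrier R \<and> h (foldr (\<otimes>) xs e) = foldr (\<otimes>\<^bsub>S\<^esub>) (map h xs) (h e)"
  by (induction xs) auto

text \<open>
  Reversing and inverting \<open>[x\<^sub>1, y\<^sub>1] \<cdots> [x\<^sub>n, y\<^sub>n]\<close> gives \<open>[y\<^sub>n, x\<^sub>n] \<cdots> [y\<^sub>1, x\<^sub>1]\<close>, which is the form used in the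
  relations of the pre-projective algebra.
\<close>

lemma inverse_gword_commutators:
  "inverse_gword (concat (map (\<lambda>i. [(Surf_x i, False), (Surf_y i, False), (Surf_x i, True), (Surf_y i, True)]) is)) =
    concat (map (\<lambda>i. [(Surf_y i, False), (Surf_x i, False), (Surf_y i, True), (Surf_x i, True)]) (rev is))"
  by (induction "is") (auto simp: inverse_gword_def)

text \<open>
  The two sides of the surface relation, as group words, evaluate to products in the ring. In this
  form they can be compared with the pre-projective relation, which has generators in place of inverses.
\<close>

lemma (in ring) surface_relation_values:
  assumes e: "e \<in> carrier R" "e \<otimes> e = e"
    and k: "k ` X \<subseteq> carrier (corner_units R e)"
    and letters: "Surf_s ` set is \<subseteq> X" "Surf_t ` set os \<subseteq> X" "Surf_x ` {1..n} \<subseteq> X" "Surf_y ` {1..n} \<subseteq> X"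
    and x': "\<And>i. i \<in> {1..n} \<Longrightarrow> inv\<^bsub>corner_units R e\<^esub> (k (Surf_x i)) = x' i"
    and y': "\<And>i. i \<in> {1..n} \<Longrightarrow> inv\<^bsub>corner_units R e\<^esub> (k (Surf_y i)) = y' i"
  shows "gword_value (corner_units R e) k (fst (surface_relation n is os)) =
      foldr (\<otimes>) (map (\<lambda>b. k (Surf_s b)) is) e"
    and "gword_value (corner_units R e) k (snd (surface_relation n is os)) =
      foldr (\<otimes>) (concat (map (\<lambda>i. [k (Surf_y i), k (Surf_x i), y' i, x' i]) (rev [1..<Suc n]))) e \<otimes>
      foldr (\<otimes>) (map (\<lambda>b. k (Surf_t b)) os) e"
proof -
  interpret U: group "corner_units R e"
    using e by (rule group_corner_units)
  show "gword_value (corner_units R e) k (fst (surface_relation n is os)) =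
      foldr (\<otimes>) (map (\<lambda>b. k (Surf_s b)) is) e"
    by (simp add: gword_value_eq_foldr surface_relation_def comp_def)
  define cs :: "'c surface_gen gword" where "cs = concat (map (\<lambda>i.
      [(Surf_y i, False), (Surf_x i, False), (Surf_y i, True), (Surf_x i, True)]) (rev [1..<Suc n]))"
  define ts :: "'c surface_gen gword" where "ts = map (\<lambda>b. (Surf_t b, False)) os"
  have "cs \<in> lists (X \<times> UNIV)" "ts \<in> lists (X \<times> UNIV)"
    using letters by (auto simp: cs_def ts_def image_subset_iff simp del: upt_Suc)
  then have "gword_value (corner_units R e) k (cs @ ts) =
      gword_value (corner_units R e) k cs \<otimes> gword_value (corner_units R e) k ts"
    using U.gword_value_append[OF _ _ k, of cs ts] by simp
  moreover have "map (\<lambda>(x, b). if b then inv\<^bsub>corner_units R e\<^esub> (k x) else k x) cs =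
      concat (map (\<lambda>i. [k (Surf_y i), k (Surf_x i), y' i, x' i]) (rev [1..<Suc n]))"
    unfolding cs_def map_concat map_map
    by (intro arg_cong[where f = concat] map_cong HOL.refl) (auto simp: x' y')
  moreover have "snd (surface_relation n is os) = cs @ ts"
    by (simp only: surface_relation_def inverse_gword_commutators cs_def ts_def snd_conv)
  ultimately show "gword_value (corner_units R e) k (snd (surface_relation n is os)) =
      foldr (\<otimes>) (concat (map (\<lambda>i. [k (Surf_y i), k (Surf_x i), y' i, x' i]) (rev [1..<Suc n]))) e \<otimes>
      foldr (\<otimes>) (map (\<lambda>b. k (Surf_t b)) os) e"
    by (simp add: gword_value_eq_foldr ts_def comp_def del: upt_Suc)
qed


section \<open>Homomorphisms out of quotient rings\<close>

lemma (in ideal) quotient_cases: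
  assumes "X \<in> carrier (R Quot I)"
  obtains x where "x \<in> carrier R" "X = I +> x"
  using assms unfolding FactRing_def A_RCOSETS_def' by auto

lemma (in ideal) quotient_hom:
  assumes h: "ring_hom_ring R A h" and zero: "\<And>i. i \<in> I \<Longrightarrow> h i = \<zero>\<^bsub>A\<^esub>"
  shows "\<exists>k. ring_hom_ring (R Quot I) A k \<and> (\<forall>x\<in>carrier R. k (I +> x) = h x)"
proof -
  interpret h: ring_hom_ring R A h by fact
  interpret pr: ring_hom_ring R "R Quot I" "(+>) I"
    by (rule rcos_ring_hom_ring)
  define k where "k X = h (SOME x. x \<in> carrier R \<and> X = I +> x)" for X
  have k: "k (I +> x) = h x" if x: "x \<in> carrier R" for x
  proof -
    define y where "y = (SOME y. y \<in> carrier R \<and> I +> x = I +> y)"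
    have y: "y \<in> carrier R" "I +> x = I +> y"
      unfolding y_def using someI[of "\<lambda>y. y \<in> carrier R \<and> I +> x = I +> y" x] x by auto
    then have "x \<ominus> y \<in> I"
      using quotient_eq_iff_same_a_r_cos[OF is_ideal x y(1)] by simp
    then have "h x \<ominus>\<^bsub>A\<^esub> h y = \<zero>\<^bsub>A\<^esub>"
      using zero[of "x \<ominus> y"] x y(1) by (simp add: a_minus_def)
    then show ?thesis
      using x y(1) unfolding k_def y_def[symmetric] by simp
  qed
  have "ring_hom_ring (R Quot I) A k"
  proof (rule ring_hom_ringI[OF quotient_is_ring h.S.ring_axioms])
    show "k X \<in> carrier A" if "X \<in> carrier (R Quot I)" for X
      using that by (rule quotient_cases) (simp add: k)
    show "k (X \<otimes>\<^bsub>R Quot I\<^esub> Y) = k X \<otimes>\<^bsub>A\<^esub> k Y" "k (X \<oplus>\<^bsub>R Quot I\<^esub> Y) = k X \<oplus>\<^bsub>A\<^esub> k Y"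
      if XY: "X \<in> carrier (R Quot I)" "Y \<in> carrier (R Quot I)" for X Y
    proof -
      obtain x y where xy: "x \<in> carrier R" "X = I +> x" "y \<in> carrier R" "Y = I +> y"
        using XY by (metis quotient_cases)
      show "k (X \<otimes>\<^bsub>R Quot I\<^esub> Y) = k X \<otimes>\<^bsub>A\<^esub> k Y" "k (X \<oplus>\<^bsub>R Quot I\<^esub> Y) = k X \<oplus>\<^bsub>A\<^esub> k Y"
        using xy k[of "x \<otimes> y"] k[of "x \<oplus> y"] k[of x] k[of y] by simp_all
    qed
    show "k \<one>\<^bsub>R Quot I\<^esub> = \<one>\<^bsub>A\<^esub>"
      using k[of \<one>] by simp
  qed
  then show ?thesis
    using k by blast
qed

lemma ring_hom_ring_comp:
  assumes "ring_hom_ring A B f" "ring_hom_ring B D g"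
  shows "ring_hom_ring A D (\<lambda>x. g (f x))"
proof -
  interpret f: ring_hom_ring A B f by fact
  interpret g: ring_hom_ring B D g by fact
  show ?thesis
    by (rule ring_hom_ringI[OF f.R.ring_axioms g.S.ring_axioms]) simp_all
qed

section \<open>Comparison of the two algebras\<close>

lemma preproj_quiver_simps [simp]:
  "verts (preproj_quiver \<Gamma> g) = verts \<Gamma>"
  "arcs (preproj_quiver \<Gamma> g) = (\<Union>a\<in>arcs \<Gamma>. {Gen_p a, Gen_q a, Gen_t a, Gen_t_inv a}) \<union>
    (\<Union>v\<in>verts \<Gamma>. \<Union>i\<in>{1..g v}. {Gen_x v i, Gen_x_inv v i, Gen_y v i, Gen_y_inv v i})"
  "tail (preproj_quiver \<Gamma> g) = preproj_source \<Gamma>"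
  "head (preproj_quiver \<Gamma> g) = preproj_target \<Gamma>"
  by (simp_all add: preproj_quiver_def)

lemma surface_relation_letters:
  assumes "Surf_s ` set is \<subseteq> X" "Surf_t ` set os \<subseteq> X" "Surf_x ` {1..n} \<subseteq> X" "Surf_y ` {1..n} \<subseteq> X"
  shows "surface_relation n is os \<in> lists (X \<times> UNIV) \<times> lists (X \<times> UNIV)"
  using assms
  by (auto simp: surface_relation_def inverse_gword_commutators image_subset_iff simp del: upt_Suc)

locale capped_plumbing = capped_hopf_links \<Gamma> Z K
  for \<Gamma> :: "('v, 'e) pre_digraph" and Z :: "('v, 'e, 's::topological_space) zero_section"
    and K :: "('v, 'e, 's) capping_system" +
  fixes g :: "'v \<Rightarrow> nat" and ins outs :: "'v \<Rightarrow> 'e list"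
  assumes set_ins: "v \<in> verts \<Gamma> \<Longrightarrow> set (ins v) = {b \<in> arcs \<Gamma>. head \<Gamma> b = v}"
    and set_outs: "v \<in> verts \<Gamma> \<Longrightarrow> set (outs v) = {b \<in> arcs \<Gamma>. tail \<Gamma> b = v}"
    and presentation: "v \<in> verts \<Gamma> \<Longrightarrow> is_presentation (pi1 \<Gamma> Z K v) (surface_gens \<Gamma> g v)
      (surface_gen_class \<Gamma> Z K v) {surface_relation (g v) (ins v) (outs v)}"
begin

text \<open>
  Homomorphisms out of \<open>short.T\<close> are rewritten in terms of its own operations.
\<close>

declare short_ops [simp del]

sublocale pre: quiver_with_groups "preproj_quiver \<Gamma> g" trivial_groups
  rewrites "tensor_ring (preproj_quiver \<Gamma> g) trivial_groups = preproj_tensor_ring \<Gamma> g"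
  by (rule quiver_with_groups.intro) (auto simp: preproj_tensor_ring_def)

abbreviation "R \<equiv> preproj_tensor_ring \<Gamma> g"
abbreviation "I \<equiv> preproj_ideal \<Gamma> g ins outs"
abbreviation "B \<equiv> preproj_algebra \<Gamma> g ins outs"
abbreviation "S \<equiv> short.T"
abbreviation "J \<equiv> CE_boundaries0 \<Gamma> Z K"
abbreviation "H \<equiv> CE_homology0 \<Gamma> Z K"
abbreviation "\<beta> x \<equiv> I +>\<^bsub>R\<^esub> x"
abbreviation "\<eta> y \<equiv> J +>\<^bsub>S\<^esub> y"
abbreviation "\<iota> \<equiv> gen (preproj_quiver \<Gamma> g) trivial_groups"
abbreviation "e \<equiv> idem trivial_groups"
abbreviation "\<sigma>B z \<equiv> \<beta> (scalar (preproj_quiver \<Gamma> g) trivial_groups z)"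
abbreviation "\<sigma>H z \<equiv> \<eta> (scalar (short_chord_quiver \<Gamma>) P z)"
abbreviation "eH v \<equiv> \<eta> (idem P v)"
abbreviation "loop v \<gamma> \<equiv> single_word (Base v \<gamma>)"

subsection \<open>Relations in the pre-projective algebra\<close>

lemma gens_at:
  "v \<in> verts \<Gamma> \<Longrightarrow> Surf_s ` set (ins v) \<subseteq> surface_gens \<Gamma> g v"
  "v \<in> verts \<Gamma> \<Longrightarrow> Surf_t ` set (outs v) \<subseteq> surface_gens \<Gamma> g v"
  "Surf_x ` {1..g v} \<subseteq> surface_gens \<Gamma> g v" "Surf_y ` {1..g v} \<subseteq> surface_gens \<Gamma> g v"
  by (auto simp: surface_gens_def set_ins set_outs)

lemma foldr_R_closed: "set xs \<subseteq> carrier R \<Longrightarrow> x \<in> carrier R \<Longrightarrow> foldr (\<lambda>x y. x \<otimes>\<^bsub>R\<^esub> y) xs x \<in> carrier R"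
  by (induction xs) auto

lemma gens_closed:
  "a \<in> arcs \<Gamma> \<Longrightarrow> \<iota> (Gen_p a) \<in> carrier R" "a \<in> arcs \<Gamma> \<Longrightarrow> \<iota> (Gen_q a) \<in> carrier R"
  "a \<in> arcs \<Gamma> \<Longrightarrow> \<iota> (Gen_t a) \<in> carrier R" "a \<in> arcs \<Gamma> \<Longrightarrow> \<iota> (Gen_t_inv a) \<in> carrier R"
  "v \<in> verts \<Gamma> \<Longrightarrow> i \<in> {1..g v} \<Longrightarrow> \<iota> (Gen_x v i) \<in> carrier R"
  "v \<in> verts \<Gamma> \<Longrightarrow> i \<in> {1..g v} \<Longrightarrow> \<iota> (Gen_x_inv v i) \<in> carrier R"
  "v \<in> verts \<Gamma> \<Longrightarrow> i \<in> {1..g v} \<Longrightarrow> \<iota> (Gen_y v i) \<in> carrier R"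
  "v \<in> verts \<Gamma> \<Longrightarrow> i \<in> {1..g v} \<Longrightarrow> \<iota> (Gen_y_inv v i) \<in> carrier R"
  by (auto intro!: pre.gen_closed)

lemma e_closed: "v \<in> verts \<Gamma> \<Longrightarrow> e v \<in> carrier R"
  using pre.idem_closed[of v] by simp

lemma vertex_factors_closed:
  assumes v: "v \<in> verts \<Gamma>"
  shows "set (map (\<lambda>a. e v \<oplus>\<^bsub>R\<^esub> \<iota> (Gen_p a) \<otimes>\<^bsub>R\<^esub> \<iota> (Gen_q a)) (ins v)) \<subseteq> carrier R"
    and "set (map (\<lambda>a. e v \<oplus>\<^bsub>R\<^esub> \<iota> (Gen_q a) \<otimes>\<^bsub>R\<^esub> \<iota> (Gen_p a)) (outs v)) \<subseteq> carrier R"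
    and "set (concat (map (\<lambda>i. [\<iota> (Gen_y v i), \<iota> (Gen_x v i), \<iota> (Gen_y_inv v i), \<iota> (Gen_x_inv v i)])
      (rev [1..<Suc (g v)]))) \<subseteq> carrier R"
  using v by (auto simp: set_ins set_outs gens_closed e_closed simp del: upt_Suc)

lemma vertex_products_closed:
  assumes v: "v \<in> verts \<Gamma>"
  shows "foldr (\<lambda>x y. x \<otimes>\<^bsub>R\<^esub> y) (map (\<lambda>a. e v \<oplus>\<^bsub>R\<^esub> \<iota> (Gen_p a) \<otimes>\<^bsub>R\<^esub> \<iota> (Gen_q a)) (ins v)) (e v) \<in> carrier R"
    and "foldr (\<lambda>x y. x \<otimes>\<^bsub>R\<^esub> y) (map (\<lambda>a. e v \<oplus>\<^bsub>R\<^esub> \<iota> (Gen_q a) \<otimes>\<^bsub>R\<^esub> \<iota> (Gen_p a)) (outs v)) (e v) \<in> carrier R"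
    and "foldr (\<lambda>x y. x \<otimes>\<^bsub>R\<^esub> y) (concat (map (\<lambda>i. [\<iota> (Gen_y v i), \<iota> (Gen_x v i), \<iota> (Gen_y_inv v i), \<iota> (Gen_x_inv v i)])
      (rev [1..<Suc (g v)]))) (e v) \<in> carrier R"
  using foldr_R_closed[OF vertex_factors_closed(1)[OF v] e_closed[OF v]]
    foldr_R_closed[OF vertex_factors_closed(2)[OF v] e_closed[OF v]]
    foldr_R_closed[OF vertex_factors_closed(3)[OF v] e_closed[OF v]] .

lemma preproj_relations_closed:
  "(l, r) \<in> preproj_relations \<Gamma> g ins outs \<Longrightarrow> l \<in> carrier R \<and> r \<in> carrier R"
  by (auto simp: preproj_relations_def Let_def gens_closed e_closed vertex_products_closed
      simp del: upt_Suc One_nat_def)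

lemma ideal_I: "ideal I R"
  unfolding preproj_ideal_def
  by (rule pre.tensor.genideal_ideal) (auto dest: preproj_relations_closed)

sublocale I: ideal I R
  by (rule ideal_I)

sublocale J: ideal J S
  by (rule ideal_boundaries)

lemma B_eq: "B = R Quot I" and H_eq: "H = S Quot J"
  by (simp_all add: preproj_algebra_def CE_homology0_def CE_cycles0_eq)

sublocale B: complex_algebra B "\<lambda>z. \<sigma>B z"
  unfolding B_eq by (rule pre.scalars.complex_algebra_quotient) (rule ideal_I)

sublocale H: complex_algebra H "\<lambda>z. \<sigma>H z"
  unfolding H_eq by (rule short.scalars.complex_algebra_quotient) (rule ideal_boundaries)

sublocale \<beta>: ring_hom_ring R B "(+>\<^bsub>R\<^esub>) I"
  unfolding B_eq by (rule I.rcos_ring_hom_ring)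

sublocale \<eta>: ring_hom_ring S H "(+>\<^bsub>S\<^esub>) J"
  unfolding H_eq by (rule J.rcos_ring_hom_ring)

lemma B_relation:
  assumes "(l, r) \<in> preproj_relations \<Gamma> g ins outs"
  shows "\<beta> l = \<beta> r"
proof -
  have "l \<ominus>\<^bsub>R\<^esub> r \<in> I"
    unfolding preproj_ideal_def using assms
    by (intro subsetD[OF pre.tensor.genideal_self]) (auto dest: preproj_relations_closed)
  then show ?thesis
    using pre.tensor.quotient_eq_iff_same_a_r_cos[OF ideal_I, of l r] preproj_relations_closed[OF assms] by simp
qed

lemma B_edge_relations:
  assumes "a \<in> arcs \<Gamma>"
  shows "\<beta> (\<iota> (Gen_t a)) \<otimes>\<^bsub>B\<^esub> \<beta> (\<iota> (Gen_t_inv a)) = \<beta> (e (tail \<Gamma> a))"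
    and "\<beta> (\<iota> (Gen_t_inv a)) \<otimes>\<^bsub>B\<^esub> \<beta> (\<iota> (Gen_t a)) = \<beta> (e (tail \<Gamma> a))"
    and "\<beta> (e (tail \<Gamma> a)) \<oplus>\<^bsub>B\<^esub> \<beta> (\<iota> (Gen_q a)) \<otimes>\<^bsub>B\<^esub> \<beta> (\<iota> (Gen_p a)) = \<beta> (\<iota> (Gen_t a))"
proof -
  have "(\<iota> (Gen_t a) \<otimes>\<^bsub>R\<^esub> \<iota> (Gen_t_inv a), e (tail \<Gamma> a)) \<in> preproj_relations \<Gamma> g ins outs"
    "(\<iota> (Gen_t_inv a) \<otimes>\<^bsub>R\<^esub> \<iota> (Gen_t a), e (tail \<Gamma> a)) \<in> preproj_relations \<Gamma> g ins outs"
    "(e (tail \<Gamma> a) \<oplus>\<^bsub>R\<^esub> \<iota> (Gen_q a) \<otimes>\<^bsub>R\<^esub> \<iota> (Gen_p a), \<iota> (Gen_t a)) \<in> preproj_relations \<Gamma> g ins outs"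
    unfolding preproj_relations_def Let_def using assms by blast+
  from this[THEN B_relation]
  show "\<beta> (\<iota> (Gen_t a)) \<otimes>\<^bsub>B\<^esub> \<beta> (\<iota> (Gen_t_inv a)) = \<beta> (e (tail \<Gamma> a))"
    "\<beta> (\<iota> (Gen_t_inv a)) \<otimes>\<^bsub>B\<^esub> \<beta> (\<iota> (Gen_t a)) = \<beta> (e (tail \<Gamma> a))"
    "\<beta> (e (tail \<Gamma> a)) \<oplus>\<^bsub>B\<^esub> \<beta> (\<iota> (Gen_q a)) \<otimes>\<^bsub>B\<^esub> \<beta> (\<iota> (Gen_p a)) = \<beta> (\<iota> (Gen_t a))"
    using assms by (simp_all add: gens_closed e_closed)
qed

lemma B_handle_relations:
  assumes "v \<in> verts \<Gamma>" "i \<in> {1..g v}"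
  shows "\<beta> (\<iota> (Gen_x v i)) \<otimes>\<^bsub>B\<^esub> \<beta> (\<iota> (Gen_x_inv v i)) = \<beta> (e v)"
    and "\<beta> (\<iota> (Gen_x_inv v i)) \<otimes>\<^bsub>B\<^esub> \<beta> (\<iota> (Gen_x v i)) = \<beta> (e v)"
    and "\<beta> (\<iota> (Gen_y v i)) \<otimes>\<^bsub>B\<^esub> \<beta> (\<iota> (Gen_y_inv v i)) = \<beta> (e v)"
    and "\<beta> (\<iota> (Gen_y_inv v i)) \<otimes>\<^bsub>B\<^esub> \<beta> (\<iota> (Gen_y v i)) = \<beta> (e v)"
proof -
  have "(\<iota> (Gen_x v i) \<otimes>\<^bsub>R\<^esub> \<iota> (Gen_x_inv v i), e v) \<in> preproj_relations \<Gamma> g ins outs"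
    "(\<iota> (Gen_x_inv v i) \<otimes>\<^bsub>R\<^esub> \<iota> (Gen_x v i), e v) \<in> preproj_relations \<Gamma> g ins outs"
    "(\<iota> (Gen_y v i) \<otimes>\<^bsub>R\<^esub> \<iota> (Gen_y_inv v i), e v) \<in> preproj_relations \<Gamma> g ins outs"
    "(\<iota> (Gen_y_inv v i) \<otimes>\<^bsub>R\<^esub> \<iota> (Gen_y v i), e v) \<in> preproj_relations \<Gamma> g ins outs"
    unfolding preproj_relations_def Let_def using assms by blast+
  from this[THEN B_relation]
  show "\<beta> (\<iota> (Gen_x v i)) \<otimes>\<^bsub>B\<^esub> \<beta> (\<iota> (Gen_x_inv v i)) = \<beta> (e v)"
    "\<beta> (\<iota> (Gen_x_inv v i)) \<otimes>\<^bsub>B\<^esub> \<beta> (\<iota> (Gen_x v i)) = \<beta> (e v)"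
    "\<beta> (\<iota> (Gen_y v i)) \<otimes>\<^bsub>B\<^esub> \<beta> (\<iota> (Gen_y_inv v i)) = \<beta> (e v)"
    "\<beta> (\<iota> (Gen_y_inv v i)) \<otimes>\<^bsub>B\<^esub> \<beta> (\<iota> (Gen_y v i)) = \<beta> (e v)"
    using assms by (simp_all add: gens_closed e_closed)
qed

lemma \<beta>_idem: "v \<in> verts \<Gamma> \<Longrightarrow> \<beta> (e v) \<otimes>\<^bsub>B\<^esub> \<beta> (e v) = \<beta> (e v)"
  using pre.idem_mult_idem[of v] by (simp add: e_closed flip: \<beta>.hom_mult)

lemma \<beta>_gen_ends:
  assumes "c \<in> arcs (preproj_quiver \<Gamma> g)"
  shows "\<beta> (e (preproj_target \<Gamma> c)) \<otimes>\<^bsub>B\<^esub> \<beta> (\<iota> c) = \<beta> (\<iota> c)"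
    and "\<beta> (\<iota> c) \<otimes>\<^bsub>B\<^esub> \<beta> (e (preproj_source \<Gamma> c)) = \<beta> (\<iota> c)"
  using pre.idem_mult_gen[OF assms] pre.head_in_verts[OF assms] pre.tail_in_verts[OF assms] pre.gen_closed[OF assms]
  by (simp_all add: e_closed flip: \<beta>.hom_mult)

lemma \<beta>_edge_ends:
  assumes "a \<in> arcs \<Gamma>"
  shows "\<beta> (e (head \<Gamma> a)) \<otimes>\<^bsub>B\<^esub> \<beta> (\<iota> (Gen_p a)) = \<beta> (\<iota> (Gen_p a))"
    "\<beta> (\<iota> (Gen_p a)) \<otimes>\<^bsub>B\<^esub> \<beta> (e (tail \<Gamma> a)) = \<beta> (\<iota> (Gen_p a))"
    "\<beta> (e (tail \<Gamma> a)) \<otimes>\<^bsub>B\<^esub> \<beta> (\<iota> (Gen_q a)) = \<beta> (\<iota> (Gen_q a))"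
    "\<beta> (\<iota> (Gen_q a)) \<otimes>\<^bsub>B\<^esub> \<beta> (e (head \<Gamma> a)) = \<beta> (\<iota> (Gen_q a))"
    "\<beta> (e (tail \<Gamma> a)) \<otimes>\<^bsub>B\<^esub> \<beta> (\<iota> (Gen_t a)) = \<beta> (\<iota> (Gen_t a))"
    "\<beta> (\<iota> (Gen_t a)) \<otimes>\<^bsub>B\<^esub> \<beta> (e (tail \<Gamma> a)) = \<beta> (\<iota> (Gen_t a))"
    "\<beta> (e (tail \<Gamma> a)) \<otimes>\<^bsub>B\<^esub> \<beta> (\<iota> (Gen_t_inv a)) = \<beta> (\<iota> (Gen_t_inv a))"
    "\<beta> (\<iota> (Gen_t_inv a)) \<otimes>\<^bsub>B\<^esub> \<beta> (e (tail \<Gamma> a)) = \<beta> (\<iota> (Gen_t_inv a))"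
  using \<beta>_gen_ends[of "Gen_p a"] \<beta>_gen_ends[of "Gen_q a"] \<beta>_gen_ends[of "Gen_t a"]
    \<beta>_gen_ends[of "Gen_t_inv a"] assms by simp_all

lemma \<beta>_handle_ends:
  assumes "v \<in> verts \<Gamma>" "i \<in> {1..g v}"
  shows "\<beta> (e v) \<otimes>\<^bsub>B\<^esub> \<beta> (\<iota> (Gen_x v i)) = \<beta> (\<iota> (Gen_x v i))"
    "\<beta> (\<iota> (Gen_x v i)) \<otimes>\<^bsub>B\<^esub> \<beta> (e v) = \<beta> (\<iota> (Gen_x v i))"
    "\<beta> (e v) \<otimes>\<^bsub>B\<^esub> \<beta> (\<iota> (Gen_x_inv v i)) = \<beta> (\<iota> (Gen_x_inv v i))"
    "\<beta> (\<iota> (Gen_x_inv v i)) \<otimes>\<^bsub>B\<^esub> \<beta> (e v) = \<beta> (\<iota> (Gen_x_inv v i))"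
    "\<beta> (e v) \<otimes>\<^bsub>B\<^esub> \<beta> (\<iota> (Gen_y v i)) = \<beta> (\<iota> (Gen_y v i))"
    "\<beta> (\<iota> (Gen_y v i)) \<otimes>\<^bsub>B\<^esub> \<beta> (e v) = \<beta> (\<iota> (Gen_y v i))"
    "\<beta> (e v) \<otimes>\<^bsub>B\<^esub> \<beta> (\<iota> (Gen_y_inv v i)) = \<beta> (\<iota> (Gen_y_inv v i))"
    "\<beta> (\<iota> (Gen_y_inv v i)) \<otimes>\<^bsub>B\<^esub> \<beta> (e v) = \<beta> (\<iota> (Gen_y_inv v i))"
  using \<beta>_gen_ends[of "Gen_x v i"] \<beta>_gen_ends[of "Gen_x_inv v i"] \<beta>_gen_ends[of "Gen_y v i"]
    \<beta>_gen_ends[of "Gen_y_inv v i"] assms by simp_all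

text \<open>
  The images of the generators of \<open>\<pi>\<^sub>1(Q\<^sub>v)\<close>. The value on \<open>s\<^sub>b\<close> is forced by the boundary of \<open>a\<^sub>2\<^sub>,\<^sub>b\<close>.
\<close>

definition unit_of_gen :: "'v \<Rightarrow> 'e surface_gen \<Rightarrow> (('v, unit, ('v, 'e) preproj_gen) word \<Rightarrow> complex) set" where
  "unit_of_gen v x = (case x of
      Surf_s b \<Rightarrow> \<beta> (e v) \<oplus>\<^bsub>B\<^esub> \<beta> (\<iota> (Gen_p b)) \<otimes>\<^bsub>B\<^esub> \<beta> (\<iota> (Gen_q b))
    | Surf_t b \<Rightarrow> \<beta> (\<iota> (Gen_t b))
    | Surf_x i \<Rightarrow> \<beta> (\<iota> (Gen_x v i))
    | Surf_y i \<Rightarrow> \<beta> (\<iota> (Gen_y v i)))"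

abbreviation "UB v \<equiv> corner_units B (\<beta> (e v))"
abbreviation "UH v \<equiv> corner_units H (eH v)"

lemma group_UB: "v \<in> verts \<Gamma> \<Longrightarrow> group (UB v)"
  by (intro B.group_corner_units) (simp_all add: e_closed \<beta>_idem)

text \<open>
  All these elements except \<open>e + p\<^sub>b q\<^sub>b\<close> have an inverse among the generators of the algebra.
\<close>

lemma unit_of_gen_closed:
  assumes v: "v \<in> verts \<Gamma>"
  shows "unit_of_gen v ` surface_gens \<Gamma> g v \<subseteq> carrier (UB v)"
proof -
  have "\<beta> (e (head \<Gamma> b)) \<oplus>\<^bsub>B\<^esub> \<beta> (\<iota> (Gen_p b)) \<otimes>\<^bsub>B\<^esub> \<beta> (\<iota> (Gen_q b)) \<in> carrier (UB (head \<Gamma> b))"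
    if b: "b \<in> arcs \<Gamma>" for b
    by (rule B.one_plus_swap[where f = "\<beta> (e (tail \<Gamma> b))" and t = "\<beta> (\<iota> (Gen_t b))" and t' = "\<beta> (\<iota> (Gen_t_inv b))"])
      (use b in \<open>simp_all add: gens_closed e_closed \<beta>_idem \<beta>_edge_ends B_edge_relations\<close>)
  moreover have "\<beta> (\<iota> (Gen_t b)) \<in> carrier (UB (tail \<Gamma> b))" if b: "b \<in> arcs \<Gamma>" for b
    by (rule B.corner_unitsI[of _ "\<beta> (\<iota> (Gen_t_inv b))"])
      (use b in \<open>simp_all add: gens_closed e_closed \<beta>_edge_ends B_edge_relations\<close>)
  moreover have "\<beta> (\<iota> (Gen_x v i)) \<in> carrier (UB v)" if i: "i \<in> {1..g v}" for i
    by (rule B.corner_unitsI[of _ "\<beta> (\<iota> (Gen_x_inv v i))"])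
      (use v i in \<open>simp_all add: gens_closed e_closed \<beta>_handle_ends B_handle_relations\<close>)
  moreover have "\<beta> (\<iota> (Gen_y v i)) \<in> carrier (UB v)" if i: "i \<in> {1..g v}" for i
    by (rule B.corner_unitsI[of _ "\<beta> (\<iota> (Gen_y_inv v i))"])
      (use v i in \<open>simp_all add: gens_closed e_closed \<beta>_handle_ends B_handle_relations\<close>)
  ultimately show ?thesis
    by (auto simp: surface_gens_def unit_of_gen_def)
qed

lemma unit_of_gen_inv:
  assumes "v \<in> verts \<Gamma>" "i \<in> {1..g v}"
  shows "inv\<^bsub>UB v\<^esub> (unit_of_gen v (Surf_x i)) = \<beta> (\<iota> (Gen_x_inv v i))"
    and "inv\<^bsub>UB v\<^esub> (unit_of_gen v (Surf_y i)) = \<beta> (\<iota> (Gen_y_inv v i))"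
  unfolding unit_of_gen_def surface_gen.case
  by (rule B.corner_units_inv;
      use assms in \<open>simp add: gens_closed e_closed \<beta>_idem \<beta>_handle_ends B_handle_relations\<close>)+

lemma unit_of_gen_inv_t:
  "b \<in> arcs \<Gamma> \<Longrightarrow> inv\<^bsub>UB (tail \<Gamma> b)\<^esub> (unit_of_gen (tail \<Gamma> b) (Surf_t b)) = \<beta> (\<iota> (Gen_t_inv b))"
  unfolding unit_of_gen_def surface_gen.case
  by (rule B.corner_units_inv; simp add: gens_closed e_closed \<beta>_idem \<beta>_edge_ends B_edge_relations)

text \<open>
  Since \<open>e + q\<^sub>b p\<^sub>b = t\<^sub>b\<close> in the pre-projective algebra, its relation at \<open>v\<close> is the surface relation for
  these units.
\<close>

lemma unit_of_gen_relation:
  assumes v: "v \<in> verts \<Gamma>"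
  shows "gword_value (UB v) (unit_of_gen v) (fst (surface_relation (g v) (ins v) (outs v))) =
    gword_value (UB v) (unit_of_gen v) (snd (surface_relation (g v) (ins v) (outs v)))"
proof -
  let ?ps = "map (\<lambda>a. e v \<oplus>\<^bsub>R\<^esub> \<iota> (Gen_p a) \<otimes>\<^bsub>R\<^esub> \<iota> (Gen_q a)) (ins v)"
  let ?qs = "map (\<lambda>a. e v \<oplus>\<^bsub>R\<^esub> \<iota> (Gen_q a) \<otimes>\<^bsub>R\<^esub> \<iota> (Gen_p a)) (outs v)"
  let ?cs = "concat (map (\<lambda>i. [\<iota> (Gen_y v i), \<iota> (Gen_x v i), \<iota> (Gen_y_inv v i), \<iota> (Gen_x_inv v i)])
      (rev [1..<Suc (g v)]))"
  note closed = vertex_factors_closed[OF v] and ev = e_closed[OF v]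
  have "(foldr (\<otimes>\<^bsub>R\<^esub>) ?ps (e v), foldr (\<otimes>\<^bsub>R\<^esub>) ?cs (e v) \<otimes>\<^bsub>R\<^esub> foldr (\<otimes>\<^bsub>R\<^esub>) ?qs (e v))
      \<in> preproj_relations \<Gamma> g ins outs"
    unfolding preproj_relations_def Let_def using v by blast
  then have "\<beta> (foldr (\<otimes>\<^bsub>R\<^esub>) ?ps (e v)) = \<beta> (foldr (\<otimes>\<^bsub>R\<^esub>) ?cs (e v) \<otimes>\<^bsub>R\<^esub> foldr (\<otimes>\<^bsub>R\<^esub>) ?qs (e v))"
    by (rule B_relation)
  then have rel: "foldr (\<otimes>\<^bsub>B\<^esub>) (map (\<lambda>x. \<beta> x) ?ps) (\<beta> (e v)) =
      foldr (\<otimes>\<^bsub>B\<^esub>) (map (\<lambda>x. \<beta> x) ?cs) (\<beta> (e v)) \<otimes>\<^bsub>B\<^esub> foldr (\<otimes>\<^bsub>B\<^esub>) (map (\<lambda>x. \<beta> x) ?qs) (\<beta> (e v))"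
    by (simp only: \<beta>.hom_mult \<beta>.hom_foldr[OF closed(1) ev] \<beta>.hom_foldr[OF closed(2) ev]
        \<beta>.hom_foldr[OF closed(3) ev])
  have ps: "map (\<lambda>x. \<beta> x) ?ps = map (\<lambda>b. unit_of_gen v (Surf_s b)) (ins v)"
    using v by (auto simp: set_ins unit_of_gen_def gens_closed ev)
  have qs: "map (\<lambda>x. \<beta> x) ?qs = map (\<lambda>b. unit_of_gen v (Surf_t b)) (outs v)"
    using v by (auto simp: set_outs unit_of_gen_def gens_closed ev B_edge_relations(3))
  have cs: "map (\<lambda>x. \<beta> x) ?cs = concat (map (\<lambda>i. [unit_of_gen v (Surf_y i), unit_of_gen v (Surf_x i),
      \<beta> (\<iota> (Gen_y_inv v i)), \<beta> (\<iota> (Gen_x_inv v i))]) (rev [1..<Suc (g v)]))"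
    by (simp add: map_concat comp_def unit_of_gen_def del: upt_Suc)
  note vals = B.surface_relation_values[OF \<beta>.hom_closed[OF ev] \<beta>_idem[OF v] unit_of_gen_closed[OF v]
      gens_at(1,2)[OF v] gens_at(3,4) unit_of_gen_inv(1,2)[OF v]]
  show ?thesis
    using rel unfolding ps qs cs by (simp only: vals)
qed

subsection \<open>From the capped algebra to the pre-projective algebra\<close>

text \<open>
  An instance of the universal property of the presentation of \<open>\<pi>\<^sub>1(Q\<^sub>v)\<close>.
\<close>

lemma exists_loop_image:
  assumes v: "v \<in> verts \<Gamma>"
  shows "\<exists>\<theta>. \<theta> \<in> hom (P v) (UB v) \<and>
    (\<forall>x\<in>surface_gens \<Gamma> g v. \<theta> (surface_gen_class \<Gamma> Z K v x) = unit_of_gen v x)"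
proof -
  obtain \<theta> where "\<theta> \<in> hom (P v) (UB v)"
    "\<And>x. x \<in> surface_gens \<Gamma> g v \<Longrightarrow> \<theta> (surface_gen_class \<Gamma> Z K v x) = unit_of_gen v x"
  proof (rule presented_group_hom[OF group_pi1[OF v] presentation[OF v] group_UB[OF v] unit_of_gen_closed[OF v]])
    show "{surface_relation (g v) (ins v) (outs v)} \<subseteq>
        lists (surface_gens \<Gamma> g v \<times> UNIV) \<times> lists (surface_gens \<Gamma> g v \<times> UNIV)"
      using surface_relation_letters[OF gens_at(1,2)[OF v] gens_at(3,4)] by simp
    show "gword_value (UB v) (unit_of_gen v) l = gword_value (UB v) (unit_of_gen v) r"
      if "(l, r) \<in> {surface_relation (g v) (ins v) (outs v)}" for l r
      using that unit_of_gen_relation[OF v] by (metis fst_conv snd_conv singletonD)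
  qed auto
  then show ?thesis
    by blast
qed

definition loop_image :: "'v \<Rightarrow> (real \<Rightarrow> 's) set \<Rightarrow> (('v, unit, ('v, 'e) preproj_gen) word \<Rightarrow> complex) set" where
  "loop_image v = (SOME \<theta>. \<theta> \<in> hom (P v) (UB v) \<and>
    (\<forall>x\<in>surface_gens \<Gamma> g v. \<theta> (surface_gen_class \<Gamma> Z K v x) = unit_of_gen v x))"

lemma loop_image:
  assumes "v \<in> verts \<Gamma>"
  shows "group_hom (P v) (UB v) (loop_image v)"
    and "x \<in> surface_gens \<Gamma> g v \<Longrightarrow> loop_image v (surface_gen_class \<Gamma> Z K v x) = unit_of_gen v x"
  using someI_ex[OF exists_loop_image[OF assms], folded loop_image_def] group_pi1[OF assms] group_UB[OF assms]
  by (auto intro!: group_hom.intro group_hom_axioms.intro)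

text \<open>
  The short chord quiver has no long chords; their value zero is a default.
\<close>

definition chord_image :: "'e chord \<Rightarrow> (('v, unit, ('v, 'e) preproj_gen) word \<Rightarrow> complex) set" where
  "chord_image c = (case c of
      Chord_p b \<Rightarrow> \<beta> (\<iota> (Gen_p b))
    | Chord_q b \<Rightarrow> \<beta> (\<iota> (Gen_q b))
    | _ \<Rightarrow> \<zero>\<^bsub>B\<^esub>)"

lemma loop_image_one: "v \<in> verts \<Gamma> \<Longrightarrow> loop_image v \<one>\<^bsub>P v\<^esub> = \<beta> (e v)"
  using group_hom.hom_one[OF loop_image(1)] by simp

sublocale Psi: tensor_representation "short_chord_quiver \<Gamma>" P B "\<lambda>z. \<sigma>B z" loop_image chord_image
proof (intro tensor_representation.intro tensor_representation_axioms.intro)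
  show "quiver_with_groups (short_chord_quiver \<Gamma>) P"
    by (rule short.quiver_with_groups_axioms)
  show "complex_algebra B (\<lambda>z. \<sigma>B z)"
    by (rule B.complex_algebra_axioms)
  fix v w \<gamma> \<gamma>' assume v: "v \<in> verts (short_chord_quiver \<Gamma>)"
  then have v': "v \<in> verts \<Gamma>" by simp
  interpret h: group_hom "P v" "UB v" "loop_image v"
    by (rule loop_image(1)[OF v'])
  show "loop_image v \<gamma> \<in> carrier B" if "\<gamma> \<in> carrier (P v)"
    using h.hom_closed[OF that] by (rule corner_unitsD)
  show "loop_image v (\<gamma> \<otimes>\<^bsub>P v\<^esub> \<gamma>') = loop_image v \<gamma> \<otimes>\<^bsub>B\<^esub> loop_image v \<gamma>'"
    if "\<gamma> \<in> carrier (P v)" "\<gamma>' \<in> carrier (P v)"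
    using h.hom_mult[OF that] by simp
  show "loop_image v \<one>\<^bsub>P v\<^esub> \<otimes>\<^bsub>B\<^esub> loop_image w \<one>\<^bsub>P w\<^esub> = \<zero>\<^bsub>B\<^esub>"
    if "w \<in> verts (short_chord_quiver \<Gamma>)" "v \<noteq> w"
    using that v' pre.idem_orthogonal[OF that(2)]
    by (simp add: loop_image_one e_closed flip: \<beta>.hom_mult)
next
  have "finsum B (\<lambda>v. loop_image v \<one>\<^bsub>P v\<^esub>) (verts \<Gamma>) = finsum B (\<lambda>v. \<beta> (e v)) (verts \<Gamma>)"
    by (rule B.finsum_cong') (simp_all add: loop_image_one e_closed)
  also have "\<dots> = \<beta> (finsum R e (verts \<Gamma>))"
    using \<beta>.hom_finsum_family[of "verts \<Gamma>" e] by (simp add: e_closed Pi_iff)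
  also have "\<dots> = \<one>\<^bsub>B\<^esub>"
    using pre.finsum_idem by simp
  finally show "finsum B (\<lambda>v. loop_image v \<one>\<^bsub>P v\<^esub>) (verts (short_chord_quiver \<Gamma>)) = \<one>\<^bsub>B\<^esub>"
    by simp
next
  fix c assume "c \<in> arcs (short_chord_quiver \<Gamma>)"
  then obtain b where b: "b \<in> arcs \<Gamma>" "c = Chord_p b \<or> c = Chord_q b"
    by auto
  then show "chord_image c \<in> carrier B"
    by (auto simp: chord_image_def gens_closed)
  show "loop_image (head (short_chord_quiver \<Gamma>) c) \<one>\<^bsub>P (head (short_chord_quiver \<Gamma>) c)\<^esub> \<otimes>\<^bsub>B\<^esub> chord_image c =
      chord_image c"
    "chord_image c \<otimes>\<^bsub>B\<^esub> loop_image (tail (short_chord_quiver \<Gamma>) c) \<one>\<^bsub>P (tail (short_chord_quiver \<Gamma>) c)\<^esub> =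
      chord_image c"
    using b by (auto simp: chord_image_def loop_image_one \<beta>_edge_ends)
qed

abbreviation "\<Psi> \<equiv> Psi.extension"

sublocale \<Psi>: ring_hom_ring S B Psi.extension
  by (rule Psi.extension_ring_hom)

lemma \<Psi>_loop: "v \<in> verts \<Gamma> \<Longrightarrow> \<gamma> \<in> carrier (P v) \<Longrightarrow> \<Psi> (loop v \<gamma>) = loop_image v \<gamma>"
  using Psi.extension_single_base[of v \<gamma>] by simp

lemma \<Psi>_idem: "v \<in> verts \<Gamma> \<Longrightarrow> \<Psi> (idem P v) = \<beta> (e v)"
  using \<Psi>_loop[of v "\<one>\<^bsub>P v\<^esub>"] short.one_at[of v] by (simp add: idem_def loop_image_one)

lemma \<Psi>_gen:
  "b \<in> arcs \<Gamma> \<Longrightarrow> \<Psi> (gen (short_chord_quiver \<Gamma>) P (Chord_p b)) = \<beta> (\<iota> (Gen_p b))"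
  "b \<in> arcs \<Gamma> \<Longrightarrow> \<Psi> (gen (short_chord_quiver \<Gamma>) P (Chord_q b)) = \<beta> (\<iota> (Gen_q b))"
  using Psi.extension_gen[of "Chord_p b"] Psi.extension_gen[of "Chord_q b"]
  by (simp_all add: chord_image_def)

lemma short_gens_closed:
  "b \<in> arcs \<Gamma> \<Longrightarrow> gen (short_chord_quiver \<Gamma>) P (Chord_p b) \<in> carrier S"
  "b \<in> arcs \<Gamma> \<Longrightarrow> gen (short_chord_quiver \<Gamma>) P (Chord_q b) \<in> carrier S"
  "v \<in> verts \<Gamma> \<Longrightarrow> idem P v \<in> carrier S"
  "v \<in> verts \<Gamma> \<Longrightarrow> \<gamma> \<in> carrier (P v) \<Longrightarrow> loop v \<gamma> \<in> carrier S"
  by (simp_all add: short.gen_closed)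

lemma surface_gens_simps [simp]:
  "b \<in> arcs \<Gamma> \<Longrightarrow> Surf_s b \<in> surface_gens \<Gamma> g (head \<Gamma> b)"
  "b \<in> arcs \<Gamma> \<Longrightarrow> Surf_t b \<in> surface_gens \<Gamma> g (tail \<Gamma> b)"
  "i \<in> {1..g v} \<Longrightarrow> Surf_x i \<in> surface_gens \<Gamma> g v"
  "i \<in> {1..g v} \<Longrightarrow> Surf_y i \<in> surface_gens \<Gamma> g v"
  by (auto simp: surface_gens_def)

lemma \<Psi>_st:
  assumes "b \<in> arcs \<Gamma>"
  shows "\<Psi> (loop (head \<Gamma> b) (s_class \<Gamma> Z K b)) = \<beta> (e (head \<Gamma> b)) \<oplus>\<^bsub>B\<^esub> \<beta> (\<iota> (Gen_p b)) \<otimes>\<^bsub>B\<^esub> \<beta> (\<iota> (Gen_q b))"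
    and "\<Psi> (loop (tail \<Gamma> b) (t_class \<Gamma> Z K b)) = \<beta> (\<iota> (Gen_t b))"
  using assms loop_image(2)[of "head \<Gamma> b" "Surf_s b"] loop_image(2)[of "tail \<Gamma> b" "Surf_t b"]
  by (simp_all add: \<Psi>_loop s_class_in_pi1 t_class_in_pi1 unit_of_gen_def)

text \<open>
  The image of \<open>t\<^sub>b\<close> equals \<open>e + q\<^sub>b p\<^sub>b\<close> by a defining relation, and that of \<open>s\<^sub>b\<close> equals \<open>e + p\<^sub>b q\<^sub>b\<close> by
  construction, so the differentials of the long chords are killed.
\<close>

lemma \<Psi>_boundaries:
  assumes "j \<in> J"
  shows "\<Psi> j = \<zero>\<^bsub>B\<^esub>"
proof -
  have "J \<subseteq> a_kernel S B Psi.extension"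
  proof (rule boundaries_subset_ideal[OF \<Psi>.kernel_is_ideal])
    fix b assume b: "b \<in> arcs \<Gamma>"
    have c: "chord_diff \<Gamma> Z K (Chord_a1 b) \<in> carrier S" "chord_diff \<Gamma> Z K (Chord_a2 b) \<in> carrier S"
      using b by (simp_all add: chord_diff_in_short del: chord_diff.simps)
    note closed = short_gens_closed(1,2)[OF b] short_gens_closed(3) short_base_closed[OF b]
    have "\<Psi> (chord_diff \<Gamma> Z K (Chord_a1 b)) = (\<beta> (e (tail \<Gamma> b)) \<ominus>\<^bsub>B\<^esub> \<beta> (\<iota> (Gen_t b))) \<oplus>\<^bsub>B\<^esub>
        \<beta> (\<iota> (Gen_q b)) \<otimes>\<^bsub>B\<^esub> \<beta> (\<iota> (Gen_p b))"
      unfolding chord_diff_long(1)[OF b]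
      by (subst \<Psi>.hom_minus_add_mult) (use b in \<open>simp_all add: closed \<Psi>_idem \<Psi>_st \<Psi>_gen\<close>)
    also have "\<dots> = \<zero>\<^bsub>B\<^esub>"
      using b by (subst B.minus_add_eq_zero_iff) (simp_all add: B_edge_relations gens_closed e_closed)
    finally show "chord_diff \<Gamma> Z K (Chord_a1 b) \<in> a_kernel S B Psi.extension"
      using c(1) unfolding a_kernel_def' by blast
    have "\<Psi> (chord_diff \<Gamma> Z K (Chord_a2 b)) =
        (\<beta> (e (head \<Gamma> b)) \<ominus>\<^bsub>B\<^esub> \<Psi> (loop (head \<Gamma> b) (s_class \<Gamma> Z K b))) \<oplus>\<^bsub>B\<^esub>
        \<beta> (\<iota> (Gen_p b)) \<otimes>\<^bsub>B\<^esub> \<beta> (\<iota> (Gen_q b))"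
      unfolding chord_diff_long(2)[OF b]
      by (subst \<Psi>.hom_minus_add_mult) (use b in \<open>simp_all add: closed \<Psi>_idem \<Psi>_gen\<close>)
    also have "\<dots> = \<zero>\<^bsub>B\<^esub>"
      using b by (subst B.minus_add_eq_zero_iff) (simp_all add: closed \<Psi>_st gens_closed e_closed)
    finally show "chord_diff \<Gamma> Z K (Chord_a2 b) \<in> a_kernel S B Psi.extension"
      using c(2) unfolding a_kernel_def' by blast
  qed
  then show ?thesis
    using assms unfolding a_kernel_def' by blast
qed

subsection \<open>From the pre-projective algebra to the homology\<close>

lemma eH_idem: "v \<in> verts \<Gamma> \<Longrightarrow> eH v \<otimes>\<^bsub>H\<^esub> eH v = eH v"
  using short.idem_mult_idem[of v] by (simp add: short_gens_closed flip: \<eta>.hom_mult)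

lemma group_UH: "v \<in> verts \<Gamma> \<Longrightarrow> group (UH v)"
  by (intro H.group_corner_units) (simp_all add: short_gens_closed eH_idem)

lemma loop_hom:
  assumes v: "v \<in> verts \<Gamma>"
  shows "group_hom (P v) (UH v) (\<lambda>\<gamma>. \<eta> (loop v \<gamma>))"
proof (intro group_hom.intro group_hom_axioms.intro homI group_pi1 group_UH v)
  interpret P: group "P v"
    using v by (rule group_pi1)
  fix \<gamma> \<gamma>' assume \<gamma>: "\<gamma> \<in> carrier (P v)"
  have ends: "eH v \<otimes>\<^bsub>H\<^esub> \<eta> (loop v \<gamma>) = \<eta> (loop v \<gamma>)" "\<eta> (loop v \<gamma>) \<otimes>\<^bsub>H\<^esub> eH v = \<eta> (loop v \<gamma>)"
    if "\<gamma> \<in> carrier (P v)" for \<gamma>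
    using v that short.idem_mult_base[of v \<gamma>] by (simp_all add: short_gens_closed flip: \<eta>.hom_mult)
  have mult: "\<eta> (loop v \<gamma>) \<otimes>\<^bsub>H\<^esub> \<eta> (loop v \<gamma>') = \<eta> (loop v (\<gamma> \<otimes>\<^bsub>P v\<^esub> \<gamma>'))"
    if "\<gamma> \<in> carrier (P v)" "\<gamma>' \<in> carrier (P v)" for \<gamma> \<gamma>'
    using v that by (simp add: short_gens_closed short.base_mult_base flip: \<eta>.hom_mult)
  show "\<eta> (loop v \<gamma>) \<in> carrier (UH v)"
    by (rule H.corner_unitsI[of _ "\<eta> (loop v (inv\<^bsub>P v\<^esub> \<gamma>))"])
      (use v \<gamma> in \<open>simp_all add: short_gens_closed ends mult idem_def\<close>)
  show "\<eta> (loop v (\<gamma> \<otimes>\<^bsub>P v\<^esub> \<gamma>')) = \<eta> (loop v \<gamma>) \<otimes>\<^bsub>UH v\<^esub> \<eta> (loop v \<gamma>')" if "\<gamma>' \<in> carrier (P v)"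
    using \<gamma> that by (simp add: mult)
qed

definition gen_image :: "('v, 'e) preproj_gen \<Rightarrow> ('v, 'e, 's) ce_elem set" where
  "gen_image c = (case c of
      Gen_p b \<Rightarrow> \<eta> (gen (short_chord_quiver \<Gamma>) P (Chord_p b))
    | Gen_q b \<Rightarrow> \<eta> (gen (short_chord_quiver \<Gamma>) P (Chord_q b))
    | Gen_t b \<Rightarrow> \<eta> (loop (tail \<Gamma> b) (t_class \<Gamma> Z K b))
    | Gen_t_inv b \<Rightarrow> \<eta> (loop (tail \<Gamma> b) (inv\<^bsub>P (tail \<Gamma> b)\<^esub> (t_class \<Gamma> Z K b)))
    | Gen_x v i \<Rightarrow> \<eta> (loop v (surface_gen_class \<Gamma> Z K v (Surf_x i)))
    | Gen_x_inv v i \<Rightarrow> \<eta> (loop v (inv\<^bsub>P v\<^esub> (surface_gen_class \<Gamma> Z K v (Surf_x i))))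
    | Gen_y v i \<Rightarrow> \<eta> (loop v (surface_gen_class \<Gamma> Z K v (Surf_y i)))
    | Gen_y_inv v i \<Rightarrow> \<eta> (loop v (inv\<^bsub>P v\<^esub> (surface_gen_class \<Gamma> Z K v (Surf_y i)))))"

lemma surface_gen_class_closed:
  "v \<in> verts \<Gamma> \<Longrightarrow> x \<in> surface_gens \<Gamma> g v \<Longrightarrow> surface_gen_class \<Gamma> Z K v x \<in> carrier (P v)"
  using presentation[of v] unfolding is_presentation_def by blast

text \<open>
  All generators but \<open>p\<^sub>b\<close> and \<open>q\<^sub>b\<close> are treated alike in the verification of the universal property,
  as loops at a vertex.
\<close>

lemma gen_image_cases:
  assumes "c \<in> arcs (preproj_quiver \<Gamma> g)"
  obtains b where "b \<in> arcs \<Gamma>" "c = Gen_p b \<or> c = Gen_q b"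
  | v \<gamma> where "v \<in> verts \<Gamma>" "\<gamma> \<in> carrier (P v)" "preproj_source \<Gamma> c = v" "preproj_target \<Gamma> c = v"
      "gen_image c = \<eta> (loop v \<gamma>)"
proof -
  have inv: "inv\<^bsub>P v\<^esub> \<gamma> \<in> carrier (P v)" if "v \<in> verts \<Gamma>" "\<gamma> \<in> carrier (P v)" for v \<gamma>
    using group.inv_closed[OF group_pi1] that by blast
  show ?thesis
  proof (cases c)
    case (Gen_x v i)
    then show ?thesis
      using assms that(2)[of v "surface_gen_class \<Gamma> Z K v (Surf_x i)"] surface_gen_class_closed[of v "Surf_x i"]
      by (auto simp: gen_image_def)
  next
    case (Gen_x_inv v i)
    then show ?thesis
      using assms that(2)[of v "inv\<^bsub>P v\<^esub> (surface_gen_class \<Gamma> Z K v (Surf_x i))"] inv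
        surface_gen_class_closed[of v "Surf_x i"]
      by (auto simp: gen_image_def)
  next
    case (Gen_y v i)
    then show ?thesis
      using assms that(2)[of v "surface_gen_class \<Gamma> Z K v (Surf_y i)"] surface_gen_class_closed[of v "Surf_y i"]
      by (auto simp: gen_image_def)
  next
    case (Gen_y_inv v i)
    then show ?thesis
      using assms that(2)[of v "inv\<^bsub>P v\<^esub> (surface_gen_class \<Gamma> Z K v (Surf_y i))"] inv
        surface_gen_class_closed[of v "Surf_y i"]
      by (auto simp: gen_image_def)
  next
    case (Gen_t b)
    then show ?thesis
      using assms that(2)[of "tail \<Gamma> b" "t_class \<Gamma> Z K b"] t_class_in_pi1[of b] by (auto simp: gen_image_def)
  next
    case (Gen_t_inv b)
    then show ?thesis
      using assms that(2)[of "tail \<Gamma> b" "inv\<^bsub>P (tail \<Gamma> b)\<^esub> (t_class \<Gamma> Z K b)"] t_class_in_pi1[of b] inv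
      by (auto simp: gen_image_def)
  qed (use assms that(1) in auto)
qed

sublocale Phi: tensor_representation "preproj_quiver \<Gamma> g" trivial_groups H "\<lambda>z. \<sigma>H z" "\<lambda>v _. eH v" gen_image
  rewrites "tensor_ring (preproj_quiver \<Gamma> g) trivial_groups = R"
proof -
  show "tensor_representation (preproj_quiver \<Gamma> g) trivial_groups H (\<lambda>z. \<sigma>H z) (\<lambda>v _. eH v) gen_image"
  proof (intro tensor_representation.intro tensor_representation_axioms.intro)
    show "quiver_with_groups (preproj_quiver \<Gamma> g) trivial_groups"
      by (rule pre.quiver_with_groups_axioms)
    show "complex_algebra H (\<lambda>z. \<sigma>H z)"
      by (rule H.complex_algebra_axioms)
    fix v w assume v: "v \<in> verts (preproj_quiver \<Gamma> g)"
    show "eH v \<in> carrier H" "eH v = eH v \<otimes>\<^bsub>H\<^esub> eH v"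
      using v by (simp_all add: short_gens_closed eH_idem)
    show "eH v \<otimes>\<^bsub>H\<^esub> eH w = \<zero>\<^bsub>H\<^esub>" if "w \<in> verts (preproj_quiver \<Gamma> g)" "v \<noteq> w"
      using that v short.idem_orthogonal[OF that(2)] by (simp add: short_gens_closed flip: \<eta>.hom_mult)
  next
    have "finsum H eH (verts \<Gamma>) = \<eta> (finsum S (idem P) (verts \<Gamma>))"
      using \<eta>.hom_finsum_family[of "verts \<Gamma>" "idem P"] by (simp add: short_gens_closed Pi_iff)
    also have "\<dots> = \<one>\<^bsub>H\<^esub>"
      using short.finsum_idem by simp
    finally show "finsum H eH (verts (preproj_quiver \<Gamma> g)) = \<one>\<^bsub>H\<^esub>"
      by simp
  next
    fix c assume c: "c \<in> arcs (preproj_quiver \<Gamma> g)"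
    have edge: "eH (head \<Gamma> b) \<otimes>\<^bsub>H\<^esub> gen_image (Gen_p b) = gen_image (Gen_p b)"
        "gen_image (Gen_p b) \<otimes>\<^bsub>H\<^esub> eH (tail \<Gamma> b) = gen_image (Gen_p b)"
        "eH (tail \<Gamma> b) \<otimes>\<^bsub>H\<^esub> gen_image (Gen_q b) = gen_image (Gen_q b)"
        "gen_image (Gen_q b) \<otimes>\<^bsub>H\<^esub> eH (head \<Gamma> b) = gen_image (Gen_q b)" if b: "b \<in> arcs \<Gamma>" for b
      using b short.idem_mult_gen[of "Chord_p b"] short.idem_mult_gen[of "Chord_q b"]
      by (simp_all add: gen_image_def short_gens_closed flip: \<eta>.hom_mult)
    have loop: "eH v \<otimes>\<^bsub>H\<^esub> \<eta> (loop v \<gamma>) = \<eta> (loop v \<gamma>)" "\<eta> (loop v \<gamma>) \<otimes>\<^bsub>H\<^esub> eH v = \<eta> (loop v \<gamma>)"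
      if "v \<in> verts \<Gamma>" "\<gamma> \<in> carrier (P v)" for v \<gamma>
      using corner_unitsD[OF group_hom.hom_closed[OF loop_hom[OF that(1)] that(2)]] by simp_all
    show "gen_image c \<in> carrier H"
      using c by (cases rule: gen_image_cases) (auto simp: gen_image_def short_gens_closed)
    show "eH (head (preproj_quiver \<Gamma> g) c) \<otimes>\<^bsub>H\<^esub> gen_image c = gen_image c"
      "gen_image c \<otimes>\<^bsub>H\<^esub> eH (tail (preproj_quiver \<Gamma> g) c) = gen_image c"
      using c by (cases rule: gen_image_cases; auto simp: edge loop)+
  qed
qed (simp add: preproj_tensor_ring_def)

abbreviation "\<Phi> \<equiv> Phi.extension"

sublocale \<Phi>: ring_hom_ring R H Phi.extension
  by (rule Phi.extension_ring_hom)

lemma \<Phi>_idem: "v \<in> verts \<Gamma> \<Longrightarrow> \<Phi> (e v) = eH v"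
  using Phi.extension_single_base[of v "()"] by (simp add: idem_def)

lemma \<Phi>_gens:
  "a \<in> arcs \<Gamma> \<Longrightarrow> \<Phi> (\<iota> (Gen_p a)) = gen_image (Gen_p a)"
  "a \<in> arcs \<Gamma> \<Longrightarrow> \<Phi> (\<iota> (Gen_q a)) = gen_image (Gen_q a)"
  "a \<in> arcs \<Gamma> \<Longrightarrow> \<Phi> (\<iota> (Gen_t a)) = gen_image (Gen_t a)"
  "a \<in> arcs \<Gamma> \<Longrightarrow> \<Phi> (\<iota> (Gen_t_inv a)) = gen_image (Gen_t_inv a)"
  "v \<in> verts \<Gamma> \<Longrightarrow> i \<in> {1..g v} \<Longrightarrow> \<Phi> (\<iota> (Gen_x v i)) = gen_image (Gen_x v i)"
  "v \<in> verts \<Gamma> \<Longrightarrow> i \<in> {1..g v} \<Longrightarrow> \<Phi> (\<iota> (Gen_x_inv v i)) = gen_image (Gen_x_inv v i)"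
  "v \<in> verts \<Gamma> \<Longrightarrow> i \<in> {1..g v} \<Longrightarrow> \<Phi> (\<iota> (Gen_y v i)) = gen_image (Gen_y v i)"
  "v \<in> verts \<Gamma> \<Longrightarrow> i \<in> {1..g v} \<Longrightarrow> \<Phi> (\<iota> (Gen_y_inv v i)) = gen_image (Gen_y_inv v i)"
  by (rule Phi.extension_gen, simp)+

lemma \<eta>_boundary: "j \<in> J \<Longrightarrow> \<eta> j = \<zero>\<^bsub>H\<^esub>"
  using J.a_rcos_const[of j] J.a_rcos_const[of "\<zero>\<^bsub>S\<^esub>"] \<eta>.hom_zero J.zero_closed by simp

text \<open>
  These are the two differentials of long chords, read in the homology.
\<close>

lemma H_edge_relations:
  assumes b: "b \<in> arcs \<Gamma>"
  shows "eH (tail \<Gamma> b) \<oplus>\<^bsub>H\<^esub> gen_image (Gen_q b) \<otimes>\<^bsub>H\<^esub> gen_image (Gen_p b) = \<eta> (loop (tail \<Gamma> b) (t_class \<Gamma> Z K b))"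
    and "eH (head \<Gamma> b) \<oplus>\<^bsub>H\<^esub> gen_image (Gen_p b) \<otimes>\<^bsub>H\<^esub> gen_image (Gen_q b) = \<eta> (loop (head \<Gamma> b) (s_class \<Gamma> Z K b))"
proof -
  note closed = short_gens_closed(1,2)[OF b] short_gens_closed(3) short_base_closed[OF b]
  have "\<eta> (chord_diff \<Gamma> Z K (Chord_a1 b)) = \<zero>\<^bsub>H\<^esub>"
    by (rule \<eta>_boundary[OF long_chord_diff_in_boundaries]) (use b in simp_all)
  then show "eH (tail \<Gamma> b) \<oplus>\<^bsub>H\<^esub> gen_image (Gen_q b) \<otimes>\<^bsub>H\<^esub> gen_image (Gen_p b) = \<eta> (loop (tail \<Gamma> b) (t_class \<Gamma> Z K b))"
    unfolding chord_diff_long(1)[OF b] using b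
    by (subst (asm) \<eta>.hom_minus_add_mult, simp_all add: closed gen_image_def)
      (subst (asm) H.minus_add_eq_zero_iff, simp_all add: closed)
  have "\<eta> (chord_diff \<Gamma> Z K (Chord_a2 b)) = \<zero>\<^bsub>H\<^esub>"
    by (rule \<eta>_boundary[OF long_chord_diff_in_boundaries]) (use b in simp_all)
  then show "eH (head \<Gamma> b) \<oplus>\<^bsub>H\<^esub> gen_image (Gen_p b) \<otimes>\<^bsub>H\<^esub> gen_image (Gen_q b) = \<eta> (loop (head \<Gamma> b) (s_class \<Gamma> Z K b))"
    unfolding chord_diff_long(2)[OF b] using b
    by (subst (asm) \<eta>.hom_minus_add_mult, simp_all add: closed gen_image_def)
      (subst (asm) H.minus_add_eq_zero_iff, simp_all add: closed)
qed

lemma H_surface_relation: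
  assumes v: "v \<in> verts \<Gamma>"
  shows "gword_value (UH v) (\<lambda>x. \<eta> (loop v (surface_gen_class \<Gamma> Z K v x))) (fst (surface_relation (g v) (ins v) (outs v))) =
    gword_value (UH v) (\<lambda>x. \<eta> (loop v (surface_gen_class \<Gamma> Z K v x))) (snd (surface_relation (g v) (ins v) (outs v)))"
proof -
  let ?r = "surface_relation (g v) (ins v) (outs v)"
  interpret h: group_hom "P v" "UH v" "\<lambda>\<gamma>. \<eta> (loop v \<gamma>)"
    using v by (rule loop_hom)
  have letters: "fst ?r \<in> lists (surface_gens \<Gamma> g v \<times> UNIV)" "snd ?r \<in> lists (surface_gens \<Gamma> g v \<times> UNIV)"
    using surface_relation_letters[OF gens_at(1,2)[OF v] gens_at(3,4)] by (auto simp: mem_Times_iff)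
  have classes: "surface_gen_class \<Gamma> Z K v ` surface_gens \<Gamma> g v \<subseteq> carrier (P v)"
    using surface_gen_class_closed[OF v] by blast
  have "gword_equiv (surface_gens \<Gamma> g v) {?r} (fst ?r) (snd ?r)"
    using gword_equiv.relation[of "fst ?r" "snd ?r" "{?r}" "surface_gens \<Gamma> g v" "[]" "[]"] by simp
  then have "gword_value (P v) (surface_gen_class \<Gamma> Z K v) (fst ?r) =
      gword_value (P v) (surface_gen_class \<Gamma> Z K v) (snd ?r)"
    using presentation[OF v] letters unfolding is_presentation_def by blast
  then show ?thesis
    using h.hom_gword_value[OF letters(1) classes] h.hom_gword_value[OF letters(2) classes]
    by (simp add: comp_def)
qed

text \<open>
  Both sides are mapped to the values of the two sides of the surface relation, by
  \<open>H_edge_relations\<close>, and these agree because the relation holds in \<open>\<pi>\<^sub>1(Q\<^sub>v)\<close>.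
\<close>

lemma \<Phi>_vertex_relation:
  assumes v: "v \<in> verts \<Gamma>"
  shows "\<Phi> (foldr (\<lambda>x y. x \<otimes>\<^bsub>R\<^esub> y) (map (\<lambda>a. e v \<oplus>\<^bsub>R\<^esub> \<iota> (Gen_p a) \<otimes>\<^bsub>R\<^esub> \<iota> (Gen_q a)) (ins v)) (e v)) =
    \<Phi> (foldr (\<lambda>x y. x \<otimes>\<^bsub>R\<^esub> y) (concat (map (\<lambda>i. [\<iota> (Gen_y v i), \<iota> (Gen_x v i), \<iota> (Gen_y_inv v i), \<iota> (Gen_x_inv v i)])
      (rev [1..<Suc (g v)]))) (e v) \<otimes>\<^bsub>R\<^esub>
      foldr (\<lambda>x y. x \<otimes>\<^bsub>R\<^esub> y) (map (\<lambda>a. e v \<oplus>\<^bsub>R\<^esub> \<iota> (Gen_q a) \<otimes>\<^bsub>R\<^esub> \<iota> (Gen_p a)) (outs v)) (e v))"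
proof -
  let ?ps = "map (\<lambda>a. e v \<oplus>\<^bsub>R\<^esub> \<iota> (Gen_p a) \<otimes>\<^bsub>R\<^esub> \<iota> (Gen_q a)) (ins v)"
  let ?qs = "map (\<lambda>a. e v \<oplus>\<^bsub>R\<^esub> \<iota> (Gen_q a) \<otimes>\<^bsub>R\<^esub> \<iota> (Gen_p a)) (outs v)"
  let ?cs = "concat (map (\<lambda>i. [\<iota> (Gen_y v i), \<iota> (Gen_x v i), \<iota> (Gen_y_inv v i), \<iota> (Gen_x_inv v i)])
      (rev [1..<Suc (g v)]))"
  let ?k = "\<lambda>x. \<eta> (loop v (surface_gen_class \<Gamma> Z K v x))"
  note closed = vertex_factors_closed[OF v] and ev = e_closed[OF v]
  interpret h: group_hom "P v" "UH v" "\<lambda>\<gamma>. \<eta> (loop v \<gamma>)"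
    using v by (rule loop_hom)
  have ps: "map \<Phi> ?ps = map (\<lambda>b. ?k (Surf_s b)) (ins v)"
    using v by (auto simp: set_ins gens_closed ev \<Phi>_idem \<Phi>_gens H_edge_relations)
  have qs: "map \<Phi> ?qs = map (\<lambda>b. ?k (Surf_t b)) (outs v)"
    using v by (auto simp: set_outs gens_closed ev \<Phi>_idem \<Phi>_gens H_edge_relations)
  have cs: "map \<Phi> ?cs = concat (map (\<lambda>i. [?k (Surf_y i), ?k (Surf_x i),
      gen_image (Gen_y_inv v i), gen_image (Gen_x_inv v i)]) (rev [1..<Suc (g v)]))"
    unfolding map_concat map_map
    by (intro arg_cong[where f = concat] map_cong HOL.refl)
      (use v in \<open>auto simp: \<Phi>_gens gen_image_def simp del: upt_Suc\<close>)
  have k: "?k ` surface_gens \<Gamma> g v \<subseteq> carrier (UH v)"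
    using surface_gen_class_closed[OF v] by (intro image_subsetI h.hom_closed)
  have inv: "inv\<^bsub>UH v\<^esub> (?k (Surf_x i)) = gen_image (Gen_x_inv v i)"
    "inv\<^bsub>UH v\<^esub> (?k (Surf_y i)) = gen_image (Gen_y_inv v i)" if "i \<in> {1..g v}" for i
    using that surface_gen_class_closed[OF v, of "Surf_x i"] surface_gen_class_closed[OF v, of "Surf_y i"]
    by (simp_all add: gen_image_def del: surface_gen_class.simps)
  have eH: "eH v \<in> carrier H" "eH v \<otimes>\<^bsub>H\<^esub> eH v = eH v"
    using v by (simp_all add: short_gens_closed eH_idem)
  note vals = H.surface_relation_values[OF eH k gens_at(1,2)[OF v] gens_at(3,4) inv]
  have "foldr (\<otimes>\<^bsub>H\<^esub>) (map \<Phi> ?ps) (eH v) =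
      foldr (\<otimes>\<^bsub>H\<^esub>) (map \<Phi> ?cs) (eH v) \<otimes>\<^bsub>H\<^esub> foldr (\<otimes>\<^bsub>H\<^esub>) (map \<Phi> ?qs) (eH v)"
    using H_surface_relation[OF v] unfolding ps qs cs by (simp only: vals)
  then show ?thesis
    by (simp only: \<Phi>.hom_mult \<Phi>.hom_foldr[OF closed(1) ev] \<Phi>.hom_foldr[OF closed(2) ev]
        \<Phi>.hom_foldr[OF closed(3) ev] \<Phi>_idem[OF v])
qed

lemma \<Phi>_relation:
  assumes "(l, r) \<in> preproj_relations \<Gamma> g ins outs"
  shows "\<Phi> l = \<Phi> r"
proof -
  have inverses: "\<eta> (loop v \<gamma>) \<otimes>\<^bsub>H\<^esub> \<eta> (loop v (inv\<^bsub>P v\<^esub> \<gamma>)) = eH v"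
      "\<eta> (loop v (inv\<^bsub>P v\<^esub> \<gamma>)) \<otimes>\<^bsub>H\<^esub> \<eta> (loop v \<gamma>) = eH v"
    if v: "v \<in> verts \<Gamma>" and \<gamma>: "\<gamma> \<in> carrier (P v)" for v \<gamma>
  proof -
    interpret h: group_hom "P v" "UH v" "\<lambda>\<gamma>. \<eta> (loop v \<gamma>)"
      using v by (rule loop_hom)
    show "\<eta> (loop v \<gamma>) \<otimes>\<^bsub>H\<^esub> \<eta> (loop v (inv\<^bsub>P v\<^esub> \<gamma>)) = eH v"
      using h.hom_mult[OF \<gamma> h.G.inv_closed[OF \<gamma>]]
      unfolding corner_units_simps h.G.r_inv[OF \<gamma>] idem_def by (rule HOL.sym)
    show "\<eta> (loop v (inv\<^bsub>P v\<^esub> \<gamma>)) \<otimes>\<^bsub>H\<^esub> \<eta> (loop v \<gamma>) = eH v"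
      using h.hom_mult[OF h.G.inv_closed[OF \<gamma>] \<gamma>]
      unfolding corner_units_simps h.G.l_inv[OF \<gamma>] idem_def by (rule HOL.sym)
  qed
  have edges: "\<Phi> (\<iota> (Gen_t a) \<otimes>\<^bsub>R\<^esub> \<iota> (Gen_t_inv a)) = \<Phi> (e (tail \<Gamma> a))"
    "\<Phi> (\<iota> (Gen_t_inv a) \<otimes>\<^bsub>R\<^esub> \<iota> (Gen_t a)) = \<Phi> (e (tail \<Gamma> a))"
    "\<Phi> (e (tail \<Gamma> a) \<oplus>\<^bsub>R\<^esub> \<iota> (Gen_q a) \<otimes>\<^bsub>R\<^esub> \<iota> (Gen_p a)) = \<Phi> (\<iota> (Gen_t a))" if "a \<in> arcs \<Gamma>" for a
    using that inverses[of "tail \<Gamma> a" "t_class \<Gamma> Z K a"] H_edge_relations[OF that]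
    by (simp_all add: gens_closed e_closed \<Phi>_idem \<Phi>_gens t_class_in_pi1 gen_image_def)
  have handles: "\<Phi> (\<iota> (Gen_x v i) \<otimes>\<^bsub>R\<^esub> \<iota> (Gen_x_inv v i)) = \<Phi> (e v)"
    "\<Phi> (\<iota> (Gen_x_inv v i) \<otimes>\<^bsub>R\<^esub> \<iota> (Gen_x v i)) = \<Phi> (e v)"
    "\<Phi> (\<iota> (Gen_y v i) \<otimes>\<^bsub>R\<^esub> \<iota> (Gen_y_inv v i)) = \<Phi> (e v)"
    "\<Phi> (\<iota> (Gen_y_inv v i) \<otimes>\<^bsub>R\<^esub> \<iota> (Gen_y v i)) = \<Phi> (e v)" if vi: "v \<in> verts \<Gamma>" "i \<in> {1..g v}" for v i
    using vi inverses[OF vi(1) surface_gen_class_closed[of v "Surf_x i"]]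
      inverses[OF vi(1) surface_gen_class_closed[of v "Surf_y i"]]
    by (simp_all add: gens_closed e_closed \<Phi>_idem \<Phi>_gens gen_image_def del: surface_gen_class.simps)
  show ?thesis
    using assms unfolding preproj_relations_def Let_def
  proof (elim UnE)
    assume "(l, r) \<in> (\<Union>a\<in>arcs \<Gamma>. {(\<iota> (Gen_t a) \<otimes>\<^bsub>R\<^esub> \<iota> (Gen_t_inv a), e (tail \<Gamma> a)),
        (\<iota> (Gen_t_inv a) \<otimes>\<^bsub>R\<^esub> \<iota> (Gen_t a), e (tail \<Gamma> a)),
        (e (tail \<Gamma> a) \<oplus>\<^bsub>R\<^esub> \<iota> (Gen_q a) \<otimes>\<^bsub>R\<^esub> \<iota> (Gen_p a), \<iota> (Gen_t a))})"
    then show ?thesis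
      by (elim UN_E insertE emptyE Pair_inject) (simp_all only: edges)
  next
    assume "(l, r) \<in> (\<Union>v\<in>verts \<Gamma>. \<Union>i\<in>{1..g v}.
        {(\<iota> (Gen_x v i) \<otimes>\<^bsub>R\<^esub> \<iota> (Gen_x_inv v i), e v), (\<iota> (Gen_x_inv v i) \<otimes>\<^bsub>R\<^esub> \<iota> (Gen_x v i), e v),
         (\<iota> (Gen_y v i) \<otimes>\<^bsub>R\<^esub> \<iota> (Gen_y_inv v i), e v), (\<iota> (Gen_y_inv v i) \<otimes>\<^bsub>R\<^esub> \<iota> (Gen_y v i), e v)})"
    then show ?thesis
      by (elim UN_E insertE emptyE Pair_inject) (simp_all only: handles)
  qed (elim UN_E insertE emptyE Pair_inject; simp only: \<Phi>_vertex_relation)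
qed

lemma \<Phi>_ideal:
  assumes "i \<in> I"
  shows "\<Phi> i = \<zero>\<^bsub>H\<^esub>"
proof -
  have "{l \<ominus>\<^bsub>R\<^esub> r |l r. (l, r) \<in> preproj_relations \<Gamma> g ins outs} \<subseteq> a_kernel R H Phi.extension"
  proof
    fix d assume "d \<in> {l \<ominus>\<^bsub>R\<^esub> r |l r. (l, r) \<in> preproj_relations \<Gamma> g ins outs}"
    then obtain l r where d: "d = l \<ominus>\<^bsub>R\<^esub> r" and lr: "(l, r) \<in> preproj_relations \<Gamma> g ins outs"
      by blast
    then have c: "l \<in> carrier R" "r \<in> carrier R"
      using preproj_relations_closed by blast+
    then have "\<Phi> d = \<zero>\<^bsub>H\<^esub>"
      using \<Phi>_relation[OF lr] by (simp add: d a_minus_def H.r_neg)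
    moreover have "d \<in> carrier R"
      using c by (simp add: d)
    ultimately show "d \<in> a_kernel R H Phi.extension"
      unfolding a_kernel_def' by blast
  qed
  then have "I \<subseteq> a_kernel R H Phi.extension"
    unfolding preproj_ideal_def by (rule pre.tensor.genideal_minimal[OF \<Phi>.kernel_is_ideal])
  then show ?thesis
    using assms unfolding a_kernel_def' by blast
qed

subsection \<open>The two homomorphisms are mutually inverse\<close>

lemma loop_inv_image:
  assumes "v \<in> verts \<Gamma>" "\<gamma> \<in> carrier (P v)"
  shows "\<Psi> (loop v (inv\<^bsub>P v\<^esub> \<gamma>)) = inv\<^bsub>UB v\<^esub> (loop_image v \<gamma>)"
  using assms group.inv_closed[OF group_pi1] group_hom.hom_inv[OF loop_image(1)] by (simp add: \<Psi>_loop)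

lemma \<Psi>_surface_gen:
  assumes "v \<in> verts \<Gamma>" "x \<in> surface_gens \<Gamma> g v"
  shows "\<Psi> (loop v (surface_gen_class \<Gamma> Z K v x)) = unit_of_gen v x"
    and "\<Psi> (loop v (inv\<^bsub>P v\<^esub> (surface_gen_class \<Gamma> Z K v x))) = inv\<^bsub>UB v\<^esub> (unit_of_gen v x)"
  using assms surface_gen_class_closed[OF assms]
  by (simp_all add: loop_inv_image \<Psi>_loop loop_image(2))

text \<open>
  The two sides are homomorphisms on a tensor ring and are compared on its generators. For the formal
  inverses this uses that group homomorphisms preserve inverses.
\<close>

lemma left_inverse:
  assumes \<psi>: "ring_hom_ring H B \<psi>" "\<And>y. y \<in> carrier S \<Longrightarrow> \<psi> (\<eta> y) = \<Psi> y"
    and x: "x \<in> carrier R"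
  shows "\<psi> (\<Phi> x) = \<beta> x"
proof (rule pre.tensor_hom_eqI[OF ring_hom_ring_comp[OF \<Phi>.ring_hom_ring_axioms \<psi>(1)] \<beta>.ring_hom_ring_axioms _ _ x])
  interpret \<psi>: ring_hom_ring H B \<psi> by (rule \<psi>(1))
  fix v \<gamma> z assume v: "v \<in> verts (preproj_quiver \<Gamma> g)" "\<gamma> \<in> carrier (trivial_groups v)"
  have "\<Phi> (scaled_word z (Base v \<gamma>)) = \<sigma>H z \<otimes>\<^bsub>H\<^esub> eH v"
    by (rule Phi.extension_base[OF v])
  then have "\<psi> (\<Phi> (scaled_word z (Base v \<gamma>))) = \<Psi> (scalar (short_chord_quiver \<Gamma>) P z) \<otimes>\<^bsub>B\<^esub> \<Psi> (idem P v)"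
    using v by (simp add: short_gens_closed \<psi>(2))
  also have "\<dots> = \<sigma>B z \<otimes>\<^bsub>B\<^esub> \<beta> (e v)"
    using v by (simp add: Psi.extension_scalar \<Psi>_idem)
  also have "\<dots> = \<beta> (scaled_word z (Base v \<gamma>))"
    using v pre.scaled_word_eq[of "Base v \<gamma>" z] by (simp add: e_closed idem_def)
  finally show "\<psi> (\<Phi> (scaled_word z (Base v \<gamma>))) = \<beta> (scaled_word z (Base v \<gamma>))" .
next
  fix c assume c: "c \<in> arcs (preproj_quiver \<Gamma> g)"
  have edge: "\<psi> (gen_image (Gen_p b)) = \<beta> (\<iota> (Gen_p b))" "\<psi> (gen_image (Gen_q b)) = \<beta> (\<iota> (Gen_q b))"
    "\<psi> (gen_image (Gen_t b)) = \<beta> (\<iota> (Gen_t b))" "\<psi> (gen_image (Gen_t_inv b)) = \<beta> (\<iota> (Gen_t_inv b))"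
    if b: "b \<in> arcs \<Gamma>" for b
    using b \<Psi>_surface_gen[of "tail \<Gamma> b" "Surf_t b"] group.inv_closed[OF group_pi1, of "tail \<Gamma> b" "t_class \<Gamma> Z K b"]
    by (simp_all add: gen_image_def short_gens_closed \<psi>(2) t_class_in_pi1 \<Psi>_gen \<Psi>_st unit_of_gen_inv_t)
  have handle: "\<psi> (gen_image (Gen_x v i)) = \<beta> (\<iota> (Gen_x v i))" "\<psi> (gen_image (Gen_x_inv v i)) = \<beta> (\<iota> (Gen_x_inv v i))"
    "\<psi> (gen_image (Gen_y v i)) = \<beta> (\<iota> (Gen_y v i))" "\<psi> (gen_image (Gen_y_inv v i)) = \<beta> (\<iota> (Gen_y_inv v i))"
    if vi: "v \<in> verts \<Gamma>" "i \<in> {1..g v}" for v i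
  proof -
    have "surface_gen_class \<Gamma> Z K v x \<in> carrier (P v)" "inv\<^bsub>P v\<^esub> (surface_gen_class \<Gamma> Z K v x) \<in> carrier (P v)"
      if "x \<in> surface_gens \<Gamma> g v" for x
      using surface_gen_class_closed[OF vi(1) that] group.inv_closed[OF group_pi1[OF vi(1)]] by blast+
    then show "\<psi> (gen_image (Gen_x v i)) = \<beta> (\<iota> (Gen_x v i))" "\<psi> (gen_image (Gen_x_inv v i)) = \<beta> (\<iota> (Gen_x_inv v i))"
      "\<psi> (gen_image (Gen_y v i)) = \<beta> (\<iota> (Gen_y v i))" "\<psi> (gen_image (Gen_y_inv v i)) = \<beta> (\<iota> (Gen_y_inv v i))"
      using vi unit_of_gen_inv[OF vi]
      by (simp_all add: gen_image_def short_gens_closed \<psi>(2) \<Psi>_surface_gen del: surface_gen_class.simps)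
        (simp_all add: unit_of_gen_def)
  qed
  show "\<psi> (\<Phi> (\<iota> c)) = \<beta> (\<iota> c)"
    unfolding Phi.extension_gen[OF c] using c by (auto simp: edge handle)
qed

text \<open>
  On the loops at \<open>v\<close>, both sides are homomorphisms on \<open>\<pi>\<^sub>1(Q\<^sub>v)\<close>, so they need to be compared on the
  generators of the presentation only.
\<close>

lemma right_inverse:
  assumes \<phi>: "ring_hom_ring B H \<phi>" "\<And>x. x \<in> carrier R \<Longrightarrow> \<phi> (\<beta> x) = \<Phi> x"
    and y: "y \<in> carrier S"
  shows "\<phi> (\<Psi> y) = \<eta> y"
proof (rule short.tensor_hom_eqI[OF ring_hom_ring_comp[OF \<Psi>.ring_hom_ring_axioms \<phi>(1)] \<eta>.ring_hom_ring_axioms _ _ y])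
  interpret \<phi>: ring_hom_ring B H \<phi> by (rule \<phi>(1))
  have gens: "\<phi> (\<beta> (\<iota> (Gen_p b))) = gen_image (Gen_p b)" "\<phi> (\<beta> (\<iota> (Gen_q b))) = gen_image (Gen_q b)" if "b \<in> arcs \<Gamma>" for b
    using that by (simp_all add: \<phi>(2) gens_closed \<Phi>_gens)
  fix v \<gamma> z assume v: "v \<in> verts (short_chord_quiver \<Gamma>)" and \<gamma>: "\<gamma> \<in> carrier (P v)"
  have \<phi>e: "\<phi> (\<beta> (e v)) = eH v"
    using v by (simp add: \<phi>(2) e_closed \<Phi>_idem)
  have loop: "\<phi> (loop_image v \<gamma>) = \<eta> (loop v \<gamma>)"
  proof (rule presented_group_hom_unique[OF _ loop_hom presentation _ \<gamma>])
    have "\<phi> \<in> hom (UB v) (UH v)"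
      using \<phi>.hom_corner_units[of "\<beta> (e v)"] v by (simp add: \<phi>e e_closed)
    then show "group_hom (P v) (UH v) (\<lambda>\<gamma>. \<phi> (loop_image v \<gamma>))"
      using group_hom.homh[OF loop_image(1)] v group_pi1 group_UH
        hom_compose[of "loop_image v" "P v" "UB v" \<phi> "UH v"]
      by (intro group_hom.intro group_hom_axioms.intro) (simp_all add: comp_def)
    fix x assume x: "x \<in> surface_gens \<Gamma> g v"
    have "\<phi> (unit_of_gen v x) = \<eta> (loop v (surface_gen_class \<Gamma> Z K v x))"
      using x v by (auto simp: surface_gens_def unit_of_gen_def gens \<phi>e \<phi>(2) \<Phi>_idem gens_closed e_closed \<Phi>_gens gen_image_def[of "Gen_t _"]
          gen_image_def[of "Gen_x _ _"] gen_image_def[of "Gen_y _ _"] H_edge_relations)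
    then show "\<phi> (loop_image v (surface_gen_class \<Gamma> Z K v x)) = \<eta> (loop v (surface_gen_class \<Gamma> Z K v x))"
      using v x by (simp add: loop_image(2))
  qed (use v in simp_all)
  have "\<Psi> (scaled_word z (Base v \<gamma>)) = \<sigma>B z \<otimes>\<^bsub>B\<^esub> loop_image v \<gamma>"
    by (rule Psi.extension_base[OF v \<gamma>])
  then have "\<phi> (\<Psi> (scaled_word z (Base v \<gamma>))) = \<Phi> (scalar (preproj_quiver \<Gamma> g) trivial_groups z) \<otimes>\<^bsub>H\<^esub> \<eta> (loop v \<gamma>)"
    using Psi.\<rho>_closed[OF v \<gamma>] by (simp add: \<phi>(2) loop)
  also have "\<dots> = \<sigma>H z \<otimes>\<^bsub>H\<^esub> \<eta> (loop v \<gamma>)"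
    by (simp add: Phi.extension_scalar)
  also have "\<dots> = \<eta> (scaled_word z (Base v \<gamma>))"
    using v \<gamma> short.scaled_word_eq[of "Base v \<gamma>" z] by (simp add: short_gens_closed)
  finally show "\<phi> (\<Psi> (scaled_word z (Base v \<gamma>))) = \<eta> (scaled_word z (Base v \<gamma>))" .
next
  fix c assume "c \<in> arcs (short_chord_quiver \<Gamma>)"
  then obtain b where "b \<in> arcs \<Gamma>" "c = Chord_p b \<or> c = Chord_q b"
    by auto
  then show "\<phi> (\<Psi> (gen (short_chord_quiver \<Gamma>) P c)) = \<eta> (gen (short_chord_quiver \<Gamma>) P c)"
    by (auto simp: \<Psi>_gen \<phi>(2) gens_closed \<Phi>_gens gen_image_def)
qed

lemma isomorphic_over_k_preproj_homology:
  "isomorphic_over_k (verts \<Gamma>) B (preproj_of_k \<Gamma> g ins outs) H (CE_homology0_of_k \<Gamma> Z K)"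
proof -
  obtain \<phi> where \<phi>: "ring_hom_ring B H \<phi>" "\<And>x. x \<in> carrier R \<Longrightarrow> \<phi> (\<beta> x) = \<Phi> x"
    using I.quotient_hom[OF \<Phi>.ring_hom_ring_axioms \<Phi>_ideal, folded B_eq] by blast
  obtain \<psi> where \<psi>: "ring_hom_ring H B \<psi>" "\<And>y. y \<in> carrier S \<Longrightarrow> \<psi> (\<eta> y) = \<Psi> y"
    using J.quotient_hom[OF \<Psi>.ring_hom_ring_axioms \<Psi>_boundaries, folded H_eq] by blast
  interpret \<phi>: ring_hom_ring B H \<phi> by (rule \<phi>(1))
  interpret \<psi>: ring_hom_ring H B \<psi> by (rule \<psi>(1))
  have "\<psi> (\<phi> X) = X" if X: "X \<in> carrier B" for X
  proof -
    obtain x where "x \<in> carrier R" "X = \<beta> x"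
      using X unfolding B_eq by (metis I.quotient_cases)
    then show ?thesis
      using left_inverse[OF \<psi>] by (simp add: \<phi>(2))
  qed
  moreover have "\<phi> (\<psi> Y) = Y" if Y: "Y \<in> carrier H" for Y
  proof -
    obtain y where "y \<in> carrier S" "Y = \<eta> y"
      using Y unfolding H_eq by (metis J.quotient_cases)
    then show ?thesis
      using right_inverse[OF \<phi>] by (simp add: \<psi>(2))
  qed
  ultimately have "bij_betw \<phi> (carrier B) (carrier H)"
    by (intro bij_betw_byWitness[where f' = \<psi>]) auto
  then have "\<phi> \<in> ring_iso B H"
    using \<phi>.homh by (simp add: ring_iso_def)
  moreover have "\<phi> (preproj_of_k \<Gamma> g ins outs v z) = CE_homology0_of_k \<Gamma> Z K v z" if v: "v \<in> verts \<Gamma>" for v z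
  proof -
    have "\<phi> (preproj_of_k \<Gamma> g ins outs v z) = \<Phi> (scaled_word z (Base v ()))"
      using v pre.scaled_word_carrier[of "Base v ()" z] by (simp add: preproj_of_k_def \<phi>(2))
    also have "\<dots> = \<sigma>H z \<otimes>\<^bsub>H\<^esub> eH v"
      using v Phi.extension_base[of v "()" z] by simp
    also have "\<dots> = \<eta> (scaled_word z (Base v \<one>\<^bsub>P v\<^esub>))"
      using v short.scaled_word_eq[of "Base v \<one>\<^bsub>P v\<^esub>" z] short.one_at[of v]
      by (simp add: short_gens_closed idem_def)
    finally show ?thesis
      by (simp add: CE_homology0_of_k_def CE_cycles0_eq)
  qed
  ultimately show ?thesis
    unfolding isomorphic_over_k_def by blast
qed

end

section \<open>The isomorphism\<close>

theorem proposition3p15: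
  fixes \<Gamma> :: "('v, 'e) pre_digraph"
    and g :: "'v \<Rightarrow> nat"
    and ins outs :: "'v \<Rightarrow> 'e list"
    and Z :: "('v, 'e, 's::topological_space) zero_section"
    and K :: "('v, 'e, 's) capping_system"
  assumes "fin_digraph \<Gamma>"
    and "edge_orders \<Gamma> ins outs"
    and "plumbing_zero_section \<Gamma> g Z"
    and "adapted_capping_system \<Gamma> g ins outs Z K"
  shows "isomorphic_over_k (verts \<Gamma>)
           (preproj_algebra \<Gamma> g ins outs) (preproj_of_k \<Gamma> g ins outs)
           (CE_homology0 \<Gamma> Z K) (CE_homology0_of_k \<Gamma> Z K)"
proof -
  interpret fin_digraph \<Gamma> by fact
  have presentation: "is_presentation (pi1 \<Gamma> Z K v) (surface_gens \<Gamma> g v) (surface_gen_class \<Gamma> Z K v)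
      {surface_relation (g v) (ins v) (outs v)}" if "v \<in> verts \<Gamma>" for v
    using that assms(4) unfolding adapted_capping_system_def by blast
  have closed: "surface_gen_class \<Gamma> Z K v x \<in> carrier (pi1 \<Gamma> Z K v)"
    if "v \<in> verts \<Gamma>" "x \<in> surface_gens \<Gamma> g v" for v x
    using presentation[OF that(1)] that(2) unfolding is_presentation_def by blast
  interpret capped_plumbing \<Gamma> Z K g ins outs
  proof (intro capped_plumbing.intro capped_hopf_links.intro capped_hopf_links_axioms.intro
      capped_plumbing_axioms.intro assms(1))
    show "Group.group (pi1 \<Gamma> Z K v)" if "v \<in> verts \<Gamma>" for v
      unfolding pi1_def
      by (rule group_fundamental_group) (use that assms(4) in \<open>auto simp: adapted_capping_system_def\<close>)
    show "s_class \<Gamma> Z K b \<in> carrier (pi1 \<Gamma> Z K (head \<Gamma> b))" if "b \<in> arcs \<Gamma>" for b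
      using that closed[of "head \<Gamma> b" "Surf_s b"] by (auto simp: surface_gens_def)
    show "t_class \<Gamma> Z K b \<in> carrier (pi1 \<Gamma> Z K (tail \<Gamma> b))" if "b \<in> arcs \<Gamma>" for b
      using that closed[of "tail \<Gamma> b" "Surf_t b"] by (auto simp: surface_gens_def)
  qed (use assms(2) presentation in \<open>auto simp: edge_orders_def\<close>)
  show ?thesis
    by (rule isomorphic_over_k_preproj_homology)
qed

end
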